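(* Let $n\ge2$, $\lambda>0$, let $M$ be the space of smooth immersed closed curves $c:S^1\to\mathbb{R}^n$, let $d=d_{H^2}$ be the geometric distance induced by the $H^2$ metric on $M$, and let $E(c)=\int_{S^1}|D_s^2c|^2\,ds$. Then: (1) $E$ is locally Lipschitz in $M$ with respect to $d$, and the local Lipschitz constant depends on the length of $c$. (2) All non-constant curves in the completion of the space of smooth curves according to the metric $H^2$ admit curvature as a measurable function, and the curvature satisfies $E(c)<\infty$. That is: if $(c_k)$ is a sequence in $M$ that is Cauchy with respect to $d$ and $c:S^1\to\mathbb{R}^n$ is a non-constant rectifiable curve with $d_f(c_k,c)\to0$, then $c$ admits curvature $D_s^2c$ in the weak sense and $E(c)<\infty$. (3) Conversely, any non-constant rectifiable closed curve $c:S^1\to\mathbb{R}^n$ admitting curvature in the weak sense and satisfying $E(c)<\infty$ is approximable by smooth curves according to the metric $H^2$; that is, there is a sequence $(c_k)$ in $M$ that is Cauchy with respect to $d$ and satisfies $d_f(c_k,c)\to0$.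
   Context: For $c\in M$ let $L=\mathrm{len}(c)=\int_{S^1}|\dot c(\theta)|\,d\theta$, $ds=|\dot c(\theta)|\,d\theta$, $D_s=\frac1{|\dot c|}\partial_\theta$. For a smooth vector field $h:S^1\to\mathbb{R}^n$ along $c$, $$\|h\|_{H^2}^2=\frac1L\int_{S^1}|h|^2\,ds+\lambda L^3\int_{S^1}|D_s^2h|^2\,ds .$$ For $c_0,c_1\in M$, $d_{H^2}(c_0,c_1)$ is the infimum of $\int_0^1\|\partial_vC(\cdot,v)\|_{H^2}\,dv$ (the norm at time $v$ being computed with respect to the curve $C(\cdot,v)$) over all smooth homotopies $C:S^1\times[0,1]\to\mathbb{R}^n$ with every $C(\cdot,v)$ immersed, $C(u,0)=c_0(u)$, and $C(u,1)=c_1(\phi(u))$ for some $\phi\in\mathrm{Diff}(S^1)$ (smooth diffeomorphism of $S^1$); the infimum of the empty set is $+\infty$. Locally Lipschitz with respect to $d$: every $c\in M$ has a $d$-neighbourhood on which $E$ is Lipschitz with respect to $d$. For continuous closed curves, $d_f(c_0,c_1)=\inf_{\phi\in\mathrm{Diff}(S^1)}\sup_u|c_1(\phi(u))-c_0(u)|$. A rectifiable closed curve is a continuous map $c:S^1\to\mathbb{R}^n$ of finite length. A non-constant rectifiable closed curve $c$ admits curvature in the weak sense if its arc-parameter representation (as a periodic function of arc length $s\in\mathbb{R}/\mathrm{len}(c)\mathbb{Z}$) has a weak second derivative, denoted $D_s^2c$, which is a measurable (locally integrable) function; then $E(c)=\int|D_s^2c|^2\,ds$.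
   Formalization: In (1), the local Lipschitz constant is taken as K(len(c))·(1+E(c)) with one function K for all curves; a constant depending on the length alone is impossible, as k-fold covered circles of fixed length show. *)

theory Defs
  imports "HOL-Analysis.Analysis"
begin

text \<open>
  The circle is modelled as \<^term>\<open>\<real>\<close> modulo \<^term>\<open>2 * pi\<close>: maps on it are
  \<^term>\<open>2 * pi\<close>-periodic functions on \<^typ>\<open>real\<close>.
\<close>

definition periodic :: "real \<Rightarrow> (real \<Rightarrow> 'a) \<Rightarrow> bool" where
  "periodic p f \<longleftrightarrow> (\<forall>x. f (x + p) = f x)"


section \<open>Smoothness\<close>

text \<open>
  Only sets \<open>S\<close> that are convex with nonempty interior are used below (\<open>UNIV\<close> and the strip
  \<open>UNIV \<times> {0..1}\<close>); for these the derivative within \<open>S\<close> is unique, so that the choice in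
  \<^const>\<open>frechet_derivative\<close> is harmless. On the boundary of the strip derivatives are one-sided.
\<close>

primrec Ck_on :: "nat \<Rightarrow> 'a::real_normed_vector set \<Rightarrow> ('a \<Rightarrow> 'b::real_normed_vector) \<Rightarrow> bool" where
  "Ck_on 0 S f \<longleftrightarrow> continuous_on S f"
| "Ck_on (Suc k) S f \<longleftrightarrow>
     f differentiable_on S \<and> (\<forall>w. Ck_on k S (\<lambda>x. frechet_derivative f (at x within S) w))"

definition smooth_on :: "'a::real_normed_vector set \<Rightarrow> ('a \<Rightarrow> 'b::real_normed_vector) \<Rightarrow> bool" where
  "smooth_on S f \<longleftrightarrow> (\<forall>k. Ck_on k S f)"


section \<open>Smooth immersed closed curves and the $H^2$ metric\<close>

definition immersed_curves :: "(real \<Rightarrow> 'a::euclidean_space) set" where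
  "immersed_curves =
     {c. periodic (2 * pi) c \<and> smooth_on UNIV c \<and> (\<forall>u. vector_derivative c (at u) \<noteq> 0)}"

text \<open>
  Diffeomorphisms of the circle, given by their lifts to the real line; both
  orientations are included.
\<close>

definition diff_circle :: "(real \<Rightarrow> real) set" where
  "diff_circle =
     {\<phi>. bij \<phi> \<and> smooth_on UNIV \<phi> \<and> smooth_on UNIV (inv \<phi>) \<and>
         ((\<forall>u. \<phi> (u + 2 * pi) = \<phi> u + 2 * pi) \<or> (\<forall>u. \<phi> (u + 2 * pi) = \<phi> u - 2 * pi))}"

definition speed :: "(real \<Rightarrow> 'a::euclidean_space) \<Rightarrow> real \<Rightarrow> real" where
  "speed c u = norm (vector_derivative c (at u))"

definition len :: "(real \<Rightarrow> 'a::euclidean_space) \<Rightarrow> real" where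
  "len c = integral {0..2 * pi} (speed c)"

definition Ds :: "(real \<Rightarrow> 'a::euclidean_space) \<Rightarrow> (real \<Rightarrow> 'a) \<Rightarrow> real \<Rightarrow> 'a" where
  "Ds c h u = (1 / speed c u) *\<^sub>R vector_derivative h (at u)"

text \<open>Integration of a scalar function along \<open>c\<close> with respect to arc length \<open>ds\<close>.\<close>

definition integral_ds :: "(real \<Rightarrow> 'a::euclidean_space) \<Rightarrow> (real \<Rightarrow> real) \<Rightarrow> real" where
  "integral_ds c f = integral {0..2 * pi} (\<lambda>u. f u * speed c u)"

definition H2_norm :: "real \<Rightarrow> (real \<Rightarrow> 'a::euclidean_space) \<Rightarrow> (real \<Rightarrow> 'a) \<Rightarrow> real" where
  "H2_norm lam c h =
     sqrt (1 / len c * integral_ds c (\<lambda>u. (norm (h u))\<^sup>2)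
           + lam * len c ^ 3 * integral_ds c (\<lambda>u. (norm (Ds c (Ds c h) u))\<^sup>2))"

definition homotopies ::
  "(real \<Rightarrow> 'a::euclidean_space) \<Rightarrow> (real \<Rightarrow> 'a) \<Rightarrow> (real \<times> real \<Rightarrow> 'a) set" where
  "homotopies c0 c1 =
     {C. smooth_on (UNIV \<times> {0..1}) C \<and>
         (\<forall>v\<in>{0..1}. (\<lambda>u. C (u, v)) \<in> immersed_curves) \<and>
         (\<forall>u. C (u, 0) = c0 u) \<and>
         (\<exists>\<phi>\<in>diff_circle. \<forall>u. C (u, 1) = c1 (\<phi> u))}"

definition homotopy_length :: "real \<Rightarrow> (real \<times> real \<Rightarrow> 'a::euclidean_space) \<Rightarrow> real" where
  "homotopy_length lam C =
     integral {0..1} (\<lambda>v. H2_norm lam (\<lambda>u. C (u, v))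
                            (\<lambda>u. vector_derivative (\<lambda>w. C (u, w)) (at v within {0..1})))"

text \<open>The value is \<open>\<infinity>\<close> if there is no homotopy.\<close>

definition H2_dist :: "real \<Rightarrow> (real \<Rightarrow> 'a::euclidean_space) \<Rightarrow> (real \<Rightarrow> 'a) \<Rightarrow> ennreal" where
  "H2_dist lam c0 c1 = (INF C\<in>homotopies c0 c1. ennreal (homotopy_length lam C))"

definition H2_Cauchy :: "real \<Rightarrow> (nat \<Rightarrow> real \<Rightarrow> 'a::euclidean_space) \<Rightarrow> bool" where
  "H2_Cauchy lam cs \<longleftrightarrow>
     (\<forall>\<epsilon>::real>0. \<exists>N. \<forall>i\<ge>N. \<forall>j\<ge>N. H2_dist lam (cs i) (cs j) < ennreal \<epsilon>)"

definition energy :: "(real \<Rightarrow> 'a::euclidean_space) \<Rightarrow> real" where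
  "energy c = integral_ds c (\<lambda>u. (norm (Ds c (Ds c c) u))\<^sup>2)"

text \<open>
  \<open>f\<close> is Lipschitz with constant \<open>K\<close>, with respect to the distance \<open>d\<close> on \<open>M\<close>,
  on some \<open>d\<close>-ball around \<open>x\<close>.
\<close>

definition lipschitz_near ::
  "('c \<Rightarrow> 'c \<Rightarrow> ennreal) \<Rightarrow> 'c set \<Rightarrow> ('c \<Rightarrow> real) \<Rightarrow> 'c \<Rightarrow> real \<Rightarrow> bool" where
  "lipschitz_near d M f x K \<longleftrightarrow>
     (\<exists>\<delta>::real>0. \<forall>y\<in>M. \<forall>z\<in>M. d x y < ennreal \<delta> \<longrightarrow> d x z < ennreal \<delta> \<longrightarrow>
        ennreal \<bar>f y - f z\<bar> \<le> ennreal K * d y z)"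


section \<open>Rectifiable closed curves and weak curvature\<close>

definition frechet_dist :: "(real \<Rightarrow> 'a::euclidean_space) \<Rightarrow> (real \<Rightarrow> 'a) \<Rightarrow> ennreal" where
  "frechet_dist c0 c1 = (INF \<phi>\<in>diff_circle. SUP u. ennreal (norm (c1 (\<phi> u) - c0 u)))"

definition arc_length :: "(real \<Rightarrow> 'a::euclidean_space) \<Rightarrow> real \<Rightarrow> real \<Rightarrow> ennreal" where
  "arc_length c a b =
     (SUP xs\<in>{xs. sorted xs \<and> set xs \<subseteq> {a..b}}.
        \<Sum>i<length xs - 1. ennreal (dist (c (xs ! i)) (c (xs ! Suc i))))"

definition rectifiable_closed_curve :: "(real \<Rightarrow> 'a::euclidean_space) \<Rightarrow> bool" where
  "rectifiable_closed_curve c \<longleftrightarrow>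
     periodic (2 * pi) c \<and> continuous_on UNIV c \<and> arc_length c 0 (2 * pi) < \<infinity>"

definition total_length :: "(real \<Rightarrow> 'a::euclidean_space) \<Rightarrow> real" where
  "total_length c = enn2real (arc_length c 0 (2 * pi))"

text \<open>
  For a non-constant rectifiable closed curve \<open>c\<close> exactly one \<open>\<gamma>\<close> satisfies this, because
  arc length, as a function of the parameter, maps \<open>{0..2 * pi}\<close> onto \<open>{0..total_length c}\<close>.
\<close>

definition arc_parametrization :: "(real \<Rightarrow> 'a::euclidean_space) \<Rightarrow> (real \<Rightarrow> 'a) \<Rightarrow> bool" where
  "arc_parametrization c \<gamma> \<longleftrightarrow>
     periodic (total_length c) \<gamma> \<and> (\<forall>u\<in>{0..2 * pi}. \<gamma> (enn2real (arc_length c 0 u)) = c u)"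

text \<open>
  Weak second derivative on the circle of length \<open>p\<close>; the test functions are
  smooth and \<open>p\<close>-periodic (not compactly supported in the open interval), so no concentrated
  curvature at the base point is overlooked.
\<close>

definition weak_second_derivative ::
  "real \<Rightarrow> (real \<Rightarrow> 'a::euclidean_space) \<Rightarrow> (real \<Rightarrow> 'a) \<Rightarrow> bool" where
  "weak_second_derivative p \<gamma> k \<longleftrightarrow>
     periodic p k \<and> k absolutely_integrable_on {0..p} \<and>
     (\<forall>\<psi>::real \<Rightarrow> real. smooth_on UNIV \<psi> \<and> periodic p \<psi> \<longrightarrow>
        integral {0..p} (\<lambda>s. deriv (deriv \<psi>) s *\<^sub>R \<gamma> s) = integral {0..p} (\<lambda>s. \<psi> s *\<^sub>R k s))"

definition weak_curvature :: "(real \<Rightarrow> 'a::euclidean_space) \<Rightarrow> (real \<Rightarrow> 'a) \<Rightarrow> bool" where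
  "weak_curvature c k \<longleftrightarrow>
     (\<exists>\<gamma>. arc_parametrization c \<gamma> \<and> weak_second_derivative (total_length c) \<gamma> k)"

text \<open>
  The energy \<open>E(c)\<close>, expressed through the weak curvature \<open>k\<close> of \<open>c\<close>; \<open>k\<close> is unique up to null sets.
\<close>

definition weak_energy :: "(real \<Rightarrow> 'a::euclidean_space) \<Rightarrow> (real \<Rightarrow> 'a) \<Rightarrow> ennreal" where
  "weak_energy c k = (\<integral>\<^sup>+ s\<in>{0..total_length c}. ennreal ((norm (k s))\<^sup>2) \<partial>lebesgue)"

definition nonconstant :: "('b \<Rightarrow> 'c) \<Rightarrow> bool" where
  "nonconstant c \<longleftrightarrow> (\<exists>u v. c u \<noteq> c v)"

end

theory Submission
  imports Defs
begin

text \<open>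
  Throughout, \<open>L\<close> is the length of the curve at hand, \<open>E\<close> its energy and \<open>N = \<parallel>h\<parallel>\<close> the \<open>H\<^sup>2\<close> norm of
  the velocity \<open>h\<close> of a homotopy. The whole theorem rests on one interpolation inequality
  (\<open>arc_derivative_bound\<close>): on a closed curve \<open>D\<^sub>s h\<close> has mean zero, hence
  \<open>\<bar>D\<^sub>s h\<bar>\<^sup>2 \<le> L \<integral>\<bar>D\<^sub>s\<^sup>2 h\<bar>\<^sup>2 ds\<close> pointwise, and the right-hand side is at most \<open>N\<^sup>2 / (\<lambda> L\<^sup>2)\<close>.

  Local Lipschitz continuity of the energy comes from its first variation. Along a homotopy the energy density \<open>\<bar>D\<^sub>s\<^sup>2c\<bar>\<^sup>2 ds\<close> varies by
  \<open>2 \<langle>D\<^sub>s\<^sup>2c, D\<^sub>s\<^sup>2h\<rangle> - 3 \<langle>D\<^sub>sh, D\<^sub>sc\<rangle> \<bar>D\<^sub>s\<^sup>2c\<bar>\<^sup>2\<close> times \<open>ds\<close>; second derivatives of \<open>h\<close> enter only in the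
  first term, as \<open>D\<^sub>s\<^sup>2c\<close> is normal to the curve (\<open>energy_density_has_vector_derivative\<close>). With the interpolation inequality this
  gives \<open>\<bar>L'\<bar> \<le> N / \<surd>\<lambda>\<close> and \<open>\<bar>(ln (1 + E))'\<bar> \<le> k N\<close>, where \<open>k\<close> depends on \<open>\<lambda>\<close> and a lower bound for \<open>L\<close>.
  Integrating, a homotopy that is short compared with \<open>L\<close> changes \<open>L\<close> and \<open>ln (1 + E)\<close> by at most a multiple
  of its length (\<open>homotopy_estimates\<close>). Homotopies that are not short are harmless, because \<open>E\<close> is bounded on
  the ball (\<open>energy_lipschitz_near\<close>).

  That limits have square integrable curvature is a matter of compactness. A sequence that is Cauchy for \<open>H\<^sup>2\<close> and converges
  to a non-constant curve has lengths bounded below and therefore bounded energies. Bounded energy makes the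
  unit tangents uniformly Hoelder continuous, so short arcs are almost as short as their chords, and
  the arc lengths of the curves converge to the arc length of the limit (\<open>arc_length_limit\<close>). Hence the
  constant-speed parametrizations converge uniformly to the arc-length parametrization \<open>\<gamma>\<close> of the limit,
  with bounded \<open>L\<^sup>2\<close> norms of the second derivatives. Among smooth loops uniformly close to \<open>\<gamma>\<close>, those
  that nearly minimize the \<open>L\<^sup>2\<close> norm of the second derivative have second derivatives that form a Cauchy
  sequence in \<open>L\<^sup>2\<close>, by the parallelogram law (\<open>minimizing_loops\<close>); the limit of these is the
  weak second derivative of \<open>\<gamma>\<close> (\<open>weak_second_derivative_exists\<close>).

  Conversely, curves with square integrable curvature are approximated by mollification. Mollifying \<open>\<gamma>\<close> mollifies its weak second derivative
  and does not increase its \<open>L\<^sup>2\<close> norm (\<open>approximation_of_weak_curvature\<close>). So \<open>\<gamma>\<close> satisfies the hypothesis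
  of \<open>minimizing_loops\<close>, which yields smooth loops \<open>c\<^sub>k\<close> that converge uniformly and whose second derivatives are
  Cauchy in \<open>L\<^sup>2\<close>; their first derivatives are then uniformly Cauchy. The speeds of the \<open>c\<^sub>k\<close> cannot
  degenerate anywhere, since otherwise \<open>\<gamma>\<close> would be shorter than its length on some interval
  (\<open>g_not_shorter\<close>, \<open>eventually_uniformly_immersed\<close>). The straight homotopies between the \<open>c\<^sub>k\<close> are therefore
  immersed, and their \<open>H\<^sup>2\<close> lengths are bounded by the \<open>L\<^sup>2\<close> distances of the second derivatives and the
  uniform distances (\<open>H2_dist_linear_path\<close>). The passage from \<open>c\<close> to \<open>\<gamma>\<close> is a monotone change of parameter,
  which may be constant on intervals but is a uniform limit of diffeomorphisms
  (\<open>monotone_map_approx_diff_circle\<close>), and the Frechet distance allows for these.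
\<close>

section \<open>Smooth functions of one real variable\<close>

abbreviation smooth :: "(real \<Rightarrow> 'b::real_normed_vector) \<Rightarrow> bool"
  where "smooth f \<equiv> smooth_on UNIV f"

abbreviation vd :: "(real \<Rightarrow> 'b::real_normed_vector) \<Rightarrow> real \<Rightarrow> 'b"
  where "vd f x \<equiv> vector_derivative f (at x)"

lemma frechet_derivative_real:
  fixes f :: "real \<Rightarrow> 'b::real_normed_vector"
  assumes "(f has_vector_derivative f') (at x)"
  shows "frechet_derivative f (at x) = (\<lambda>w. w *\<^sub>R f')"
  using assms frechet_derivative_at[of f "\<lambda>w. w *\<^sub>R f'" x]
  by (simp add: has_vector_derivative_def)

lemma Ck_on_scaleR_const:
  fixes f :: "real \<Rightarrow> 'b::real_normed_vector"
  shows "Ck_on k UNIV f \<Longrightarrow> Ck_on k UNIV (\<lambda>x. w *\<^sub>R f x)"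
proof (induction k arbitrary: f)
  case 0
  then show ?case by (auto intro!: continuous_intros)
next
  case (Suc k)
  have d: "f differentiable (at x)" for x
    using Suc.prems by (auto simp: differentiable_on_def)
  have d': "(f has_derivative frechet_derivative f (at x)) (at x)" for x
    using d frechet_derivative_works by blast
  have *: "((\<lambda>x. w *\<^sub>R f x) has_derivative (\<lambda>h. w *\<^sub>R frechet_derivative f (at x) h)) (at x)" for x
    using d' by (auto intro!: derivative_eq_intros)
  have "frechet_derivative (\<lambda>x. w *\<^sub>R f x) (at x) = (\<lambda>h. w *\<^sub>R frechet_derivative f (at x) h)" for x
    using frechet_derivative_at[OF *] by simp
  moreover have "(\<lambda>x. w *\<^sub>R f x) differentiable_on UNIV"
    using * by (auto simp: differentiable_on_def differentiable_def)
  ultimately show ?case using Suc by simp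
qed

text \<open>The Frechet derivative of a function of one real variable in direction \<open>w\<close> is \<open>w\<close> times the ordinary
  derivative. This and the following lemma turn the directional recursion that defines \<open>Ck_on\<close> into one on
  ordinary derivatives, in which all closure properties below are proved by induction.\<close>

lemma Ck_on_SucI:
  fixes f :: "real \<Rightarrow> 'b::real_normed_vector"
  assumes "\<And>x. (f has_vector_derivative f' x) (at x)" "Ck_on k UNIV f'"
  shows "Ck_on (Suc k) UNIV f"
  using assms Ck_on_scaleR_const[OF assms(2)] frechet_derivative_real[OF assms(1)]
  by (auto simp: differentiable_on_def has_vector_derivative_def differentiable_def)

lemma Ck_on_SucE:
  fixes f :: "real \<Rightarrow> 'b::real_normed_vector"
  assumes "Ck_on (Suc k) UNIV f"
  shows "(f has_vector_derivative vd f x) (at x)" and "Ck_on k UNIV (vd f)"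
proof -
  have d: "f differentiable (at x)" for x
    using assms by (auto simp: differentiable_on_def)
  then show *: "(f has_vector_derivative vd f x) (at x)" for x
    by (simp add: vector_derivative_works)
  have "Ck_on k UNIV (\<lambda>x. frechet_derivative f (at x) 1)"
    using assms by simp
  then show "Ck_on k UNIV (vd f)"
    by (simp add: frechet_derivative_real[OF *])
qed

lemma Ck_on_mono:
  fixes f :: "real \<Rightarrow> 'b::real_normed_vector"
  shows "Ck_on (Suc k) UNIV f \<Longrightarrow> Ck_on k UNIV f"
proof (induction k arbitrary: f)
  case 0
  then show ?case
    using differentiable_imp_continuous_on by auto
next
  case (Suc k)
  show ?case
    by (rule Ck_on_SucI[OF Ck_on_SucE(1)[OF Suc.prems]]) (rule Suc.IH[OF Ck_on_SucE(2)[OF Suc.prems]])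
qed

lemma smooth_onI:
  fixes f :: "real \<Rightarrow> 'b::real_normed_vector"
  assumes "\<And>x. (f has_vector_derivative f' x) (at x)" "smooth f'"
  shows "smooth f"
  unfolding smooth_on_def
proof
  fix k show "Ck_on k UNIV f"
    using Ck_on_SucI[OF assms(1)] assms(2) Ck_on_mono unfolding smooth_on_def by blast
qed

lemma
  fixes f :: "real \<Rightarrow> 'b::real_normed_vector"
  assumes "smooth f"
  shows smooth_has_vd: "(f has_vector_derivative vd f x) (at x)"
    and smooth_vd: "smooth (vd f)"
    and smooth_continuous: "continuous_on A f"
    and smooth_differentiable: "f differentiable (at x)"
proof -
  have k: "Ck_on k UNIV f" for k
    using assms by (simp add: smooth_on_def)
  show *: "(f has_vector_derivative vd f x) (at x)" for x
    using Ck_on_SucE(1)[OF k] .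
  show "smooth (vd f)"
    unfolding smooth_on_def using Ck_on_SucE(2)[OF k] by blast
  show "continuous_on A f"
    using k[of 0] continuous_on_subset by auto
  show "f differentiable (at x)"
    using * differentiableI_vector by blast
qed

lemma Ck_on_cong:
  fixes f g :: "'a::real_normed_vector \<Rightarrow> 'b::real_normed_vector"
  shows "Ck_on k S f \<Longrightarrow> (\<And>x. x \<in> S \<Longrightarrow> f x = g x) \<Longrightarrow> Ck_on k S g"
proof (induction k arbitrary: f g)
  case 0
  then show ?case using continuous_on_cong[of S S f g] by simp
next
  case (Suc k)
  have iff: "(f has_derivative F) (at x within S) \<longleftrightarrow> (g has_derivative F) (at x within S)" if "x \<in> S" for x F
    using has_derivative_transform[OF that, of g f F] has_derivative_transform[OF that, of f g F] Suc.prems(2) by auto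
  then have fd: "frechet_derivative f (at x within S) = frechet_derivative g (at x within S)" if "x \<in> S" for x
    using that by (simp add: frechet_derivative_def)
  have "Ck_on k S (\<lambda>x. frechet_derivative g (at x within S) w)" for w
  proof (rule Suc.IH)
    show "Ck_on k S (\<lambda>x. frechet_derivative f (at x within S) w)" using Suc.prems(1) by simp
  qed (simp add: fd)
  moreover have "g differentiable_on S"
    using Suc.prems(1) iff unfolding Ck_on.simps differentiable_on_def differentiable_def by blast
  ultimately show ?case by simp
qed

lemma deriv_eq_vd:
  fixes f :: "real \<Rightarrow> real"
  assumes "smooth f"
  shows "deriv f = vd f"
proof
  fix x
  have "(f has_real_derivative vd f x) (at x)"
    using smooth_has_vd[OF assms] by (simp add: has_real_derivative_iff_has_vector_derivative)
  then show "deriv f x = vd f x" by (rule DERIV_imp_deriv)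
qed

text \<open>For functions whose derivatives of all orders stay within a simple class, such as convolutions with smooth
  kernels.\<close>

lemma smooth_on_closed_family:
  fixes F :: "(real \<Rightarrow> 'b::real_normed_vector) set"
  assumes "\<And>f. f \<in> F \<Longrightarrow> \<exists>f'\<in>F. \<forall>x. (f has_vector_derivative f' x) (at x)" "f \<in> F"
  shows "smooth f"
proof -
  have "Ck_on k UNIV f" for k
    using assms(2)
  proof (induction k arbitrary: f)
    case 0
    then obtain f' where "\<forall>x. (f has_vector_derivative f' x) (at x)"
      using assms(1) by blast
    then have "continuous_on UNIV f"
      using has_vector_derivative_continuous continuous_at_imp_continuous_on by blast
    then show ?case by simp
  next
    case (Suc k)
    then show ?case
      using assms(1) Ck_on_SucI by metis
  qed
  then show ?thesis by (simp add: smooth_on_def)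
qed

lemma Ck_on_add:
  fixes f g :: "real \<Rightarrow> 'b::real_normed_vector"
  shows "Ck_on k UNIV f \<Longrightarrow> Ck_on k UNIV g \<Longrightarrow> Ck_on k UNIV (\<lambda>x. f x + g x)"
proof (induction k arbitrary: f g)
  case 0
  then show ?case by (auto intro!: continuous_intros)
next
  case (Suc k)
  show ?case
    by (rule Ck_on_SucI[OF has_vector_derivative_add[OF Ck_on_SucE(1)[OF Suc.prems(1)] Ck_on_SucE(1)[OF Suc.prems(2)]]
          Suc.IH[OF Ck_on_SucE(2)[OF Suc.prems(1)] Ck_on_SucE(2)[OF Suc.prems(2)]]])
qed

lemma Ck_on_const: "Ck_on k UNIV (\<lambda>x::real. a :: 'b::real_normed_vector)"
proof (induction k arbitrary: a)
  case (Suc k)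
  show ?case
    by (rule Ck_on_SucI[of _ "\<lambda>x. 0"]) (use Suc in \<open>auto\<close>)
qed auto

lemma (in bounded_bilinear) Ck_on_prod:
  fixes f :: "real \<Rightarrow> 'a" and g :: "real \<Rightarrow> 'b"
  shows "Ck_on k UNIV f \<Longrightarrow> Ck_on k UNIV g \<Longrightarrow> Ck_on k UNIV (\<lambda>x. prod (f x) (g x))"
proof (induction k arbitrary: f g)
  case 0
  then show ?case by (auto intro!: continuous_on)
next
  case (Suc k)
  show ?case
  proof (rule Ck_on_SucI)
    show "((\<lambda>x. prod (f x) (g x)) has_vector_derivative prod (f x) (vd g x) + prod (vd f x) (g x)) (at x)" for x
      by (rule has_vector_derivative[OF Ck_on_SucE(1)[OF Suc.prems(1)] Ck_on_SucE(1)[OF Suc.prems(2)]])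
    show "Ck_on k UNIV (\<lambda>x. prod (f x) (vd g x) + prod (vd f x) (g x))"
      by (intro Ck_on_add Suc.IH Ck_on_mono[OF Suc.prems(1)] Ck_on_mono[OF Suc.prems(2)]
          Ck_on_SucE(2)[OF Suc.prems(1)] Ck_on_SucE(2)[OF Suc.prems(2)])
  qed
qed

lemma Ck_on_compose:
  fixes f :: "real \<Rightarrow> 'b::real_normed_vector" and g :: "real \<Rightarrow> real"
  shows "Ck_on k UNIV f \<Longrightarrow> Ck_on k UNIV g \<Longrightarrow> Ck_on k UNIV (\<lambda>x. f (g x))"
proof (induction k arbitrary: f g)
  case 0
  then show ?case by (auto intro: continuous_on_compose2)
next
  case (Suc k)
  show ?case
  proof (rule Ck_on_SucI)
    show "((\<lambda>x. f (g x)) has_vector_derivative vd g x *\<^sub>R vd f (g x)) (at x)" for x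
      using vector_diff_chain_at[OF Ck_on_SucE(1)[OF Suc.prems(2)] Ck_on_SucE(1)[OF Suc.prems(1)]]
      by (simp add: o_def)
    show "Ck_on k UNIV (\<lambda>x. vd g x *\<^sub>R vd f (g x))"
      by (rule bounded_bilinear.Ck_on_prod[OF bounded_bilinear_scaleR Ck_on_SucE(2)[OF Suc.prems(2)]
          Suc.IH[OF Ck_on_SucE(2)[OF Suc.prems(1)] Ck_on_mono[OF Suc.prems(2)]]])
  qed
qed

lemma Ck_on_inverse:
  fixes f :: "real \<Rightarrow> real"
  assumes "\<And>x. f x \<noteq> 0"
  shows "Ck_on k UNIV f \<Longrightarrow> Ck_on k UNIV (\<lambda>x. inverse (f x))"
proof (induction k)
  case 0
  then show ?case using assms by (auto intro!: continuous_intros)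
next
  case (Suc k)
  show ?case
  proof (rule Ck_on_SucI)
    show "((\<lambda>x. inverse (f x)) has_vector_derivative (-1) *\<^sub>R (inverse (f x) * inverse (f x)) * vd f x) (at x)" for x
    proof -
      have "(f has_real_derivative vd f x) (at x)"
        using Ck_on_SucE(1)[OF Suc.prems] by (simp add: has_real_derivative_iff_has_vector_derivative)
      then have "((\<lambda>x. inverse (f x)) has_real_derivative (-1) *\<^sub>R (inverse (f x) * inverse (f x)) * vd f x) (at x)"
        by (auto intro!: derivative_eq_intros simp: assms)
      then show ?thesis by (simp add: has_real_derivative_iff_has_vector_derivative)
    qed
    show "Ck_on k UNIV (\<lambda>x. (-1) *\<^sub>R (inverse (f x) * inverse (f x)) * vd f x)"
      by (intro bounded_bilinear.Ck_on_prod[OF bounded_bilinear_mult] Suc.IH Ck_on_scaleR_const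
          Ck_on_mono[OF Suc.prems] Ck_on_SucE(2)[OF Suc.prems])
  qed
qed

named_theorems smooth_intros

lemma smooth_const [smooth_intros]: "smooth (\<lambda>x. a)"
  by (simp add: smooth_on_def Ck_on_const)

lemma smooth_id [smooth_intros]: "smooth (\<lambda>x. x)"
  by (rule smooth_onI[OF has_vector_derivative_id]) (rule smooth_const)

lemma smooth_add [smooth_intros]: "smooth f \<Longrightarrow> smooth g \<Longrightarrow> smooth (\<lambda>x. f x + g x)"
  by (simp add: smooth_on_def Ck_on_add)

lemma smooth_scaleR [smooth_intros]: "smooth f \<Longrightarrow> smooth g \<Longrightarrow> smooth (\<lambda>x. f x *\<^sub>R g x)"
  by (simp add: smooth_on_def bounded_bilinear.Ck_on_prod[OF bounded_bilinear_scaleR])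

lemma smooth_mult [smooth_intros]:
  fixes f g :: "real \<Rightarrow> real"
  shows "smooth f \<Longrightarrow> smooth g \<Longrightarrow> smooth (\<lambda>x. f x * g x)"
  by (simp add: smooth_on_def bounded_bilinear.Ck_on_prod[OF bounded_bilinear_mult])

lemma smooth_power [smooth_intros]:
  fixes f :: "real \<Rightarrow> real"
  shows "smooth f \<Longrightarrow> smooth (\<lambda>x. f x ^ j)"
  by (induction j) (simp_all add: smooth_const smooth_mult)

lemma smooth_diff [smooth_intros]:
  assumes "smooth f" "smooth g" shows "smooth (\<lambda>x. f x - g x)"
  using smooth_add[OF assms(1) smooth_scaleR[OF smooth_const[of "-1"] assms(2)]] by simp

lemma smooth_compose: "smooth f \<Longrightarrow> smooth g \<Longrightarrow> smooth (\<lambda>x. f (g x))"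
  by (simp add: smooth_on_def Ck_on_compose)

lemma smooth_inverse [smooth_intros]:
  fixes f :: "real \<Rightarrow> real"
  shows "smooth f \<Longrightarrow> (\<And>x. f x \<noteq> 0) \<Longrightarrow> smooth (\<lambda>x. inverse (f x))"
  by (simp add: smooth_on_def Ck_on_inverse)

lemma smooth_cos: "smooth (cos :: real \<Rightarrow> real)"
proof (rule smooth_on_closed_family[of "{cos, (\<lambda>x. - sin x), (\<lambda>x. - cos x), sin}"])
  fix f :: "real \<Rightarrow> real" assume "f \<in> {cos, (\<lambda>x. - sin x), (\<lambda>x. - cos x), sin}"
  then show "\<exists>f'\<in>{cos, (\<lambda>x. - sin x), (\<lambda>x. - cos x), sin}. \<forall>x. (f has_vector_derivative f' x) (at x)"
    by (auto simp flip: has_real_derivative_iff_has_vector_derivative intro!: derivative_eq_intros)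
qed auto

lemma smooth_norm [smooth_intros]:
  fixes f :: "real \<Rightarrow> 'a::euclidean_space"
  assumes "smooth f" "\<And>x. f x \<noteq> 0"
  shows "smooth (\<lambda>x. norm (f x))"
proof -
  have "((\<lambda>x. norm (f x)) has_vector_derivative (f x \<bullet> vd f x) * inverse (norm (f x))) (at x)" for x
  proof -
    have "(f has_derivative (\<lambda>h. h *\<^sub>R vd f x)) (at x)"
      using smooth_has_vd[OF assms(1)] by (simp add: has_vector_derivative_def)
    from has_derivative_compose[OF this has_derivative_norm[OF assms(2)]]
    show ?thesis
      by (simp add: has_vector_derivative_def sgn_div_norm inner_commute divide_inverse mult_ac)
  qed
  note d = this
  have "Ck_on k UNIV (\<lambda>x. norm (f x))" for k
  proof (induction k)
    case 0
    then show ?case using smooth_continuous[OF assms(1)] by (auto intro!: continuous_intros)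
  next
    case (Suc k)
    have "Ck_on k UNIV f" "Ck_on k UNIV (vd f)"
      using assms(1) smooth_vd by (auto simp: smooth_on_def)
    then show ?case
      by (intro Ck_on_SucI[OF d] bounded_bilinear.Ck_on_prod[OF bounded_bilinear_mult]
          bounded_bilinear.Ck_on_prod[OF bounded_bilinear_inner] Ck_on_inverse Suc) (auto simp: assms)
  qed
  then show ?thesis by (simp add: smooth_on_def)
qed

text \<open>Bootstrapping: the derivative of the inverse is \<open>1 / \<phi>'\<close> composed with the inverse, so the
  inverse is one order more regular than it is known to be.\<close>

lemma smooth_inv:
  fixes \<phi> :: "real \<Rightarrow> real"
  assumes \<phi>: "smooth \<phi>" "bij \<phi>" and cont: "continuous_on UNIV (inv \<phi>)"
    and d: "\<And>x. vd \<phi> x \<noteq> 0"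
  shows "smooth (inv \<phi>)" and "(inv \<phi> has_vector_derivative inverse (vd \<phi> (inv \<phi> x))) (at x)"
proof -
  have D: "(inv \<phi> has_vector_derivative inverse (vd \<phi> (inv \<phi> x))) (at x)" for x
  proof -
    have "(\<phi> has_field_derivative vd \<phi> (inv \<phi> x)) (at (inv \<phi> x))"
      using smooth_has_vd[OF \<phi>(1)] by (simp add: has_real_derivative_iff_has_vector_derivative)
    moreover have "isCont (inv \<phi>) x"
      using cont by (simp add: continuous_on_eq_continuous_at)
    ultimately have "DERIV (inv \<phi>) x :> inverse (vd \<phi> (inv \<phi> x))"
      using d surj_f_inv_f[OF bij_is_surj[OF \<phi>(2)]]
      by (intro DERIV_inverse_function[where a="x-1" and b="x+1" and f=\<phi>]) auto
    then show ?thesis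
      by (simp add: has_real_derivative_iff_has_vector_derivative)
  qed
  then show "(inv \<phi> has_vector_derivative inverse (vd \<phi> (inv \<phi> x))) (at x)" .
  have r: "smooth (\<lambda>x. inverse (vd \<phi> x))"
    by (intro smooth_intros smooth_vd \<phi> d)
  have "Ck_on k UNIV (inv \<phi>)" for k
  proof (induction k)
    case 0
    then show ?case using cont by simp
  next
    case (Suc k)
    then show ?case
      using r Ck_on_compose[of k "\<lambda>x. inverse (vd \<phi> x)" "inv \<phi>"]
      by (intro Ck_on_SucI[OF D]) (auto simp: smooth_on_def)
  qed
  then show "smooth (inv \<phi>)" by (simp add: smooth_on_def)
qed

section \<open>Periodic functions\<close>

lemma periodic_int:
  assumes "periodic p f"
  shows "f (x + p * of_int n) = f x"
proof (induction n rule: int_induct[of _ 0])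
  case (step1 i)
  then show ?case using assms unfolding periodic_def by (metis add.assoc distrib_left mult.right_neutral of_int_1 of_int_add)
next
  case (step2 i)
  have "f (x + p * of_int (i - 1)) = f ((x + p * of_int (i - 1)) + p)"
    using assms by (simp add: periodic_def)
  also have "(x + p * of_int (i - 1)) + p = x + p * of_int i" by (simp add: algebra_simps)
  finally show ?case using step2 by simp
qed simp

lemma periodic_reduce: "p > 0 \<Longrightarrow> x - p * of_int \<lfloor>x / p\<rfloor> \<in> {0..<p}" for x p :: real
  using floor_divide_lower[of p x] floor_divide_upper[of p x] by (simp add: algebra_simps)

lemma periodic_bounded:
  fixes f :: "real \<Rightarrow> 'a::real_normed_vector"
  assumes p: "p > 0" and f: "continuous_on UNIV f" "periodic p f"
  shows "\<exists>K. \<forall>x. norm (f x) \<le> K"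
proof -
  have "bounded (f ` {0..p})"
    by (intro compact_imp_bounded compact_continuous_image continuous_on_subset[OF f(1)]) auto
  then obtain K where K: "\<forall>x\<in>{0..p}. norm (f x) \<le> K" unfolding bounded_iff by auto
  have "norm (f x) \<le> K" for x
    using K[rule_format, of "x - p * of_int \<lfloor>x / p\<rfloor>"] periodic_reduce[OF p, of x]
      periodic_int[OF f(2), of "x - p * of_int \<lfloor>x / p\<rfloor>" "\<lfloor>x / p\<rfloor>"] by simp
  then show ?thesis by blast
qed

lemma periodic_extension:
  fixes f :: "real \<Rightarrow> 'b"
  assumes "p > 0"
  shows "periodic p (\<lambda>t. f (t - p * of_int \<lfloor>t / p\<rfloor>))"
    and "t \<in> {0..<p} \<Longrightarrow> f (t - p * of_int \<lfloor>t / p\<rfloor>) = f t"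
proof -
  have "\<lfloor>(t + p) / p\<rfloor> = \<lfloor>t / p\<rfloor> + 1" for t
    using assms by (simp add: add_divide_distrib)
  then show "periodic p (\<lambda>t. f (t - p * of_int \<lfloor>t / p\<rfloor>))"
    by (simp add: periodic_def algebra_simps)
  have "\<lfloor>t / p\<rfloor> = 0" if "t \<in> {0..<p}" using that assms by (simp add: floor_eq_iff)
  then show "t \<in> {0..<p} \<Longrightarrow> f (t - p * of_int \<lfloor>t / p\<rfloor>) = f t" by simp
qed

lemma periodic_extension_continuous:
  fixes f :: "real \<Rightarrow> 'a::real_normed_vector"
  assumes p: "p > 0" and f: "continuous_on {0..p} f" "f p = f 0"
  shows "continuous_on UNIV (\<lambda>t. f (t - p * of_int \<lfloor>t / p\<rfloor>))"
proof -
  define F where "F t = f (t - p * of_int \<lfloor>t / p\<rfloor>)" for t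
  have eq: "F t = f (t - p * of_int n)" if "t \<in> {p * of_int n..p * of_int n + p}" for t n
  proof (cases "t = p * of_int n + p")
    case True
    then have "t / p = of_int (n + 1)" using p by (simp add: add_divide_distrib)
    then have "\<lfloor>t / p\<rfloor> = n + 1" by (simp only: floor_of_int)
    then have "F t = f 0" using True by (simp add: F_def algebra_simps)
    then show ?thesis using True f(2) by simp
  next
    case False
    then have "of_int n \<le> t / p" "t / p < of_int n + 1" using that p by (simp_all add: field_simps)
    then have "\<lfloor>t / p\<rfloor> = n" by (simp add: floor_eq_iff)
    then show ?thesis by (simp add: F_def)
  qed
  have c: "continuous_on {p * of_int n..p * of_int n + p} F" for n
  proof (rule continuous_on_eq)
    show "continuous_on {p * of_int n..p * of_int n + p} (\<lambda>t. f (t - p * of_int n))"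
      by (rule continuous_on_compose2[OF f(1)]) (auto intro!: continuous_intros)
  qed (simp add: eq)
  have "isCont F x" for x
  proof -
    define n where "n = \<lfloor>x / p\<rfloor>"
    have x: "x - p * of_int n \<in> {0..<p}" unfolding n_def by (rule periodic_reduce[OF p])
    have "continuous_on ({p * of_int (n - 1)..p * of_int (n - 1) + p} \<union> {p * of_int n..p * of_int n + p}) F"
      by (intro continuous_on_closed_Un c) auto
    then have "continuous_on {p * of_int n - p<..<p * of_int n + p} F"
      by (rule continuous_on_subset) (auto simp: algebra_simps)
    moreover have "x \<in> {p * of_int n - p<..<p * of_int n + p}" using x p by auto
    ultimately show "isCont F x" by (simp add: continuous_on_eq_continuous_at)
  qed
  then show ?thesis by (simp add: continuous_at_imp_continuous_on F_def[symmetric])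
qed

section \<open>Reparametrization\<close>

text \<open>Primitives on the whole line make substitutions with maps that do not preserve \<open>{0..2*pi}\<close>, such as
  lifts of circle diffeomorphisms, a matter of evaluating at end points.\<close>

lemma antiderivative_UNIV:
  fixes f :: "real \<Rightarrow> 'a::euclidean_space"
  assumes "continuous_on UNIV f"
  shows "\<exists>G. (\<forall>x. (G has_vector_derivative f x) (at x)) \<and> G 0 = 0"
proof -
  define G where "G x = (if x \<ge> 0 then integral {0..x} f else - integral {x..0} f)" for x
  have "(G has_vector_derivative f x) (at x)" for x
  proof -
    define N where "N = \<bar>x\<bar> + 1"
    have "N > 0" by (simp add: N_def)
    obtain g where g: "\<And>y. y \<in> {-N..N} \<Longrightarrow> (g has_vector_derivative f y) (at y within {-N..N})"
      using antiderivative_continuous[of "-N" N f] assms continuous_on_subset by blast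
    have int: "(f has_integral (g b - g a)) {a..b}" if "a \<le> b" "-N \<le> a" "b \<le> N" for a b
      using that has_vector_derivative_within_subset[OF g] by (intro fundamental_theorem_of_calculus) auto
    have "G y = g y - g 0" if "y \<in> {-N<..<N}" for y
      using that \<open>N > 0\<close> int[of 0 y] int[of y 0] by (auto simp: G_def dest!: integral_unique)
    moreover have "((\<lambda>y. g y - g 0) has_vector_derivative f x) (at x)"
    proof -
      have "(g has_vector_derivative f x) (at x within {-N<..<N})"
        by (rule has_vector_derivative_within_subset[OF g]) (auto simp: N_def)
      then have "(g has_vector_derivative f x) (at x)"
        by (subst (asm) has_vector_derivative_within_open) (auto simp: N_def)
      then show ?thesis by (auto intro!: derivative_eq_intros)
    qed
    moreover have "x \<in> {-N<..<N}" by (auto simp: N_def)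
    ultimately show ?thesis
      using has_vector_derivative_transform_within_open[of "\<lambda>y. g y - g 0" "f x" x "{-N<..<N}" G] by auto
  qed
  moreover have "G 0 = 0" by (simp add: G_def)
  ultimately show ?thesis by blast
qed

lemma integral_antiderivative:
  fixes G :: "real \<Rightarrow> 'a::euclidean_space"
  assumes "\<And>x. (G has_vector_derivative f x) (at x)" "a \<le> b"
  shows "integral {a..b} f = G b - G a"
  using fundamental_theorem_of_calculus[of a b G f] assms has_vector_derivative_at_within
  by (blast intro: integral_unique)

lemma antiderivative_periodic:
  fixes G :: "real \<Rightarrow> 'a::euclidean_space"
  assumes "\<And>x. (G has_vector_derivative f x) (at x)" "periodic p f"
  shows "G (x + p) - G x = G p - G 0"
proof -
  have "((\<lambda>x. G (x + p) - G x) has_vector_derivative 0) (at x)" for x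
  proof -
    have "((\<lambda>x. G (x + p)) has_vector_derivative 1 *\<^sub>R f (x + p)) (at x)"
      using vector_diff_chain_at[of "\<lambda>x. x + p" 1 x G "f (x+p)"] assms(1)
        has_vector_derivative_add[OF has_vector_derivative_id has_vector_derivative_const[of p]]
      by (simp add: o_def)
    from has_vector_derivative_diff[OF this assms(1)] show ?thesis
      using assms(2) by (simp add: periodic_def)
  qed
  then have "((\<lambda>x. G (x + p) - G x) has_derivative (\<lambda>h. 0)) (at x within UNIV)" for x
    by (simp add: has_vector_derivative_def)
  then show ?thesis
    using has_derivative_zero_unique[of UNIV "\<lambda>x. G (x + p) - G x" x 0] by simp
qed

lemma integral_periodic:
  fixes f :: "real \<Rightarrow> 'a::euclidean_space"
  assumes "continuous_on UNIV f" "periodic p f" "p \<ge> 0"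
  shows "integral {a..a+p} f = integral {0..p} f"
proof -
  obtain G where G: "\<And>x. (G has_vector_derivative f x) (at x)"
    using antiderivative_UNIV[OF assms(1)] by blast
  show ?thesis
    using antiderivative_periodic[OF G assms(2), of a] assms(3)
    by (simp add: integral_antiderivative[OF G])
qed

lemma diff_circle_derivative_nonzero:
  assumes "\<phi> \<in> diff_circle"
  shows "vd \<phi> u \<noteq> 0"
proof
  assume 0: "vd \<phi> u = 0"
  have s: "smooth \<phi>" "smooth (inv \<phi>)" "inj \<phi>"
    using assms by (auto simp: diff_circle_def bij_def)
  have "((inv \<phi> \<circ> \<phi>) has_vector_derivative vd \<phi> u *\<^sub>R vd (inv \<phi>) (\<phi> u)) (at u)"
    by (intro vector_diff_chain_at smooth_has_vd s)
  moreover have "inv \<phi> \<circ> \<phi> = (\<lambda>x. x)" using s by (auto simp: fun_eq_iff)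
  ultimately have "((\<lambda>x. x) has_vector_derivative 0) (at u)" by (simp add: 0)
  then have "(1::real) = 0"
    by (rule vector_derivative_unique_at[OF has_vector_derivative_id])
  then show False by simp
qed

lemma vd_pos_imp_increasing:
  fixes \<phi> :: "real \<Rightarrow> real"
  assumes "smooth \<phi>" "\<And>u. vd \<phi> u > 0" "x < y"
  shows "\<phi> x < \<phi> (y::real)"
proof (rule DERIV_pos_imp_increasing[OF assms(3)])
  fix z
  have "(\<phi> has_real_derivative vd \<phi> z) (at z)"
    using smooth_has_vd[OF assms(1)] by (simp add: has_real_derivative_iff_has_vector_derivative)
  then show "\<exists>y. (\<phi> has_real_derivative y) (at z) \<and> 0 < y" using assms(2) by blast
qed

lemma vd_neg_imp_decreasing:
  fixes \<phi> :: "real \<Rightarrow> real"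
  assumes "smooth \<phi>" "\<And>u. vd \<phi> u < 0" "x < y"
  shows "\<phi> y < \<phi> (x::real)"
proof (rule DERIV_neg_imp_decreasing[OF assms(3)])
  fix z
  have "(\<phi> has_real_derivative vd \<phi> z) (at z)"
    using smooth_has_vd[OF assms(1)] by (simp add: has_real_derivative_iff_has_vector_derivative)
  then show "\<exists>y. (\<phi> has_real_derivative y) (at z) \<and> y < 0" using assms(2) by blast
qed

text \<open>The derivative of a diffeomorphism has no zero, hence one sign, and the sign decides between the
  two possible equivariances.\<close>

lemma diff_circle_cases:
  assumes "\<phi> \<in> diff_circle"
  obtains (preserving) "\<And>u. vd \<phi> u > 0" "\<And>u. \<phi> (u + 2 * pi) = \<phi> u + 2 * pi"
  | (reversing) "\<And>u. vd \<phi> u < 0" "\<And>u. \<phi> (u + 2 * pi) = \<phi> u - 2 * pi"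
proof -
  have s: "smooth \<phi>" using assms by (auto simp: diff_circle_def)
  have nz: "vd \<phi> u \<noteq> 0" for u by (rule diff_circle_derivative_nonzero[OF assms])
  have "(\<forall>u. vd \<phi> u > 0) \<or> (\<forall>u. vd \<phi> u < 0)"
  proof (rule ccontr)
    assume "\<not> ?thesis"
    then obtain u v where uv: "vd \<phi> u < 0" "vd \<phi> v > 0" using nz by (metis linorder_neqE_linordered_idom)
    have "connected (range (vd \<phi>))"
      by (intro connected_continuous_image smooth_continuous smooth_vd s) simp
    then have "0 \<in> range (vd \<phi>)"
      using uv unfolding connected_iff_interval by (meson less_imp_le rangeI)
    then show False using nz by auto
  qed
  then consider (a) "\<And>u. vd \<phi> u > 0" | (b) "\<And>u. vd \<phi> u < 0" by blast
  then show ?thesis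
  proof cases
    case a
    then have "\<phi> 0 < \<phi> (0 + 2 * pi)" by (intro vd_pos_imp_increasing[OF s]) auto
    then have "\<And>u. \<phi> (u + 2 * pi) = \<phi> u + 2 * pi"
      using assms unfolding diff_circle_def by (smt (verit) mem_Collect_eq pi_gt_zero)
    then show ?thesis using a preserving by blast
  next
    case b
    then have "\<phi> 0 > \<phi> (0 + 2 * pi)" by (intro vd_neg_imp_decreasing[OF s]) auto
    then have "\<And>u. \<phi> (u + 2 * pi) = \<phi> u - 2 * pi"
      using assms unfolding diff_circle_def by (smt (verit) mem_Collect_eq pi_gt_zero)
    then show ?thesis using b reversing by blast
  qed
qed

lemma equivariant_nat:
  fixes f :: "real \<Rightarrow> real"
  assumes "\<And>u. f (u + p) = f u + q"
  shows "f (u + real n * p) = f u + real n * q"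
proof (induction n)
  case (Suc n)
  have "f (u + real (Suc n) * p) = f ((u + real n * p) + p)" by (simp add: algebra_simps)
  also have "\<dots> = f (u + real n * p) + q" by (rule assms)
  finally show ?case using Suc by (simp add: algebra_simps)
qed simp

text \<open>An increasing equivariant map is unbounded in both directions, hence onto; as its derivative
  does not vanish, the inverse is smooth.\<close>

lemma diff_circleI:
  assumes s: "smooth \<phi>" and per: "\<And>u. \<phi> (u + 2 * pi) = \<phi> u + 2 * pi" and pos: "\<And>u. vd \<phi> u > 0"
  shows "\<phi> \<in> diff_circle"
proof -
  have mono: "\<phi> x < \<phi> y" if "x < y" for x y
    by (rule vd_pos_imp_increasing[OF s pos that])
  then have inj: "inj \<phi>"
    by (metis mono injI linorder_neqE_linordered_idom order_less_irrefl)
  have "\<exists>x. \<phi> x = y" for y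
  proof -
    obtain n :: nat where n: "real n > \<bar>y - \<phi> 0\<bar>" using reals_Archimedean2 by blast
    have n2: "real n * (2 * pi) \<ge> real n"
      using pi_gt3 mult_left_mono[of 1 "2 * pi" "real n"] by simp
    have "\<phi> (0 + real n * (2 * pi)) = \<phi> 0 + real n * (2 * pi)"
      by (rule equivariant_nat[where f=\<phi> and q="2 * pi"]) (rule per)
    moreover have "\<phi> (- (real n * (2 * pi)) + real n * (2 * pi)) = \<phi> (- (real n * (2 * pi))) + real n * (2 * pi)"
      by (rule equivariant_nat[where f=\<phi> and q="2 * pi"]) (rule per)
    ultimately have "\<phi> (- (real n * (2 * pi))) \<le> y" "y \<le> \<phi> (real n * (2 * pi))"
      using n n2 by (simp_all only: add_0 add.left_inverse)
    then show ?thesis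
      using IVT'[of \<phi> "- (real n * (2 * pi))" y "real n * (2 * pi)"] smooth_continuous[OF s] by auto
  qed
  then have bij: "bij \<phi>" using inj by (metis bijI surjI surj_def)
  have "isCont (inv \<phi>) y" for y
  proof -
    obtain x where y: "y = \<phi> x" using bij by (metis bij_pointE)
    have "isCont (inv \<phi>) (\<phi> x)"
      using smooth_continuous[OF s, of UNIV] inv_f_f[OF inj]
      by (intro isCont_inverse_function[of 1 x "inv \<phi>" \<phi>]) (simp_all add: continuous_on_eq_continuous_at)
    then show ?thesis by (simp add: y)
  qed
  then have "continuous_on UNIV (inv \<phi>)" by (simp add: continuous_at_imp_continuous_on)
  then have "smooth (inv \<phi>)"
    using smooth_inv(1)[OF s bij] pos by (metis less_irrefl)
  then show ?thesis using s bij per by (simp add: diff_circle_def)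
qed

lemma diff_circle_id: "(\<lambda>u. u) \<in> diff_circle"
  by (rule diff_circleI) (simp_all add: smooth_id)

lemma diff_circle_inv:
  assumes "\<phi> \<in> diff_circle"
  shows "inv \<phi> \<in> diff_circle" "\<phi> (inv \<phi> u) = u" "inv \<phi> (\<phi> u) = u"
proof -
  have b: "bij \<phi>" and s: "smooth \<phi>" "smooth (inv \<phi>)" using assms by (auto simp: diff_circle_def)
  show i: "\<phi> (inv \<phi> u) = u" "inv \<phi> (\<phi> u) = u" for u
    using b by (auto simp: bij_is_surj surj_f_inv_f bij_is_inj)
  have "(\<forall>u. inv \<phi> (u + 2 * pi) = inv \<phi> u + 2 * pi) \<or> (\<forall>u. inv \<phi> (u + 2 * pi) = inv \<phi> u - 2 * pi)"
  proof (cases rule: diff_circle_cases[OF assms])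
    case 1
    then show ?thesis using i by metis
  next
    case 2
    have "\<phi> (inv \<phi> u - 2 * pi) = u + 2 * pi" for u
      using 2(2)[of "inv \<phi> u - 2 * pi"] i(1)[of u] by simp
    then show ?thesis using i by metis
  qed
  then show "inv \<phi> \<in> diff_circle"
    using b s by (auto simp: diff_circle_def bij_imp_bij_inv inv_inv_eq)
qed

lemma immersed_curvesD:
  assumes "c \<in> immersed_curves"
  shows "smooth c" "periodic (2 * pi) c" "vd c u \<noteq> 0"
  using assms by (auto simp: immersed_curves_def)

lemma vd_periodic:
  assumes "smooth f" "periodic p f"
  shows "periodic p (vd f)"
  unfolding periodic_def
proof
  fix x
  have "((f \<circ> (\<lambda>x. x + p)) has_vector_derivative 1 *\<^sub>R vd f (x + p)) (at x)"
    by (intro vector_diff_chain_at smooth_has_vd assms) (auto intro!: derivative_eq_intros)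
  moreover have "f \<circ> (\<lambda>x. x + p) = f" using assms by (auto simp: periodic_def)
  ultimately show "vd f (x + p) = vd f x" by (simp add: vector_derivative_at)
qed

lemma smooth_speed:
  assumes "c \<in> immersed_curves"
  shows "smooth (speed c)" "speed c u > 0" "periodic (2 * pi) (speed c)" "len c > 0"
proof -
  have "speed c = (\<lambda>u. norm (vd c u))" by (simp add: speed_def fun_eq_iff)
  then show s: "smooth (speed c)"
    using immersed_curvesD[OF assms] by (auto intro!: smooth_intros smooth_vd)
  show pos: "speed c u > 0" for u using immersed_curvesD[OF assms] by (simp add: speed_def)
  show "periodic (2 * pi) (speed c)"
    using vd_periodic[OF immersed_curvesD(1,2)[OF assms]] by (simp add: periodic_def speed_def)
  have "0 < integral {0..2*pi} (speed c)"
  proof (rule ccontr)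
    assume "\<not> ?thesis"
    moreover have "integral {0..2*pi} (speed c) \<ge> 0"
      using pos by (intro integral_nonneg integrable_continuous_real smooth_continuous s) (auto intro: less_imp_le)
    ultimately have "integral {0..2*pi} (speed c) = 0" by simp
    moreover have "speed c u \<ge> 0" for u using pos[of u] by simp
    ultimately have "\<forall>x\<in>{0..2*pi}. speed c x = 0"
      using integral_eq_0_iff[of 0 "2*pi" "speed c"] smooth_continuous[OF s] by simp
    then have "speed c 0 = 0" by simp
    then show False using pos[of 0] by simp
  qed
  then show "len c > 0" by (simp add: len_def)
qed

lemma smooth_Ds:
  assumes "c \<in> immersed_curves" "smooth h"
  shows "smooth (Ds c h)"
proof -
  have "Ds c h = (\<lambda>u. inverse (speed c u) *\<^sub>R vd h u)" by (simp add: Ds_def fun_eq_iff divide_inverse)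
  moreover have "speed c u \<noteq> 0" for u using smooth_speed(2)[OF assms(1), of u] by simp
  ultimately show ?thesis
    using smooth_speed[OF assms(1)] by (auto intro!: smooth_intros smooth_vd assms)
qed

lemma vd_compose:
  assumes "smooth f" "smooth g"
  shows "vd (\<lambda>x. f (g x)) x = vd g x *\<^sub>R vd f (g x)"
  using vector_diff_chain_at[OF smooth_has_vd[OF assms(2)] smooth_has_vd[OF assms(1)], of x]
  by (simp add: o_def vector_derivative_at)

lemma diff_circle_substitution:
  fixes f :: "real \<Rightarrow> real"
  assumes \<phi>: "\<phi> \<in> diff_circle" and f: "continuous_on UNIV f" "periodic (2 * pi) f"
  shows "integral {0..2*pi} (\<lambda>u. f (\<phi> u) * \<bar>vd \<phi> u\<bar>) = integral {0..2*pi} f"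
proof -
  obtain G where G: "\<And>x. (G has_vector_derivative f x) (at x)"
    using antiderivative_UNIV[OF f(1)] by blast
  have s: "smooth \<phi>" using \<phi> by (auto simp: diff_circle_def)
  have ch: "((\<lambda>u. G (\<phi> u)) has_vector_derivative f (\<phi> u) * vd \<phi> u) (at u)" for u
    using vector_diff_chain_at[OF smooth_has_vd[OF s] G, of u] by (simp add: o_def mult.commute)
  have p: "G (x + 2 * pi) - G x = integral {0..2*pi} f" for x
    using antiderivative_periodic[OF G f(2), of x] by (simp add: integral_antiderivative[OF G])
  show ?thesis
  proof (cases rule: diff_circle_cases[OF \<phi>])
    case 1
    have "integral {0..2*pi} (\<lambda>u. f (\<phi> u) * vd \<phi> u) = integral {0..2*pi} f"
      using integral_antiderivative[OF ch, of 0 "2*pi"] p[of "\<phi> 0"] 1(2)[of 0] by simp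
    then show ?thesis using 1(1) by (simp add: abs_of_pos)
  next
    case 2
    have "integral {0..2*pi} (\<lambda>u. f (\<phi> u) * vd \<phi> u) = - integral {0..2*pi} f"
      using integral_antiderivative[OF ch, of 0 "2*pi"] p[of "\<phi> 0 - 2*pi"] 2(2)[of 0] by simp
    then show ?thesis using 2(1) by (simp add: abs_of_neg)
  qed
qed

lemma
  assumes c: "c \<in> immersed_curves" and \<phi>: "\<phi> \<in> diff_circle"
  shows immersed_reparam: "(\<lambda>u. c (\<phi> u)) \<in> immersed_curves"
    and len_reparam: "len (\<lambda>u. c (\<phi> u)) = len c"
    and energy_reparam: "energy (\<lambda>u. c (\<phi> u)) = energy c"
proof -
  have s: "smooth \<phi>" using \<phi> by (auto simp: diff_circle_def)
  note C = immersed_curvesD[OF c]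
  have per: "c (\<phi> (u + 2 * pi)) = c (\<phi> u)" for u
  proof (cases rule: diff_circle_cases[OF \<phi>])
    case 2
    then show ?thesis using C(2)[unfolded periodic_def, rule_format, of "\<phi> u - 2 * pi"] by simp
  qed (use C(2) in \<open>simp add: periodic_def\<close>)
  have nz: "vd \<phi> u \<noteq> 0" for u by (rule diff_circle_derivative_nonzero[OF \<phi>])
  have vdc: "vd (\<lambda>x. h (\<phi> x)) u = vd \<phi> u *\<^sub>R vd h (\<phi> u)" if "smooth h" for u and h :: "real \<Rightarrow> 'a"
    by (rule vd_compose[OF that s])
  show im: "(\<lambda>u. c (\<phi> u)) \<in> immersed_curves"
    using per vdc[OF C(1)] C(3) nz by (auto simp: immersed_curves_def periodic_def smooth_compose C s)
  have sp: "speed (\<lambda>u. c (\<phi> u)) u = speed c (\<phi> u) * \<bar>vd \<phi> u\<bar>" for u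
    by (simp add: speed_def vdc[OF C(1)])
  show "len (\<lambda>u. c (\<phi> u)) = len c"
    unfolding len_def sp[abs_def]
    by (rule diff_circle_substitution[OF \<phi>]) (use smooth_speed[OF c] smooth_continuous in auto)
  obtain \<sigma> :: real where \<sigma>: "\<bar>\<sigma>\<bar> = 1" "\<And>u. vd \<phi> u = \<sigma> * \<bar>vd \<phi> u\<bar>"
    by (cases rule: diff_circle_cases[OF \<phi>]) (metis abs_1 abs_neg_one abs_of_neg abs_of_pos mult_1 mult_minus1 minus_minus)+
  have nsp: "speed c u \<noteq> 0" for u using smooth_speed(2)[OF c, of u] by simp
  have D: "Ds (\<lambda>u. c (\<phi> u)) (\<lambda>u. h (\<phi> u)) u = \<sigma> *\<^sub>R Ds c h (\<phi> u)" if "smooth h" for h u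
  proof -
    have "vd \<phi> u / \<bar>vd \<phi> u\<bar> = \<sigma>" using \<sigma>(2)[of u] nz[of u]
      by (metis abs_eq_0 nonzero_mult_div_cancel_right)
    then show ?thesis unfolding Ds_def sp vdc[OF that] by (simp add: divide_inverse mult_ac)
  qed
  have "Ds (\<lambda>u. c (\<phi> u)) (Ds (\<lambda>u. c (\<phi> u)) (\<lambda>u. c (\<phi> u))) u = (\<sigma> * \<sigma>) *\<^sub>R Ds c (Ds c c) (\<phi> u)" for u
  proof -
    have "Ds (\<lambda>u. c (\<phi> u)) (\<lambda>u. c (\<phi> u)) = (\<lambda>u. (\<lambda>x. \<sigma> *\<^sub>R Ds c c x) (\<phi> u))"
      using D[OF C(1)] by auto
    moreover have sm: "smooth (Ds c c)" using smooth_Ds[OF c C(1)] .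
    moreover have "Ds c (\<lambda>x. \<sigma> *\<^sub>R Ds c c x) x = \<sigma> *\<^sub>R Ds c (Ds c c) x" for x
    proof -
      have "((\<lambda>x. \<sigma> *\<^sub>R Ds c c x) has_vector_derivative \<sigma> *\<^sub>R vd (Ds c c) x) (at x)"
        using smooth_has_vd[OF sm] by (auto intro!: derivative_eq_intros)
      then show ?thesis by (simp add: Ds_def vector_derivative_at)
    qed
    ultimately show ?thesis
      using D[of "\<lambda>x. \<sigma> *\<^sub>R Ds c c x" u] by (simp add: smooth_scaleR smooth_const)
  qed
  then have n: "norm (Ds (\<lambda>u. c (\<phi> u)) (Ds (\<lambda>u. c (\<phi> u)) (\<lambda>u. c (\<phi> u))) u) = norm (Ds c (Ds c c) (\<phi> u))" for u
    using \<sigma>(1) by (simp add: abs_mult)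
  have pp: "periodic (2 * pi) (Ds c h)" if "periodic (2 * pi) h" "smooth h" for h
    using smooth_speed(3)[OF c] vd_periodic[OF that(2,1)] by (simp add: Ds_def periodic_def)
  show "energy (\<lambda>u. c (\<phi> u)) = energy c"
    unfolding energy_def integral_ds_def n sp mult.assoc[symmetric]
  proof (rule diff_circle_substitution[OF \<phi>])
    show "continuous_on UNIV (\<lambda>u. (norm (Ds c (Ds c c) u))\<^sup>2 * speed c u)"
      by (intro continuous_intros smooth_continuous smooth_Ds c C smooth_speed)
    show "periodic (2 * pi) (\<lambda>u. (norm (Ds c (Ds c c) u))\<^sup>2 * speed c u)"
      using smooth_speed(3)[OF c] pp[OF pp[OF C(2,1)] smooth_Ds[OF c C(1)]] by (simp add: periodic_def)
  qed
qed

text \<open>The new parameter is \<open>2\<pi> / L\<close> times the arc length from the base point, so that its derivative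
  is proportional to the speed of the curve.\<close>

lemma constant_speed_reparam:
  assumes c: "c \<in> immersed_curves"
  shows "\<exists>g \<sigma>. g \<in> immersed_curves \<and> \<sigma> \<in> diff_circle \<and> c = (\<lambda>u. g (\<sigma> u)) \<and> (\<forall>u. speed g u = len c / (2 * pi))
    \<and> mono \<sigma> \<and> \<sigma> 0 = 0 \<and> \<sigma> (2 * pi) = 2 * pi"
proof -
  note C = immersed_curvesD[OF c]
  note S = smooth_speed[OF c]
  obtain G where G: "\<And>x. (G has_vector_derivative speed c x) (at x)" "G 0 = 0"
    using antiderivative_UNIV[OF smooth_continuous[OF S(1)]] by blast
  define k where "k = 2 * pi / len c"
  have k: "k > 0" using S by (simp add: k_def)
  define \<sigma> where "\<sigma> x = k * G x" for x
  have d: "(\<sigma> has_vector_derivative k * speed c x) (at x)" for x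
    unfolding \<sigma>_def using G(1) by (auto intro!: derivative_eq_intros)
  have s: "smooth \<sigma>"
    using smooth_onI[OF d] smooth_mult[OF smooth_const S(1)] by blast
  have v: "vd \<sigma> x = k * speed c x" for x using d by (rule vector_derivative_at)
  have "G (x + 2 * pi) - G x = len c" for x
    using antiderivative_periodic[OF G(1) S(3), of x]
    by (simp add: len_def integral_antiderivative[OF G(1)])
  then have \<sigma>_per: "\<sigma> (x + 2 * pi) = \<sigma> x + 2 * pi" for x
    using S(4) by (simp add: \<sigma>_def k_def field_simps)
  then have \<sigma>: "\<sigma> \<in> diff_circle"
    by (intro diff_circleI s) (auto simp: v k S)
  define g where "g x = c (inv \<sigma> x)" for x
  have g: "g \<in> immersed_curves"
    using immersed_reparam[OF c diff_circle_inv(1)[OF \<sigma>]] by (simp add: g_def[abs_def])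
  have cg: "c = (\<lambda>u. g (\<sigma> u))" by (simp add: g_def diff_circle_inv[OF \<sigma>])
  have sp: "speed g x = len c / (2 * pi)" for x
  proof -
    have "speed c (inv \<sigma> x) = \<bar>k * speed c (inv \<sigma> x)\<bar> * speed g x"
    proof -
      have "vd c (inv \<sigma> x) = (k * speed c (inv \<sigma> x)) *\<^sub>R vd g x"
        using vd_compose[OF immersed_curvesD(1)[OF g] s, of "inv \<sigma> x"]
        by (simp only: cg[symmetric] diff_circle_inv[OF \<sigma>] v)
      then show ?thesis by (metis norm_scaleR speed_def)
    qed
    then have "k * speed g x = 1" using k S(2)[of "inv \<sigma> x"] by (simp add: abs_mult)
    then have "speed g x = 1 / k" by (metis nonzero_mult_div_cancel_left k less_irrefl)
    then show ?thesis by (simp add: k_def)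
  qed
  show ?thesis
  proof (intro exI[of _ g] exI[of _ \<sigma>] conjI allI g \<sigma> cg sp)
    have "vd \<sigma> u > 0" for u using v k S(2) by simp
    then have "\<sigma> x \<le> \<sigma> y" if "x \<le> y" for x y
      using vd_pos_imp_increasing[OF s, of x y] that by (cases "x = y") auto
    then show "mono \<sigma>" by (rule monoI)
    show "\<sigma> 0 = 0" using G(2) by (simp add: \<sigma>_def)
    then show "\<sigma> (2 * pi) = 2 * pi" using \<sigma>_per[of 0] by simp
  qed
qed

text \<open>Constant speed turns the energy into a quadratic functional, to which \<open>L\<^sup>2\<close> methods apply.\<close>

lemma energy_constant_speed:
  assumes g: "g \<in> immersed_curves" and sp: "\<And>u. speed g u = r"
  shows "energy g = integral {0..2*pi} (\<lambda>u. (norm (vd (vd g) u))\<^sup>2) / r ^ 3"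
proof -
  note C = immersed_curvesD[OF g]
  have r: "r > 0" using smooth_speed(2)[OF g] sp by metis
  have "Ds g g = (\<lambda>u. (1/r) *\<^sub>R vd g u)" by (simp add: Ds_def sp fun_eq_iff)
  moreover have "vd (\<lambda>u. (1/r) *\<^sub>R vd g u) x = (1/r) *\<^sub>R vd (vd g) x" for x
    using smooth_has_vd[OF smooth_vd[OF C(1)]]
    by (intro vector_derivative_at) (auto intro!: derivative_eq_intros)
  ultimately have "Ds g (Ds g g) u = (1/r\<^sup>2) *\<^sub>R vd (vd g) u" for u
    unfolding Ds_def[of g "Ds g g"] by (simp add: sp power2_eq_square)
  then have "(norm (Ds g (Ds g g) u))\<^sup>2 * speed g u = (norm (vd (vd g) u))\<^sup>2 / r ^ 3" for u
    using r by (simp add: sp power_divide power2_eq_square field_simps eval_nat_numeral)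
  then show ?thesis
    by (simp add: energy_def integral_ds_def)
qed

section \<open>The second arc-length derivative of a vector field along a curve\<close>

lemma integral_Cauchy_Schwarz:
  fixes f g :: "real \<Rightarrow> real"
  assumes f: "continuous_on {a..b} f" and g: "continuous_on {a..b} g"
  shows "(integral {a..b} (\<lambda>x. f x * g x))\<^sup>2 \<le> integral {a..b} (\<lambda>x. (f x)\<^sup>2) * integral {a..b} (\<lambda>x. (g x)\<^sup>2)"
proof (cases "a < b")
  case False
  then have "integral {a..b} h = 0" for h :: "real \<Rightarrow> real"
    by (cases "a = b") auto
  then show ?thesis by simp
next
  case True
  define A where "A = integral {a..b} (\<lambda>x. f x * g x)"
  define B where "B = integral {a..b} (\<lambda>x. (g x)\<^sup>2)"
  define D where "D = integral {a..b} (\<lambda>x. (f x)\<^sup>2)"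
  have B0: "B \<ge> 0" unfolding B_def by (intro integral_nonneg integrable_continuous_real continuous_intros g) auto
  show ?thesis
  proof (cases "B = 0")
    case True
    then have "\<forall>x\<in>{a..b}. (g x)\<^sup>2 = 0"
      unfolding B_def using integral_eq_0_iff[of a b "\<lambda>x. (g x)\<^sup>2"] \<open>a < b\<close> g
      by (simp add: continuous_intros)
    then have "A = integral {a..b} (\<lambda>x. 0)" unfolding A_def by (intro integral_cong) simp
    then show ?thesis using True by (simp add: A_def B_def)
  next
    case False
    have "0 \<le> integral {a..b} (\<lambda>x. (B * f x - A * g x)\<^sup>2)"
      by (intro integral_nonneg integrable_continuous_real continuous_intros f g) auto
    also have "(\<lambda>x. (B * f x - A * g x)\<^sup>2) = (\<lambda>x. B\<^sup>2 * (f x)\<^sup>2 - 2 * A * B * (f x * g x) + A\<^sup>2 * (g x)\<^sup>2)"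
      by (simp add: fun_eq_iff power2_eq_square algebra_simps)
    also have "integral {a..b} \<dots> = B\<^sup>2 * D - 2 * A * B * A + A\<^sup>2 * B"
    proof -
      have 1: "(\<lambda>x. B\<^sup>2 * (f x)\<^sup>2) integrable_on {a..b}" "(\<lambda>x. 2 * A * B * (f x * g x)) integrable_on {a..b}"
        "(\<lambda>x. A\<^sup>2 * (g x)\<^sup>2) integrable_on {a..b}"
        by (intro integrable_continuous_real continuous_intros f g)+
      show ?thesis
        unfolding integral_add[OF integrable_diff[OF 1(1,2)] 1(3)] integral_diff[OF 1(1,2)]
        by (simp add: A_def B_def D_def)
    qed
    also have "\<dots> = B * (B * D - A\<^sup>2)" by (simp add: power2_eq_square algebra_simps)
    finally have "A\<^sup>2 \<le> B * D" using B0 False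
      by (simp add: zero_le_mult_iff)
    then show ?thesis by (simp add: A_def B_def D_def mult.commute)
  qed
qed

text \<open>\<open>D2s x y z w\<close> is \<open>D\<^sub>s\<^sup>2 h\<close> at a point where the curve has derivatives \<open>x\<close>, \<open>y\<close> and the field \<open>h\<close>
  has derivatives \<open>z\<close>, \<open>w\<close> with respect to the parameter.\<close>

definition D2s :: "'a::euclidean_space \<Rightarrow> 'a \<Rightarrow> 'a \<Rightarrow> 'a \<Rightarrow> 'a" where
  "D2s x y z w = inverse (norm x) ^ 2 *\<^sub>R w - ((x \<bullet> y) * inverse (norm x) ^ 4) *\<^sub>R z"

lemma inverse_norm_has_vector_derivative:
  fixes X :: "real \<Rightarrow> 'a::euclidean_space"
  assumes "(X has_vector_derivative y) (at u within S)" "X u \<noteq> 0"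
  shows "((\<lambda>u. inverse (norm (X u))) has_vector_derivative - ((X u \<bullet> y) * inverse (norm (X u)) ^ 3)) (at u within S)"
    and "((\<lambda>u. norm (X u)) has_vector_derivative (X u \<bullet> y) * inverse (norm (X u))) (at u within S)"
proof -
  have "(X has_derivative (\<lambda>h. h *\<^sub>R y)) (at u within S)"
    using assms(1) by (simp add: has_vector_derivative_def)
  from has_derivative_compose[OF this has_derivative_norm[OF assms(2)]]
  show n: "((\<lambda>u. norm (X u)) has_vector_derivative (X u \<bullet> y) * inverse (norm (X u))) (at u within S)"
    by (simp add: has_vector_derivative_def sgn_div_norm inner_commute divide_inverse mult_ac)
  then have "((\<lambda>u. norm (X u)) has_real_derivative (X u \<bullet> y) * inverse (norm (X u))) (at u within S)"
    by (simp add: has_real_derivative_iff_has_vector_derivative)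
  from DERIV_inverse_fun[OF this] assms(2)
  show "((\<lambda>u. inverse (norm (X u))) has_vector_derivative - ((X u \<bullet> y) * inverse (norm (X u)) ^ 3)) (at u within S)"
    by (simp add: has_real_derivative_iff_has_vector_derivative eval_nat_numeral mult_ac)
qed

text \<open>The chain rule \<open>\<partial>\<^sub>u (D\<^sub>s h) = \<bar>X\<bar> D\<^sub>s\<^sup>2 h\<close>.\<close>

lemma scaled_has_vector_derivative:
  fixes X Z :: "real \<Rightarrow> 'a::euclidean_space"
  assumes "(X has_vector_derivative y) (at u)" "(Z has_vector_derivative w) (at u)" "X u \<noteq> 0"
  shows "((\<lambda>u. inverse (norm (X u)) *\<^sub>R Z u) has_vector_derivative norm (X u) *\<^sub>R D2s (X u) y (Z u) w) (at u)"
proof -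
  have "((\<lambda>u. inverse (norm (X u)) *\<^sub>R Z u) has_vector_derivative
      inverse (norm (X u)) *\<^sub>R w + (- ((X u \<bullet> y) * inverse (norm (X u)) ^ 3)) *\<^sub>R Z u) (at u)"
    by (rule bounded_bilinear.has_vector_derivative[OF bounded_bilinear_scaleR
          inverse_norm_has_vector_derivative(1)[OF assms(1,3)] assms(2)])
  moreover have "norm (X u) *\<^sub>R D2s (X u) y (Z u) w
      = inverse (norm (X u)) *\<^sub>R w + (- ((X u \<bullet> y) * inverse (norm (X u)) ^ 3)) *\<^sub>R Z u"
  proof -
    define m where "m = inverse (norm (X u))"
    have "norm (X u) = inverse m" "m \<noteq> 0" using assms(3) by (simp_all add: m_def)
    then have 1: "inverse m * (m ^ 2) = m" "inverse m * (a * m ^ 4) = a * m ^ 3" for a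
      by (simp_all add: eval_nat_numeral)
    show ?thesis
      unfolding D2s_def m_def[symmetric] unfolding \<open>norm (X u) = inverse m\<close> scaleR_diff_right scaleR_scaleR 1
      by simp
  qed
  ultimately show ?thesis by metis
qed

lemma Ds_Ds_eq_D2s:
  fixes c h :: "real \<Rightarrow> 'a::euclidean_space"
  assumes "\<And>u. (c has_vector_derivative X u) (at u)" "\<And>u. (X has_vector_derivative Y u) (at u)"
    "\<And>u. (h has_vector_derivative Z u) (at u)" "\<And>u. (Z has_vector_derivative W u) (at u)"
    "\<And>u. X u \<noteq> 0"
  shows "Ds c (Ds c h) u = D2s (X u) (Y u) (Z u) (W u)"
proof -
  have sp: "speed c = (\<lambda>u. norm (X u))"
    using vector_derivative_at[OF assms(1)] by (simp add: speed_def fun_eq_iff)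
  have 1: "Ds c h = (\<lambda>u. inverse (norm (X u)) *\<^sub>R Z u)"
    using vector_derivative_at[OF assms(3)] by (simp add: Ds_def sp fun_eq_iff divide_inverse)
  have "vd (\<lambda>u. inverse (norm (X u)) *\<^sub>R Z u) u = norm (X u) *\<^sub>R D2s (X u) (Y u) (Z u) (W u)"
    by (rule vector_derivative_at[OF scaled_has_vector_derivative[OF assms(2,4,5)]])
  then show ?thesis
    using assms(5) unfolding Ds_def[of c "Ds c h"] unfolding 1 sp by simp
qed

text \<open>The first variation of \<open>\<bar>D\<^sub>s\<^sup>2c\<bar>\<^sup>2 ds\<close> in direction \<open>h\<close>, where \<open>z\<close> and \<open>w\<close> are the first and second parameter
  derivatives of \<open>h\<close>. The variation of the operator \<open>D\<^sub>s\<close> is \<open>- \<langle>D\<^sub>sh, D\<^sub>sc\<rangle> D\<^sub>s\<close>, which contributes \<open>-4\<close>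
  to the factor \<open>-3\<close>, and that of \<open>ds\<close> contributes \<open>1\<close>; the derivative of \<open>\<langle>D\<^sub>sh, D\<^sub>sc\<rangle>\<close> multiplies \<open>D\<^sub>sc\<close>, which is
  orthogonal to \<open>D\<^sub>s\<^sup>2c\<close>. The computation differentiates the density as a polynomial in
  \<open>\<langle>Y, Y\<rangle>\<close>, \<open>\<langle>X, Y\<rangle>\<close> and \<open>1 / \<bar>X\<bar>\<close>.\<close>

lemma energy_density_has_vector_derivative:
  fixes X Y :: "real \<Rightarrow> 'a::euclidean_space"
  assumes "(X has_vector_derivative z) (at v within S)" "(Y has_vector_derivative w) (at v within S)" "X v \<noteq> 0"
  defines "m \<equiv> inverse (norm (X v))"
  shows "((\<lambda>v. (norm (D2s (X v) (Y v) (X v) (Y v)))\<^sup>2 * norm (X v)) has_vector_derivative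
    2 * (D2s (X v) (Y v) (X v) (Y v) \<bullet> D2s (X v) (Y v) z w) * norm (X v)
     - 3 * ((z \<bullet> X v) * m\<^sup>2) * ((norm (D2s (X v) (Y v) (X v) (Y v)))\<^sup>2 * norm (X v))) (at v within S)"
proof -
  have e: "(norm (D2s x y x y))\<^sup>2 * norm x = (y \<bullet> y) * inverse (norm x) ^ 3 - (x \<bullet> y)\<^sup>2 * inverse (norm x) ^ 5"
    for x y :: 'a
  proof (cases "x = 0")
    case False
    define n where "n = norm x"
    have n: "n \<noteq> 0" "x \<bullet> x = n\<^sup>2" using False by (auto simp: n_def power2_norm_eq_inner)
    show ?thesis
      unfolding power2_norm_eq_inner D2s_def n_def[symmetric]
      using n by (simp add: inner_diff_left inner_diff_right inner_commute[of y x] divide_simps)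
        (simp add: algebra_simps eval_nat_numeral)
  qed simp
  let ?x = "X v" and ?y = "Y v"
  have dm: "((\<lambda>v. inverse (norm (X v))) has_real_derivative - ((?x \<bullet> z) * m ^ 3)) (at v within S)"
    using inverse_norm_has_vector_derivative(1)[OF assms(1,3)]
    by (simp add: has_real_derivative_iff_has_vector_derivative m_def)
  have dyy: "((\<lambda>v. Y v \<bullet> Y v) has_real_derivative (?y \<bullet> w + w \<bullet> ?y)) (at v within S)"
    unfolding has_real_derivative_iff_has_vector_derivative
    by (rule bounded_bilinear.has_vector_derivative[OF bounded_bilinear_inner assms(2) assms(2)])
  have dxy: "((\<lambda>v. X v \<bullet> Y v) has_real_derivative (?x \<bullet> w + z \<bullet> ?y)) (at v within S)"
    unfolding has_real_derivative_iff_has_vector_derivative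
    by (rule bounded_bilinear.has_vector_derivative[OF bounded_bilinear_inner assms(1) assms(2)])
  have n: "norm ?x * m = 1" "m \<noteq> 0" "?x \<bullet> ?x = norm ?x ^ 2"
    using assms(3) by (auto simp: m_def power2_norm_eq_inner)
  have nm: "norm ?x = inverse m" by (simp add: m_def)
  show ?thesis
    unfolding e has_real_derivative_iff_has_vector_derivative[symmetric]
    apply (rule DERIV_cong)
     apply (rule DERIV_diff DERIV_mult DERIV_power dm dyy dxy)+
    unfolding m_def[symmetric] unfolding D2s_def m_def[symmetric] nm
    using n(2) apply (simp add: inner_diff_left inner_diff_right inner_commute[of w] inner_commute[of z] inner_commute[of ?y ?x] n(3)[unfolded nm] divide_simps)
    apply (simp add: algebra_simps eval_nat_numeral)
    done
qed

lemma Cauchy_Schwarz_le: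
  fixes f g :: "real \<Rightarrow> real"
  assumes "continuous_on {a..b} f" "continuous_on {a..b} g"
  shows "integral {a..b} (\<lambda>x. f x * g x)
    \<le> sqrt (integral {a..b} (\<lambda>x. (f x)\<^sup>2)) * sqrt (integral {a..b} (\<lambda>x. (g x)\<^sup>2))"
  unfolding real_sqrt_mult[symmetric] by (rule real_le_rsqrt[OF integral_Cauchy_Schwarz[OF assms]])

text \<open>The derivative \<open>D\<^sub>s h\<close> of a field along a closed curve has mean zero with respect to
  arc length, so its norm is at most its total variation \<open>\<integral>\<bar>D\<^sub>s\<^sup>2 h\<bar> ds\<close>, to which the Cauchy-Schwarz
  inequality applies. The curve enters only through its derivative \<open>X\<close>, so that a constant \<open>X\<close> is
  allowed as well.\<close>

lemma arc_derivative_bound: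
  fixes X Z :: "real \<Rightarrow> 'a::euclidean_space"
  assumes X: "\<And>u. (X has_vector_derivative Y u) (at u)" "\<And>u. X u \<noteq> 0" "continuous_on UNIV Y"
    and h: "\<And>u. (h has_vector_derivative Z u) (at u)" "h (2 * pi) = h 0"
    and Z: "\<And>u. (Z has_vector_derivative W u) (at u)" "continuous_on UNIV W"
    and u: "u \<in> {0..2*pi}"
  defines "L \<equiv> integral {0..2*pi} (\<lambda>u. norm (X u))"
    and "H \<equiv> integral {0..2*pi} (\<lambda>u. (norm (D2s (X u) (Y u) (Z u) (W u)))\<^sup>2 * norm (X u))"
  shows "norm (Z u) \<le> sqrt (L * H) * norm (X u)" and "L > 0" and "H \<ge> 0"
proof -
  define I where "I = {0..2*pi}"
  have cX: "continuous_on A X" and cZ: "continuous_on A Z" for A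
    using X(1) Z(1) by (meson continuous_at_imp_continuous_on has_vector_derivative_continuous)+
  have cY: "continuous_on A Y" and cW: "continuous_on A W" for A
    using X(3) Z(2) continuous_on_subset by blast+
  define K where "K u = D2s (X u) (Y u) (Z u) (W u)" for u
  have cK: "continuous_on A K" for A
    unfolding K_def[abs_def] D2s_def
    by (intro continuous_intros cX cY cZ cW) (simp_all add: X(2))
  have L0: "L \<ge> 0" unfolding L_def by (intro integral_nonneg integrable_continuous_real continuous_intros cX) simp
  show "L > 0"
  proof (rule ccontr)
    assume "\<not> L > 0"
    then have "L = 0" using L0 by simp
    moreover have "continuous_on {0..2*pi} (\<lambda>x. norm (X x))" by (intro continuous_intros cX)
    ultimately have "\<forall>x\<in>{0..2*pi}. norm (X x) = 0"
      using integral_eq_0_iff[of 0 "2*pi" "\<lambda>x. norm (X x)"] by (simp add: L_def)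
    then have "norm (X 0) = 0" by simp
    then show False using X(2) by simp
  qed
  show H0: "H \<ge> 0" unfolding H_def K_def[symmetric]
    by (intro integral_nonneg integrable_continuous_real continuous_intros cX cK) simp
  define T where "T u = inverse (norm (X u)) *\<^sub>R Z u" for u
  have dT: "(T has_vector_derivative norm (X u) *\<^sub>R K u) (at u)" for u
    unfolding T_def[abs_def] K_def by (rule scaled_has_vector_derivative[OF X(1) Z(1) X(2)])
  have cT: "continuous_on A T" for A
    using dT by (meson continuous_at_imp_continuous_on has_vector_derivative_continuous)
  define P where "P = integral I (\<lambda>u. norm (X u) * norm (K u))"
  have P: "P \<le> sqrt (L * H)"
  proof -
    have "P = integral I (\<lambda>u. sqrt (norm (X u)) * (sqrt (norm (X u)) * norm (K u)))"
      unfolding P_def by (rule integral_cong) (simp add: mult.assoc[symmetric])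
    also have "\<dots> \<le> sqrt (integral I (\<lambda>u. (sqrt (norm (X u)))\<^sup>2)) * sqrt (integral I (\<lambda>u. (sqrt (norm (X u)) * norm (K u))\<^sup>2))"
      unfolding I_def by (intro Cauchy_Schwarz_le continuous_intros cX cK)
    also have "\<dots> = sqrt (L * H)"
      by (simp add: L_def H_def I_def K_def real_sqrt_mult power_mult_distrib mult.commute)
    finally show ?thesis .
  qed
  have TT: "norm (T a - T b) \<le> P" if "a \<in> I" "b \<in> I" "b \<le> a" for a b
  proof -
    have "((\<lambda>u. norm (X u) *\<^sub>R K u) has_integral (T a - T b)) {b..a}"
      by (rule fundamental_theorem_of_calculus[OF that(3)]) (rule has_vector_derivative_at_within[OF dT])
    then have "norm (T a - T b) = norm (integral {b..a} (\<lambda>u. norm (X u) *\<^sub>R K u))" by (simp add: integral_unique)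
    also have "\<dots> \<le> integral {b..a} (\<lambda>u. norm (X u) * norm (K u))"
      by (rule integral_norm_bound_integral) (auto intro!: integrable_continuous_real continuous_intros cX cK)
    also have "\<dots> \<le> P"
      unfolding P_def I_def using that
      by (intro integral_subset_le integrable_continuous_real continuous_intros cX cK) (auto simp: I_def)
    finally show ?thesis .
  qed
  have TT': "norm (T a - T b) \<le> P" if "a \<in> I" "b \<in> I" for a b
    using TT[of a b] TT[of b a] that by (cases "b \<le> a") (simp_all add: norm_minus_commute)
  have "integral I Z = 0"
    using integral_antiderivative[OF h(1), of 0 "2*pi"] h(2) by (simp add: I_def)
  moreover have "integral I (\<lambda>w. norm (X w) *\<^sub>R (T u - T w)) = integral I (\<lambda>w. norm (X w) *\<^sub>R T u) - integral I Z"
    unfolding I_def using X(2)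
    by (subst integral_diff[symmetric]) (auto intro!: integrable_continuous_real continuous_intros cX cZ integral_cong simp: T_def scaleR_diff_right)
  moreover have "integral I (\<lambda>w. norm (X w) *\<^sub>R T u) = L *\<^sub>R T u"
    unfolding I_def L_def
    by (rule integral_unique, rule has_integral_scaleR_left) (intro integrable_integral integrable_continuous_real continuous_intros cX)
  ultimately have "L * norm (T u) = norm (integral I (\<lambda>w. norm (X w) *\<^sub>R (T u - T w)))"
    using L0 by simp
  also have "\<dots> \<le> integral I (\<lambda>w. norm (X w) * P)"
    unfolding I_def
  proof (rule integral_norm_bound_integral)
    show "norm (norm (X w) *\<^sub>R (T u - T w)) \<le> norm (X w) * P" if "w \<in> {0..2*pi}" for w
      using TT'[of u w] u that by (simp add: I_def mult_left_mono)
  qed (intro integrable_continuous_real continuous_intros cX cT)+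
  also have "\<dots> = L * P" by (simp add: L_def I_def)
  finally have "norm (T u) \<le> P" using \<open>L > 0\<close> by simp
  then have "norm (T u) \<le> sqrt (L * H)" using P by simp
  then have "norm (T u) * norm (X u) \<le> sqrt (L * H) * norm (X u)" by (rule mult_right_mono) simp
  moreover have "norm (T u) * norm (X u) = norm (Z u)"
    using X(2)[of u] by (simp add: T_def)
  ultimately show "norm (Z u) \<le> sqrt (L * H) * norm (X u)" by simp
qed

section \<open>Smooth functions on the strip\<close>

abbreviation strip :: "(real \<times> real) set" where "strip \<equiv> UNIV \<times> {0..1}"

text \<open>The partial derivatives in the curve parameter and in the time, the latter one-sided at the times \<open>0\<close> and \<open>1\<close>.\<close>

definition P1 :: "(real \<times> real \<Rightarrow> 'b::real_normed_vector) \<Rightarrow> real \<times> real \<Rightarrow> 'b" where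
  "P1 f x = frechet_derivative f (at x within strip) (1, 0)"

definition P2 :: "(real \<times> real \<Rightarrow> 'b::real_normed_vector) \<Rightarrow> real \<times> real \<Rightarrow> 'b" where
  "P2 f x = frechet_derivative f (at x within strip) (0, 1)"

lemma
  fixes f :: "real \<times> real \<Rightarrow> 'b::real_normed_vector"
  assumes "smooth_on strip f"
  shows smooth_P1: "smooth_on strip (P1 f)" and smooth_P2: "smooth_on strip (P2 f)"
    and strip_continuous: "continuous_on strip f"
    and P1_has_vd: "v \<in> {0..1} \<Longrightarrow> ((\<lambda>u. f (u, v)) has_vector_derivative P1 f (u, v)) (at u)"
    and P2_has_vd: "v \<in> {0..1} \<Longrightarrow> ((\<lambda>v. f (u, v)) has_vector_derivative P2 f (u, v)) (at v within {0..1})"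
proof -
  have *: "Ck_on (Suc k) strip f" for k using assms by (simp only: smooth_on_def)
  show "smooth_on strip (P1 f)" "smooth_on strip (P2 f)"
    using * by (auto simp: smooth_on_def P1_def[abs_def] P2_def[abs_def])
  show "continuous_on strip f" using assms by (auto simp: smooth_on_def dest: spec[of _ 0])
  have D: "(f has_derivative frechet_derivative f (at x within strip)) (at x within strip)" if "x \<in> strip" for x
    using *[of 0] that by (auto simp: differentiable_on_def frechet_derivative_works)
  have lin: "linear (frechet_derivative f (at x within strip))" if "x \<in> strip" for x
    using has_derivative_linear[OF D[OF that]] .
  show "((\<lambda>u. f (u, v)) has_vector_derivative P1 f (u, v)) (at u)" if "v \<in> {0..1}"
  proof -
    have "((\<lambda>u. (u, v)) has_derivative (\<lambda>h. (h, 0))) (at u)"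
      by (auto intro!: derivative_eq_intros)
    moreover have "(f has_derivative frechet_derivative f (at (u, v) within strip)) (at (u, v) within range (\<lambda>u. (u, v)))"
      by (rule has_derivative_subset[OF D]) (use that in auto)
    ultimately have "((\<lambda>u. f (u, v)) has_derivative (\<lambda>h. frechet_derivative f (at (u, v) within strip) (h, 0))) (at u)"
      using diff_chain_within[of "\<lambda>u. (u, v)" "\<lambda>h. (h, 0)" u UNIV f] by (simp add: o_def)
    moreover have "frechet_derivative f (at (u, v) within strip) (h, 0) = h *\<^sub>R P1 f (u, v)" for h
      using linear_scale[OF lin, of "(u, v)" h "(1, 0)"] that by (simp add: P1_def)
    ultimately show ?thesis by (simp add: has_vector_derivative_def)
  qed
  show "((\<lambda>v. f (u, v)) has_vector_derivative P2 f (u, v)) (at v within {0..1})" if "v \<in> {0..1}"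
  proof -
    have "((\<lambda>v. (u, v)) has_derivative (\<lambda>h. (0, h))) (at v within {0..1})"
      by (auto intro!: derivative_eq_intros)
    moreover have "(f has_derivative frechet_derivative f (at (u, v) within strip)) (at (u, v) within (\<lambda>v. (u, v)) ` {0..1})"
      by (rule has_derivative_subset[OF D]) (use that in auto)
    ultimately have "((\<lambda>v. f (u, v)) has_derivative (\<lambda>h. frechet_derivative f (at (u, v) within strip) (0, h))) (at v within {0..1})"
      using diff_chain_within[of "\<lambda>v. (u, v)" "\<lambda>h. (0, h)" v "{0..1}" f] by (simp add: o_def)
    moreover have "frechet_derivative f (at (u, v) within strip) (0, h) = h *\<^sub>R P2 f (u, v)" for h
      using linear_scale[OF lin, of "(u, v)" h "(0, 1)"] that by (simp add: P2_def)
    ultimately show ?thesis by (simp add: has_vector_derivative_def)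
  qed
qed

lemma P2_interior_has_vd:
  assumes "smooth_on strip f" "v \<in> {0<..<1}"
  shows "((\<lambda>v. f (u, v)) has_vector_derivative P2 f (u, v)) (at v)"
proof -
  have "((\<lambda>v. f (u, v)) has_vector_derivative P2 f (u, v)) (at v within {0<..<1})"
    by (rule has_vector_derivative_within_subset[OF P2_has_vd[OF assms(1)]]) (use assms(2) in auto)
  then show ?thesis
    using assms(2) by (subst (asm) has_vector_derivative_within_open) auto
qed

text \<open>Differentiating \<open>f(u, w) - f(u, v) = \<integral>\<^sub>v\<^sup>w \<partial>\<^sub>2f(u, t) dt\<close> first in \<open>u\<close> and then in \<open>w\<close> from the right.\<close>

lemma P2_P1_commute:
  fixes f :: "real \<times> real \<Rightarrow> 'b::euclidean_space"
  assumes f: "smooth_on strip f" and v: "v \<in> {0<..<1}"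
  shows "P2 (P1 f) (u, v) = P1 (P2 f) (u, v)"
proof -
  have v01: "v \<in> {0..1}" using v by simp
  define G where "G t = P1 (P2 f) (u, t)" for t
  have cG: "continuous_on {v..1} G"
    unfolding G_def
    by (rule continuous_on_compose2[OF strip_continuous[OF smooth_P1[OF smooth_P2[OF f]]]])
      (use v in \<open>auto intro!: continuous_intros\<close>)
  have int: "f (x, w) - f (x, v) = integral {v..w} (\<lambda>t. P2 f (x, t))" if "w \<in> {v..1}" for x w
  proof -
    have "((\<lambda>t. P2 f (x, t)) has_integral f (x, w) - f (x, v)) {v..w}"
      using that v by (intro fundamental_theorem_of_calculus
          has_vector_derivative_within_subset[OF P2_has_vd[OF f]]) auto
    then show ?thesis by (simp add: integral_unique)
  qed
  have eq: "P1 f (u, w) - P1 f (u, v) = integral {v..w} G" if w: "w \<in> {v..1}" for w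
  proof -
    have "((\<lambda>x. integral (cbox v w) (\<lambda>t. P2 f (x, t))) has_vector_derivative
        integral (cbox v w) (\<lambda>t. P1 (P2 f) (u, t))) (at u within UNIV)"
    proof (rule leibniz_rule_vector_derivative)
      show "((\<lambda>x. P2 f (x, t)) has_vector_derivative P1 (P2 f) (x, t)) (at x within UNIV)"
        if "t \<in> cbox v w" for x t
        by (rule P1_has_vd[OF smooth_P2[OF f]]) (use that w v in auto)
      show "(\<lambda>t. P2 f (x, t)) integrable_on cbox v w" for x
        using w v unfolding cbox_interval
        by (intro integrable_continuous_real continuous_on_compose2[OF strip_continuous[OF smooth_P2[OF f]]])
          (auto intro!: continuous_intros)
      show "continuous_on (UNIV \<times> cbox v w) (\<lambda>(x, t). P1 (P2 f) (x, t))"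
        using w v by (intro continuous_on_subset[OF strip_continuous[OF smooth_P1[OF smooth_P2[OF f]]], THEN continuous_on_eq]) auto
    qed auto
    then have 1: "((\<lambda>x. f (x, w) - f (x, v)) has_vector_derivative integral {v..w} G) (at u)"
      using int[OF w] by (simp add: G_def[abs_def])
    have "((\<lambda>x. f (x, w) - f (x, v)) has_vector_derivative P1 f (u, w) - P1 f (u, v)) (at u)"
      using w v by (intro has_vector_derivative_diff P1_has_vd[OF f]) auto
    from vector_derivative_unique_at[OF this 1] show ?thesis .
  qed
  have "((\<lambda>w. integral {v..w} G) has_vector_derivative G v) (at v within {v..1})"
    by (rule integral_has_vector_derivative[OF cG]) (use v in auto)
  then have 1: "((\<lambda>w. P1 f (u, w) - P1 f (u, v)) has_vector_derivative G v) (at v within {v..1})"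
    by (rule has_vector_derivative_transform[rotated 2]) (use v eq in auto)
  have "((\<lambda>w. P1 f (u, w) - P1 f (u, v)) has_vector_derivative P2 (P1 f) (u, v) - 0) (at v within {v..1})"
    by (intro has_vector_derivative_diff has_vector_derivative_const
        has_vector_derivative_within_subset[OF P2_has_vd[OF smooth_P1[OF f] v01]]) (use v in auto)
  from vector_derivative_within_closed_interval[OF _ _ this] vector_derivative_within_closed_interval[OF _ _ 1]
  show ?thesis using v by (simp add: G_def)
qed

section \<open>Length and energy along a homotopy\<close>

text \<open>The homotopy is differentiated only at interior times, since one-sided derivatives at the ends would
  complicate the interchange of partial derivatives.\<close>

lemma abs_diff_le_integral:
  fixes f :: "real \<Rightarrow> real"
  assumes "a \<le> b" "continuous_on {a..b} f" "continuous_on {a..b} g"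
    and d: "\<And>x. x \<in> {a<..<b} \<Longrightarrow> (f has_vector_derivative f' x) (at x)"
    and le: "\<And>x. x \<in> {a<..<b} \<Longrightarrow> \<bar>f' x\<bar> \<le> g x"
    and g: "\<And>x. x \<in> {a..b} \<Longrightarrow> 0 \<le> g x"
  shows "\<bar>f b - f a\<bar> \<le> integral {a..b} g"
proof -
  define F where "F x = (if x \<in> {a<..<b} then f' x else 0)" for x
  have F: "(F has_integral (f b - f a)) {a..b}"
    using assms(1,2) by (rule fundamental_theorem_of_calculus_interior) (simp add: F_def d)
  then have "\<bar>f b - f a\<bar> = norm (integral {a..b} F)" by (simp add: integral_unique)
  also have "\<dots> \<le> integral {a..b} g"
  proof (rule integral_norm_bound_integral)
    show "norm (F x) \<le> g x" if "x \<in> {a..b}" for x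
      using le[of x] g[OF that] by (simp add: F_def)
  qed (use F assms(3) in \<open>auto intro: integrable_continuous_real has_integral_integrable\<close>)
  finally show ?thesis .
qed

text \<open>\<open>X\<close>, \<open>Y\<close> are the first two parameter derivatives of the curve and \<open>Z\<close>, \<open>W\<close> those of the velocity
  \<open>\<partial>\<^sub>vC\<close>. In these terms \<open>curv\<close> is \<open>D\<^sub>s\<^sup>2c\<close>, \<open>vel2\<close> is \<open>D\<^sub>s\<^sup>2(\<partial>\<^sub>vC)\<close>,
  \<open>accel_at\<close> is \<open>\<integral>\<bar>D\<^sub>s\<^sup>2(\<partial>\<^sub>vC)\<bar>\<^sup>2 ds\<close> and \<open>norm_at\<close> is the integrand of the length of the homotopy.\<close>

locale curve_homotopy =
  fixes C :: "real \<times> real \<Rightarrow> 'a::euclidean_space" and lam :: real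
  assumes smooth: "smooth_on strip C" and lam: "lam > 0"
    and immersed: "\<And>v. v \<in> {0..1} \<Longrightarrow> (\<lambda>u. C (u, v)) \<in> immersed_curves"
begin

definition "X u v = P1 C (u, v)"
definition "Y u v = P1 (P1 C) (u, v)"
definition "Z u v = P1 (P2 C) (u, v)"
definition "W u v = P1 (P1 (P2 C)) (u, v)"
definition "curv u v = D2s (X u v) (Y u v) (X u v) (Y u v)"
definition "vel2 u v = D2s (X u v) (Y u v) (Z u v) (W u v)"
definition "len_at v = len (\<lambda>u. C (u, v))"
definition "energy_at v = energy (\<lambda>u. C (u, v))"
definition "accel_at v = integral {0..2*pi} (\<lambda>u. (norm (vel2 u v))\<^sup>2 * norm (X u v))"
definition "norm_at v = H2_norm lam (\<lambda>u. C (u, v)) (\<lambda>u. vector_derivative (\<lambda>w. C (u, w)) (at v within {0..1}))"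

lemmas sm = smooth_P1[OF smooth] smooth_P2[OF smooth] smooth_P1[OF smooth_P1[OF smooth]]
  smooth_P1[OF smooth_P2[OF smooth]] smooth_P1[OF smooth_P1[OF smooth_P2[OF smooth]]]

lemma derivatives_in_u:
  assumes "v \<in> {0..1}"
  shows "((\<lambda>u. C (u, v)) has_vector_derivative X u v) (at u)"
    "((\<lambda>u. X u v) has_vector_derivative Y u v) (at u)"
    "((\<lambda>u. P2 C (u, v)) has_vector_derivative Z u v) (at u)"
    "((\<lambda>u. Z u v) has_vector_derivative W u v) (at u)"
  using P1_has_vd[OF smooth assms] P1_has_vd[OF sm(1) assms] P1_has_vd[OF sm(2) assms] P1_has_vd[OF sm(4) assms]
  by (simp_all add: X_def Y_def Z_def W_def)

lemma derivatives_in_v: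
  assumes "v \<in> {0<..<1}"
  shows "((\<lambda>v. X u v) has_vector_derivative Z u v) (at v)"
    "((\<lambda>v. Y u v) has_vector_derivative W u v) (at v)"
proof -
  show "((\<lambda>v. X u v) has_vector_derivative Z u v) (at v)"
    using P2_interior_has_vd[OF sm(1) assms] P2_P1_commute[OF smooth assms]
    by (simp add: X_def Z_def)
  have "P2 (P1 (P1 C)) (u, v) = P1 (P2 (P1 C)) (u, v)"
    by (rule P2_P1_commute[OF sm(1) assms])
  also have "\<dots> = W u v"
  proof -
    have v: "v \<in> {0..1}" using assms by simp
    have "((\<lambda>u. P2 (P1 C) (u, v)) has_vector_derivative P1 (P2 (P1 C)) (u, v)) (at u)"
      by (rule P1_has_vd[OF smooth_P2[OF sm(1)] v])
    then have "((\<lambda>u. Z u v) has_vector_derivative P1 (P2 (P1 C)) (u, v)) (at u)"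
      using P2_P1_commute[OF smooth assms] by (simp add: Z_def)
    from vector_derivative_unique_at[OF this derivatives_in_u(4)[OF v]] show ?thesis .
  qed
  finally show "((\<lambda>v. Y u v) has_vector_derivative W u v) (at v)"
    using P2_interior_has_vd[OF sm(3) assms, of u] by (simp add: Y_def)
qed

lemma X_nz: "v \<in> {0..1} \<Longrightarrow> X u v \<noteq> 0"
  using immersed_curvesD(3)[OF immersed, of v u] vector_derivative_at[OF derivatives_in_u(1), of v u] by simp

lemma continuous_partials_pairs:
  "continuous_on ({0..1} \<times> A) (\<lambda>(v, u). X u v)" "continuous_on ({0..1} \<times> A) (\<lambda>(v, u). Y u v)"
  "continuous_on ({0..1} \<times> A) (\<lambda>(v, u). Z u v)" "continuous_on ({0..1} \<times> A) (\<lambda>(v, u). W u v)"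
  "continuous_on ({0..1} \<times> A) (\<lambda>(v, u). P2 C (u, v))"
proof -
  have *: "continuous_on ({0..1} \<times> A) (\<lambda>(v, u). f (u, v))" if "smooth_on strip f" for f :: "real \<times> real \<Rightarrow> 'a"
  proof -
    have "continuous_on ({0..1} \<times> A) (\<lambda>x. f (snd x, fst x))"
      by (rule continuous_on_compose2[OF strip_continuous[OF that]]) (auto intro!: continuous_intros)
    then show ?thesis by (simp add: case_prod_beta)
  qed
  show "continuous_on ({0..1} \<times> A) (\<lambda>(v, u). X u v)" "continuous_on ({0..1} \<times> A) (\<lambda>(v, u). Y u v)"
  "continuous_on ({0..1} \<times> A) (\<lambda>(v, u). Z u v)" "continuous_on ({0..1} \<times> A) (\<lambda>(v, u). W u v)"
  "continuous_on ({0..1} \<times> A) (\<lambda>(v, u). P2 C (u, v))"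
    using *[OF sm(1)] *[OF sm(2)] *[OF sm(3)] *[OF sm(4)] *[OF sm(5)]
    by (simp_all only: X_def Y_def Z_def W_def)
qed

lemmas continuous_partials = continuous_partials_pairs[unfolded case_prod_beta]

lemma continuous_D2s_partials:
  "continuous_on ({0..1} \<times> A) (\<lambda>x. curv (snd x) (fst x))"
  "continuous_on ({0..1} \<times> A) (\<lambda>x. vel2 (snd x) (fst x))"
  unfolding curv_def vel2_def D2s_def
  by (intro continuous_intros continuous_partials; use X_nz in force)+

lemma slice:
  assumes "continuous_on ({0..1} \<times> UNIV) (\<lambda>x. f (snd x) (fst x))" "v \<in> {0..1}"
  shows "continuous_on A (\<lambda>u. f u v)"
  using assms(2) continuous_on_compose2[OF assms(1), of A "\<lambda>u. (v, u)"]
  by (force intro: continuous_intros)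

lemma functionals_by_partials:
  assumes "v \<in> {0..1}"
  shows "len_at v = integral {0..2*pi} (\<lambda>u. norm (X u v))"
    and "energy_at v = integral {0..2*pi} (\<lambda>u. (norm (curv u v))\<^sup>2 * norm (X u v))"
    and "norm_at v = sqrt (1 / len_at v * integral {0..2*pi} (\<lambda>u. (norm (P2 C (u, v)))\<^sup>2 * norm (X u v)) + lam * len_at v ^ 3 * accel_at v)"
proof -
  have sp: "speed (\<lambda>u. C (u, v)) = (\<lambda>u. norm (X u v))"
    using vector_derivative_at[OF derivatives_in_u(1)[OF assms]] by (simp add: speed_def fun_eq_iff)
  have h: "vector_derivative (\<lambda>w. C (u, w)) (at v within {0..1}) = P2 C (u, v)" for u
    by (rule vector_derivative_within_closed_interval[OF _ assms P2_has_vd[OF smooth assms]]) simp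
  show 1: "len_at v = integral {0..2*pi} (\<lambda>u. norm (X u v))" by (simp add: len_at_def len_def sp)
  have 2: "Ds (\<lambda>u. C (u, v)) (Ds (\<lambda>u. C (u, v)) (\<lambda>u. C (u, v))) u = curv u v" for u
    unfolding curv_def by (rule Ds_Ds_eq_D2s[OF derivatives_in_u(1,2)[OF assms] derivatives_in_u(1,2)[OF assms] X_nz[OF assms]])
  show "energy_at v = integral {0..2*pi} (\<lambda>u. (norm (curv u v))\<^sup>2 * norm (X u v))"
    by (simp add: energy_at_def energy_def integral_ds_def sp 2)
  have 3: "Ds (\<lambda>u. C (u, v)) (Ds (\<lambda>u. C (u, v)) (\<lambda>u. P2 C (u, v))) u = vel2 u v" for u
    unfolding vel2_def by (rule Ds_Ds_eq_D2s[OF derivatives_in_u[OF assms] X_nz[OF assms]])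
  show "norm_at v = sqrt (1 / len_at v * integral {0..2*pi} (\<lambda>u. (norm (P2 C (u, v)))\<^sup>2 * norm (X u v)) + lam * len_at v ^ 3 * accel_at v)"
    unfolding norm_at_def H2_norm_def h len_at_def[symmetric] integral_ds_def 3 sp accel_at_def ..
qed

lemma cont_param:
  fixes f :: "real \<Rightarrow> real \<Rightarrow> real"
  assumes "continuous_on ({0..1} \<times> {0..2*pi}) (\<lambda>x. f (snd x) (fst x))"
  shows "continuous_on {0..1} (\<lambda>v. integral {0..2*pi} (\<lambda>u. f u v))"
  using integral_continuous_on_param[of "{0..1}" 0 "2*pi" "\<lambda>v u. f u v"] assms
  by (simp add: case_prod_beta)

lemma len_at_pos: "v \<in> {0..1} \<Longrightarrow> len_at v > 0"
  unfolding len_at_def by (rule smooth_speed(4)[OF immersed])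

lemma energy_at_nonneg: "v \<in> {0..1} \<Longrightarrow> energy_at v \<ge> 0"
  unfolding functionals_by_partials by (intro integral_nonneg integrable_continuous_real continuous_intros slice[OF continuous_partials(1)] slice[OF continuous_D2s_partials(1)]) simp_all

lemma continuous_functionals: "continuous_on {0..1} len_at" "continuous_on {0..1} energy_at" "continuous_on {0..1} norm_at"
proof -
  have "continuous_on {0..1} (\<lambda>v. integral {0..2*pi} (\<lambda>u. norm (X u v)))"
    by (intro cont_param continuous_intros continuous_partials)
  then show L: "continuous_on {0..1} len_at" by (rule continuous_on_eq) (simp add: functionals_by_partials)
  have "continuous_on {0..1} (\<lambda>v. integral {0..2*pi} (\<lambda>u. (norm (curv u v))\<^sup>2 * norm (X u v)))"
    by (intro cont_param continuous_intros continuous_partials continuous_D2s_partials)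
  then show "continuous_on {0..1} energy_at" by (rule continuous_on_eq) (simp add: functionals_by_partials)
  have "continuous_on {0..1} accel_at"
    unfolding accel_at_def[abs_def] by (intro cont_param continuous_intros continuous_partials continuous_D2s_partials)
  moreover have "continuous_on {0..1} (\<lambda>v. integral {0..2*pi} (\<lambda>u. (norm (P2 C (u, v)))\<^sup>2 * norm (X u v)))"
    by (intro cont_param[of "\<lambda>u v. (norm (P2 C (u, v)))\<^sup>2 * norm (X u v)"] continuous_intros continuous_partials)
  ultimately have "continuous_on {0..1} (\<lambda>v. sqrt (1 / len_at v * integral {0..2*pi} (\<lambda>u. (norm (P2 C (u, v)))\<^sup>2 * norm (X u v)) + lam * len_at v ^ 3 * accel_at v))"
    using L len_at_pos by (intro continuous_intros) (auto simp: less_imp_neq[symmetric])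
  then show "continuous_on {0..1} norm_at" by (rule continuous_on_eq) (simp add: functionals_by_partials)
qed

lemma deriv_param:
  fixes f :: "real \<Rightarrow> real \<Rightarrow> real"
  assumes f: "continuous_on ({0..1} \<times> UNIV) (\<lambda>x. f (snd x) (fst x))"
    and f': "continuous_on ({0..1} \<times> UNIV) (\<lambda>x. f' (snd x) (fst x))"
    and d: "\<And>u v. v \<in> {0<..<1} \<Longrightarrow> ((\<lambda>v. f u v) has_vector_derivative f' u v) (at v)"
    and v: "v \<in> {0<..<1}"
  shows "((\<lambda>v. integral {0..2*pi} (\<lambda>u. f u v)) has_vector_derivative integral {0..2*pi} (\<lambda>u. f' u v)) (at v)"
proof -
  have "((\<lambda>v. integral (cbox 0 (2*pi)) (\<lambda>u. f u v)) has_vector_derivative integral (cbox 0 (2*pi)) (\<lambda>u. f' u v)) (at v within {0<..<1})"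
  proof (rule leibniz_rule_vector_derivative)
    show "((\<lambda>v. f u v) has_vector_derivative f' u v) (at v within {0<..<1})" if "v \<in> {0<..<1}" for u v
      using d[OF that] by (rule has_vector_derivative_at_within)
    show "(\<lambda>u. f u v) integrable_on cbox 0 (2 * pi)" if "v \<in> {0<..<1}" for v
      unfolding cbox_interval using that by (intro integrable_continuous_real slice[OF f]) simp
    have "continuous_on ({0<..<1} \<times> cbox 0 (2 * pi)) (\<lambda>x. f' (snd x) (fst x))"
      by (rule continuous_on_subset[OF f']) auto
    then show "continuous_on ({0<..<1} \<times> cbox 0 (2 * pi)) (\<lambda>(v, u). f' u v)"
      by (simp add: case_prod_beta)
  qed (use v in auto)
  then show ?thesis using v by (subst (asm) has_vector_derivative_within_open) auto
qed

definition "len_at' v = integral {0..2*pi} (\<lambda>u. (X u v \<bullet> Z u v) * inverse (norm (X u v)))"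
definition "energy_at' v = integral {0..2*pi} (\<lambda>u. 2 * (curv u v \<bullet> vel2 u v) * norm (X u v)
    - 3 * ((Z u v \<bullet> X u v) * (inverse (norm (X u v)))\<^sup>2) * ((norm (curv u v))\<^sup>2 * norm (X u v)))"

lemma derivatives:
  assumes v: "v \<in> {0<..<1}"
  shows "(len_at has_vector_derivative len_at' v) (at v)" "(energy_at has_vector_derivative energy_at' v) (at v)"
proof -
  have v01: "w \<in> {0<..<1} \<Longrightarrow> w \<in> {0..1}" for w :: real by simp
  have "((\<lambda>v. integral {0..2*pi} (\<lambda>u. norm (X u v))) has_vector_derivative len_at' v) (at v)"
    unfolding len_at'_def
    by (rule deriv_param[OF _ _ inverse_norm_has_vector_derivative(2)[OF derivatives_in_v(1) X_nz[OF v01]] v])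
      (auto intro!: continuous_intros continuous_partials simp: X_nz)
  then show "(len_at has_vector_derivative len_at' v) (at v)"
    by (rule has_vector_derivative_transform_within_open[of _ _ _ "{0<..<1}"]) (use v in \<open>auto simp: functionals_by_partials\<close>)
  have "((\<lambda>v. integral {0..2*pi} (\<lambda>u. (norm (curv u v))\<^sup>2 * norm (X u v))) has_vector_derivative energy_at' v) (at v)"
    unfolding energy_at'_def
  proof (rule deriv_param[OF _ _ _ v])
    show "((\<lambda>v. (norm (curv u v))\<^sup>2 * norm (X u v)) has_vector_derivative 2 * (curv u v \<bullet> vel2 u v) * norm (X u v)
      - 3 * ((Z u v \<bullet> X u v) * (inverse (norm (X u v)))\<^sup>2) * ((norm (curv u v))\<^sup>2 * norm (X u v))) (at v)"
      if "v \<in> {0<..<1}" for u v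
      unfolding curv_def vel2_def
      by (rule energy_density_has_vector_derivative[OF derivatives_in_v[OF that] X_nz[OF v01[OF that]]])
  qed (auto intro!: continuous_intros continuous_partials continuous_D2s_partials simp: X_nz)
  then show "(energy_at has_vector_derivative energy_at' v) (at v)"
    by (rule has_vector_derivative_transform_within_open[of _ _ _ "{0<..<1}"]) (use v in \<open>auto simp: functionals_by_partials\<close>)
qed

text \<open>The part \<open>\<lambda> L\<^sup>3 \<integral>\<bar>D\<^sub>s\<^sup>2h\<bar>\<^sup>2 ds\<close> of the squared norm, inserted in \<open>arc_derivative_bound\<close>. The
  power \<open>L\<^sup>3\<close> is what makes the bound for the rate of change of \<open>L\<close> independent of \<open>L\<close>.\<close>

lemma field_bounds:
  assumes v: "v \<in> {0..1}"
  shows "accel_at v \<ge> 0" "norm_at v \<ge> 0" "sqrt (accel_at v) \<le> norm_at v / sqrt (lam * len_at v ^ 3)"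
    "sqrt (len_at v * accel_at v) \<le> norm_at v / (sqrt lam * len_at v)"
    "u \<in> {0..2*pi} \<Longrightarrow> norm (Z u v) \<le> norm_at v / (sqrt lam * len_at v) * norm (X u v)"
proof -
  have per: "P2 C (2 * pi, v) = P2 C (0, v)"
  proof -
    have "C (2 * pi, w) = C (0, w)" if "w \<in> {0..1}" for w
      using immersed_curvesD(2)[OF immersed[OF that]] unfolding periodic_def by (metis add_0)
    then have "((\<lambda>w. C (0, w)) has_vector_derivative P2 C (2 * pi, v)) (at v within {0..1})"
      using has_vector_derivative_transform[OF v _ P2_has_vd[OF smooth v, of "2*pi"], of "\<lambda>w. C (0, w)"] by simp
    from vector_derivative_within_closed_interval[OF _ v this]
      vector_derivative_within_closed_interval[OF _ v P2_has_vd[OF smooth v, of 0]]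
    show ?thesis by simp
  qed
  note B = arc_derivative_bound[OF derivatives_in_u(2)[OF v] X_nz[OF v] slice[OF continuous_partials(2) v] derivatives_in_u(3)[OF v] per derivatives_in_u(4)[OF v] slice[OF continuous_partials(4) v],
      folded vel2_def, folded functionals_by_partials(1)[OF v] accel_at_def]
  have L: "len_at v > 0" by (rule len_at_pos[OF v])
  show H: "accel_at v \<ge> 0" using B(3)[of 0] by simp
  define Q where "Q = 1 / len_at v * integral {0..2*pi} (\<lambda>u. (norm (P2 C (u, v)))\<^sup>2 * norm (X u v))"
  have Q: "Q \<ge> 0"
    unfolding Q_def using L
    by (intro mult_nonneg_nonneg integral_nonneg integrable_continuous_real continuous_intros slice[OF continuous_partials(1) v] slice[OF continuous_partials(5) v])
     simp_all
  have Nv: "norm_at v = sqrt (Q + lam * len_at v ^ 3 * accel_at v)" unfolding functionals_by_partials(3)[OF v] Q_def ..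
  show N0: "norm_at v \<ge> 0" unfolding Nv using Q H L lam by simp
  have "sqrt (lam * len_at v ^ 3) * sqrt (accel_at v) \<le> norm_at v"
    unfolding Nv real_sqrt_mult[symmetric] using Q by simp
  then show 1: "sqrt (accel_at v) \<le> norm_at v / sqrt (lam * len_at v ^ 3)"
    using L lam by (simp add: pos_le_divide_eq mult.commute)
  have "sqrt (len_at v * accel_at v) \<le> sqrt (len_at v) * (norm_at v / sqrt (lam * len_at v ^ 3))"
    unfolding real_sqrt_mult using 1 L by (intro mult_left_mono) (simp_all add: real_sqrt_mult)
  also have "\<dots> = norm_at v / (sqrt lam * len_at v)"
    using L lam by (simp add: real_sqrt_mult eval_nat_numeral)
  finally show 2: "sqrt (len_at v * accel_at v) \<le> norm_at v / (sqrt lam * len_at v)" .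
  show "norm (Z u v) \<le> norm_at v / (sqrt lam * len_at v) * norm (X u v)" if u: "u \<in> {0..2*pi}"
    using B(1)[OF u] mult_right_mono[OF 2, of "norm (X u v)"] by simp
qed

lemma len_at'_bound:
  assumes v: "v \<in> {0<..<1}"
  shows "\<bar>len_at' v\<bar> \<le> norm_at v / sqrt lam"
proof -
  have v': "v \<in> {0..1}" using v by simp
  note L = len_at_pos[OF v']
  define A where "A = norm_at v / (sqrt lam * len_at v)"
  have "norm (len_at' v) \<le> integral {0..2*pi} (\<lambda>u. A * norm (X u v))"
    unfolding len_at'_def
  proof (rule integral_norm_bound_integral)
    show "norm ((X u v \<bullet> Z u v) * inverse (norm (X u v))) \<le> A * norm (X u v)" if "u \<in> {0..2*pi}" for u
    proof -
      have "norm ((X u v \<bullet> Z u v) * inverse (norm (X u v))) \<le> (norm (X u v) * norm (Z u v)) * inverse (norm (X u v))"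
        using Cauchy_Schwarz_ineq2[of "X u v" "Z u v"] by (simp add: abs_mult mult_right_mono)
      also have "\<dots> = norm (Z u v)" using X_nz[OF v'] by simp
      also have "\<dots> \<le> A * norm (X u v)" unfolding A_def by (rule field_bounds(5)[OF v' that])
      finally show ?thesis .
    qed
  qed (intro integrable_continuous_real continuous_intros slice[OF continuous_partials(1) v'] slice[OF continuous_partials(3) v']; simp add: X_nz[OF v'])+
  also have "\<dots> = A * len_at v" by (simp add: functionals_by_partials(1)[OF v'])
  also have "\<dots> = norm_at v / sqrt lam" using L by (simp add: A_def)
  finally show ?thesis by simp
qed

text \<open>The two terms of the variation are linear in \<open>h\<close>, of orders \<open>\<surd>E\<close> and \<open>E\<close>. Bounding both by \<open>1 + E\<close>
  gives a linear differential inequality for \<open>1 + E\<close>.\<close>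

lemma energy_at'_bound:
  assumes v: "v \<in> {0<..<1}"
  shows "\<bar>energy_at' v\<bar> \<le> norm_at v / sqrt lam * (2 / sqrt (len_at v ^ 3) + 3 / len_at v) * (1 + energy_at v)"
proof -
  have v': "v \<in> {0..1}" using v by simp
  note L = len_at_pos[OF v']
  note E = energy_at_nonneg[OF v']
  note cX = slice[OF continuous_partials(1) v'] and cZ = slice[OF continuous_partials(3) v'] and cK = slice[OF continuous_D2s_partials(1) v'] and cV = slice[OF continuous_D2s_partials(2) v']
  define A where "A = norm_at v / (sqrt lam * len_at v)"
  have A0: "A \<ge> 0" using field_bounds(2)[OF v'] L lam by (simp add: A_def)
  define P where "P = integral {0..2*pi} (\<lambda>u. norm (curv u v) * norm (vel2 u v) * norm (X u v))"
  have "norm (energy_at' v) \<le> integral {0..2*pi} (\<lambda>u. 2 * (norm (curv u v) * norm (vel2 u v) * norm (X u v)) + 3 * A * ((norm (curv u v))\<^sup>2 * norm (X u v)))"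
    unfolding energy_at'_def
  proof (rule integral_norm_bound_integral)
    fix u assume u: "u \<in> {0..2*pi}"
    let ?x = "norm (X u v)"
    have "\<bar>Z u v \<bullet> X u v\<bar> \<le> norm (Z u v) * ?x" by (rule Cauchy_Schwarz_ineq2)
    also have "\<dots> \<le> (A * ?x) * ?x"
      unfolding A_def by (intro mult_right_mono field_bounds(5)[OF v' u]) simp
    finally have "\<bar>Z u v \<bullet> X u v\<bar> * (inverse ?x)\<^sup>2 \<le> (A * ?x * ?x) * (inverse ?x)\<^sup>2"
      by (rule mult_right_mono) simp
    also have "\<dots> = A"
    proof -
      define n where "n = norm (X u v)"
      have "n \<noteq> 0" using X_nz[OF v', of u] by (simp add: n_def)
      then show ?thesis unfolding n_def[symmetric] by (simp add: power2_eq_square field_simps)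
    qed
    finally have a: "\<bar>(Z u v \<bullet> X u v) * (inverse ?x)\<^sup>2\<bar> \<le> A" by (simp add: abs_mult)
    have "\<bar>2 * (curv u v \<bullet> vel2 u v) * ?x\<bar> \<le> 2 * (norm (curv u v) * norm (vel2 u v) * ?x)"
      using mult_right_mono[OF Cauchy_Schwarz_ineq2[of "curv u v" "vel2 u v"], of ?x]
      by (simp add: abs_mult mult.assoc)
    moreover have "\<bar>3 * ((Z u v \<bullet> X u v) * (inverse ?x)\<^sup>2) * ((norm (curv u v))\<^sup>2 * ?x)\<bar> \<le> 3 * A * ((norm (curv u v))\<^sup>2 * ?x)"
      unfolding abs_mult[of _ "(norm (curv u v))\<^sup>2 * ?x"] abs_mult[of 3] using a by (simp add: mult_right_mono)
    ultimately show "norm (2 * (curv u v \<bullet> vel2 u v) * ?x - 3 * ((Z u v \<bullet> X u v) * (inverse ?x)\<^sup>2) * ((norm (curv u v))\<^sup>2 * ?x))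
      \<le> 2 * (norm (curv u v) * norm (vel2 u v) * ?x) + 3 * A * ((norm (curv u v))\<^sup>2 * ?x)"
      unfolding real_norm_def by linarith
  qed (intro integrable_continuous_real continuous_intros cX cZ cK cV; simp add: X_nz[OF v'])+
  also have "\<dots> = 2 * P + 3 * A * energy_at v"
  proof -
    have "(\<lambda>u. 2 * (norm (curv u v) * norm (vel2 u v) * norm (X u v))) integrable_on {0..2*pi}"
      "(\<lambda>u. 3 * A * ((norm (curv u v))\<^sup>2 * norm (X u v))) integrable_on {0..2*pi}"
      by (intro integrable_continuous_real continuous_intros cX cK cV)+
    from integral_add[OF this] show ?thesis by (simp add: P_def functionals_by_partials(2)[OF v'])
  qed
  also have "P \<le> sqrt (energy_at v) * sqrt (accel_at v)"
  proof -
    have "P = integral {0..2*pi} (\<lambda>u. (norm (curv u v) * sqrt (norm (X u v))) * (norm (vel2 u v) * sqrt (norm (X u v))))"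
      unfolding P_def
    proof (rule integral_cong)
      fix u
      have "norm (X u v) = sqrt (norm (X u v)) * sqrt (norm (X u v))" by simp
      then show "norm (curv u v) * norm (vel2 u v) * norm (X u v) = norm (curv u v) * sqrt (norm (X u v)) * (norm (vel2 u v) * sqrt (norm (X u v)))"
        by (metis mult.assoc mult.left_commute)
    qed
    also have "\<dots> \<le> sqrt (integral {0..2*pi} (\<lambda>u. (norm (curv u v) * sqrt (norm (X u v)))\<^sup>2))
         * sqrt (integral {0..2*pi} (\<lambda>u. (norm (vel2 u v) * sqrt (norm (X u v)))\<^sup>2))"
      by (intro Cauchy_Schwarz_le continuous_intros cX cK cV)
    also have "\<dots> = sqrt (energy_at v) * sqrt (accel_at v)"
      by (simp add: functionals_by_partials(2)[OF v'] accel_at_def power_mult_distrib)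
    finally show ?thesis .
  qed
  also have "sqrt (energy_at v) * sqrt (accel_at v) \<le> (1 + energy_at v) * (norm_at v / sqrt (lam * len_at v ^ 3))"
  proof (rule mult_mono)
    show "sqrt (energy_at v) \<le> 1 + energy_at v"
    proof (rule real_le_lsqrt)
      show "energy_at v \<le> (1 + energy_at v)\<^sup>2" using E by (simp add: power2_eq_square algebra_simps)
    qed (use E in simp)
  qed (use E field_bounds[OF v'] in simp_all)
  also have "3 * A * energy_at v \<le> 3 * A * (1 + energy_at v)" using A0 by (intro mult_left_mono) simp_all
  finally have "\<bar>energy_at' v\<bar> \<le> 2 * ((1 + energy_at v) * (norm_at v / sqrt (lam * len_at v ^ 3))) + 3 * A * (1 + energy_at v)" by simp
  also have "\<dots> = norm_at v / sqrt lam * (2 / sqrt (len_at v ^ 3) + 3 / len_at v) * (1 + energy_at v)"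
    by (simp add: A_def real_sqrt_mult algebra_simps)
  finally show ?thesis .
qed

definition "path_length = integral {0..1} norm_at"

lemma norm_at_integrable: "norm_at integrable_on {0..1}"
  by (intro integrable_continuous_real continuous_functionals)

lemma path_length_nonneg: "path_length \<ge> 0"
  unfolding path_length_def by (intro integral_nonneg norm_at_integrable field_bounds)

lemma length_change:
  assumes v: "v \<in> {0..1}"
  shows "\<bar>len_at v - len_at 0\<bar> \<le> path_length / sqrt lam"
proof -
  have sub: "{0..v} \<subseteq> {0..1}" using v by auto
  have c: "continuous_on {0..v} (\<lambda>v. norm_at v / sqrt lam)"
    using lam by (intro continuous_intros continuous_on_subset[OF continuous_functionals(3) sub]) simp
  have "\<bar>len_at v - len_at 0\<bar> \<le> integral {0..v} (\<lambda>v. norm_at v / sqrt lam)"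
    by (rule abs_diff_le_integral[OF _ continuous_on_subset[OF continuous_functionals(1) sub] c derivatives(1) len_at'_bound])
      (use v field_bounds(2) lam in auto)
  also have "\<dots> \<le> integral {0..1} (\<lambda>v. norm_at v / sqrt lam)"
    by (rule integral_subset_le[OF sub integrable_continuous_real[OF c]])
      (use norm_at_integrable field_bounds(2) lam in auto)
  finally show ?thesis by (simp add: path_length_def)
qed

text \<open>Integrated form of \<open>\<bar>E'\<bar> \<le> k N (1 + E)\<close>; the hypothesis on \<open>m\<close> keeps the length above \<open>m\<close> during the
  whole homotopy, by \<open>length_change\<close>.\<close>

lemma log_energy_change:
  assumes m: "m > 0" "m \<le> len_at 0 - path_length / sqrt lam"
  shows "\<bar>ln (1 + energy_at 1) - ln (1 + energy_at 0)\<bar> \<le> (2 / sqrt (m ^ 3) + 3 / m) / sqrt lam * path_length"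
proof -
  define R where "R = (2 / sqrt (m ^ 3) + 3 / m) / sqrt lam"
  have R: "R \<ge> 0" using m(1) lam by (simp add: R_def)
  have E1: "1 + energy_at v > 0" if "v \<in> {0..1}" for v using energy_at_nonneg[OF that] by simp
  have "\<bar>ln (1 + energy_at 1) - ln (1 + energy_at 0)\<bar> \<le> integral {0..1} (\<lambda>v. R * norm_at v)"
  proof (rule abs_diff_le_integral[where f="\<lambda>v. ln (1 + energy_at v)" and f'="\<lambda>v. energy_at' v / (1 + energy_at v)"])
    show "continuous_on {0..1} (\<lambda>v. ln (1 + energy_at v))"
      using E1 by (intro continuous_intros continuous_functionals(2)) force
    show "continuous_on {0..1} (\<lambda>v. R * norm_at v)" by (intro continuous_intros continuous_functionals(3))
    show "R * norm_at v \<ge> 0" if "v \<in> {0..1}" for v using R field_bounds(2)[OF that] by simp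
    fix v :: real assume v: "v \<in> {0<..<1}"
    then have v': "v \<in> {0..1}" by simp
    have "(energy_at has_real_derivative energy_at' v) (at v)"
      using derivatives(2)[OF v] by (simp add: has_real_derivative_iff_has_vector_derivative)
    then have "((\<lambda>v. ln (1 + energy_at v)) has_real_derivative energy_at' v / (1 + energy_at v)) (at v)"
      using E1[OF v'] by (auto intro!: derivative_eq_intros)
    then show "((\<lambda>v. ln (1 + energy_at v)) has_vector_derivative energy_at' v / (1 + energy_at v)) (at v)"
      by (simp add: has_real_derivative_iff_has_vector_derivative)
    have mL: "m \<le> len_at v" using length_change[OF v'] m(2) by linarith
    have "2 / sqrt (len_at v ^ 3) \<le> 2 / sqrt (m ^ 3)"
      using m(1) mL by (intro divide_left_mono real_sqrt_le_mono power_mono mult_pos_pos) simp_all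
    moreover have "3 / len_at v \<le> 3 / m" using m(1) mL by (intro divide_left_mono) simp_all
    ultimately have "2 / sqrt (len_at v ^ 3) + 3 / len_at v \<le> 2 / sqrt (m ^ 3) + 3 / m" by simp
    then have "norm_at v / sqrt lam * (2 / sqrt (len_at v ^ 3) + 3 / len_at v) \<le> norm_at v / sqrt lam * (2 / sqrt (m ^ 3) + 3 / m)"
      using field_bounds(2)[OF v'] lam by (intro mult_left_mono) simp_all
    also have "\<dots> = R * norm_at v" by (simp add: R_def)
    finally have "norm_at v / sqrt lam * (2 / sqrt (len_at v ^ 3) + 3 / len_at v) * (1 + energy_at v) \<le> R * norm_at v * (1 + energy_at v)"
      using E1[OF v'] by (intro mult_right_mono) simp_all
    with energy_at'_bound[OF v] have "\<bar>energy_at' v\<bar> \<le> R * norm_at v * (1 + energy_at v)" by linarith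
    then show "\<bar>energy_at' v / (1 + energy_at v)\<bar> \<le> R * norm_at v"
      using E1[OF v'] by (simp add: abs_div_pos[symmetric] pos_divide_le_eq)
  qed simp
  then show ?thesis by (simp add: path_length_def R_def)
qed

end

definition energy_rate :: "real \<Rightarrow> real \<Rightarrow> real" where
  "energy_rate lam m = (2 / sqrt (m ^ 3) + 3 / m) / sqrt lam"

lemma homotopy_estimates:
  assumes lam: "lam > 0" and c: "c0 \<in> immersed_curves" "c1 \<in> immersed_curves" and C: "C \<in> homotopies c0 c1"
  defines "l \<equiv> homotopy_length lam C"
  shows "l \<ge> 0" and "\<bar>len c1 - len c0\<bar> \<le> l / sqrt lam"
    and "\<lbrakk>m > 0; m \<le> len c0 - l / sqrt lam\<rbrakk> \<Longrightarrow> \<bar>ln (1 + energy c1) - ln (1 + energy c0)\<bar> \<le> energy_rate lam m * l"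
proof -
  interpret curve_homotopy C lam
    using lam C by unfold_locales (auto simp: homotopies_def)
  have l: "l = path_length" by (simp add: l_def homotopy_length_def path_length_def norm_at_def[abs_def])
  have 0: "(\<lambda>u. C (u, 0)) = c0" using C by (auto simp: homotopies_def)
  obtain \<phi> where \<phi>: "\<phi> \<in> diff_circle" "(\<lambda>u. C (u, 1)) = (\<lambda>u. c1 (\<phi> u))"
    using C by (auto simp: homotopies_def)
  have e: "len_at 0 = len c0" "energy_at 0 = energy c0" "len_at 1 = len c1" "energy_at 1 = energy c1"
    unfolding len_at_def energy_at_def 0 \<phi>(2) using len_reparam[OF c(2) \<phi>(1)] energy_reparam[OF c(2) \<phi>(1)] by simp_all
  show "l \<ge> 0" "\<bar>len c1 - len c0\<bar> \<le> l / sqrt lam"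
    using path_length_nonneg length_change[of 1] by (simp_all add: l e)
  show "\<bar>ln (1 + energy c1) - ln (1 + energy c0)\<bar> \<le> energy_rate lam m * l"
    if "m > 0" "m \<le> len c0 - l / sqrt lam"
    using log_energy_change[of m] that by (simp add: l e energy_rate_def)
qed

lemma energy_nonneg: "c \<in> immersed_curves \<Longrightarrow> energy c \<ge> 0"
  unfolding energy_def integral_ds_def
  using immersed_curvesD(1)[of c] smooth_speed[of c] less_imp_le[OF smooth_speed(2)[of c]]
  by (intro integral_nonneg integrable_continuous_real continuous_intros smooth_continuous smooth_Ds) simp_all

lemma H2_dist_lessE:
  assumes "lam > 0" "c0 \<in> immersed_curves" "c1 \<in> immersed_curves" "H2_dist lam c0 c1 < ennreal \<delta>"
  obtains C where "C \<in> homotopies c0 c1" "homotopy_length lam C < \<delta>"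
proof -
  obtain C where C: "C \<in> homotopies c0 c1" "ennreal (homotopy_length lam C) < ennreal \<delta>"
    using assms(4) unfolding H2_dist_def INF_less_iff by blast
  then show ?thesis
    using that[of C] homotopy_estimates(1)[OF assms(1-3) C(1)] by (simp add: ennreal_less_iff)
qed

lemma energy_rate_nonneg: "lam > 0 \<Longrightarrow> m > 0 \<Longrightarrow> energy_rate lam m \<ge> 0"
  by (simp add: energy_rate_def)

text \<open>Within distance \<open>\<surd>\<lambda> r\<close> lengths vary by at most \<open>r\<close>, so a ball of this radius around a curve of length at least
  \<open>2 r\<close> is reached through curves of length at least \<open>r\<close>.\<close>

lemma H2_ball_bounds:
  assumes lam: "lam > 0" and c: "c \<in> immersed_curves" "y \<in> immersed_curves"
    and d: "H2_dist lam c y < ennreal (sqrt lam * r)" and r: "r > 0" "len c \<ge> 2 * r"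
  shows "len y \<ge> len c - r" and "len y \<le> len c + r"
    and "1 + energy y \<le> (1 + energy c) * exp (energy_rate lam r * (sqrt lam * r))"
proof -
  obtain C where C: "C \<in> homotopies c y" "homotopy_length lam C < sqrt lam * r"
    by (rule H2_dist_lessE[OF lam c d])
  note H = homotopy_estimates[OF lam c C(1)]
  have l: "homotopy_length lam C / sqrt lam < r" using C(2) lam by (simp add: pos_divide_less_eq mult.commute)
  show "len y \<ge> len c - r" "len y \<le> len c + r" using H(2) l by linarith+
  have "ln (1 + energy y) \<le> ln (1 + energy c) + energy_rate lam r * homotopy_length lam C"
    using H(3)[OF r(1)] l r(2) by linarith
  also have "\<dots> \<le> ln (1 + energy c) + energy_rate lam r * (sqrt lam * r)"
    using C(2) energy_rate_nonneg[OF lam r(1)] by (intro add_left_mono mult_left_mono) simp_all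
  also have "\<dots> = ln ((1 + energy c) * exp (energy_rate lam r * (sqrt lam * r)))"
    using energy_nonneg[OF c(1)] by (simp add: ln_mult)
  finally show "1 + energy y \<le> (1 + energy c) * exp (energy_rate lam r * (sqrt lam * r))"
    using energy_nonneg[OF c(1)] energy_nonneg[OF c(2)] by (subst (asm) ln_le_cancel_iff) auto
qed

lemma abs_diff_le_ln_diff:
  fixes p q :: real
  assumes "0 < p" "0 < q" "p \<le> M" "q \<le> M"
  shows "\<bar>p - q\<bar> \<le> M * \<bar>ln p - ln q\<bar>"
proof -
  have *: "b - a \<le> M * (ln b - ln a)" if "0 < a" "a \<le> b" "b \<le> M" for a b
  proof -
    have "ln (a / b) \<le> a / b - 1" using that by (intro ln_le_minus_one) simp
    then have "(b - a) / b \<le> ln b - ln a" using that by (simp add: ln_div diff_divide_distrib)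
    then have "b - a \<le> b * (ln b - ln a)" using that by (simp add: pos_divide_le_eq mult.commute)
    also have "\<dots> \<le> M * (ln b - ln a)" using that by (intro mult_right_mono) simp_all
    finally show ?thesis .
  qed
  show ?thesis
  proof (cases "p \<le> q")
    case True
    then show ?thesis using *[of p q] assms by simp
  next
    case False
    then show ?thesis using *[of q p] assms by simp
  qed
qed

text \<open>Only homotopies from \<open>y\<close> to \<open>z\<close> that are short compared with the length of \<open>c\<close> stay in a region
  where the estimates are uniform. For the long ones, \<open>\<bar>E(y) - E(z)\<bar>\<close> is at most the bound for \<open>E\<close> on
  the ball, hence at most a multiple of the length of the homotopy. With \<open>r\<close> a quarter of \<open>len c\<close> and a ball of
  radius \<open>\<surd>\<lambda> r\<close>, lengths are at least \<open>3 r\<close> on the ball and at least \<open>2 r\<close> along the short homotopies.\<close>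

lemma energy_lipschitz_near:
  fixes c :: "real \<Rightarrow> 'a::euclidean_space"
  assumes lam: "lam > 0" and c: "c \<in> immersed_curves"
  defines "r \<equiv> len c / 4"
  shows "lipschitz_near (H2_dist lam) immersed_curves energy c
    (exp (energy_rate lam r * (sqrt lam * r)) * (energy_rate lam r + 1 / (sqrt lam * r)) * (1 + energy c))"
  unfolding lipschitz_near_def
proof (intro exI conjI ballI impI)
  have r: "r > 0" using smooth_speed(4)[OF c] by (simp add: r_def)
  define \<delta> where "\<delta> = sqrt lam * r"
  have \<delta>: "\<delta> > 0" using lam r by (simp add: \<delta>_def)
  then show "sqrt lam * r > 0" by (simp add: \<delta>_def)
  fix y z :: "real \<Rightarrow> 'a"
  assume yz: "y \<in> immersed_curves" "z \<in> immersed_curves"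
    and d: "H2_dist lam c y < ennreal (sqrt lam * r)" "H2_dist lam c z < ennreal (sqrt lam * r)"
  define M where "M = (1 + energy c) * exp (energy_rate lam r * \<delta>)"
  have lc: "len c \<ge> 2 * r" using r by (simp add: r_def)
  note By = H2_ball_bounds[OF lam c yz(1) d(1) r lc, folded \<delta>_def, folded M_def]
  note Bz = H2_ball_bounds[OF lam c yz(2) d(2) r lc, folded \<delta>_def, folded M_def]
  have E: "energy y \<ge> 0" "energy z \<ge> 0" using energy_nonneg yz by blast+
  have M0: "M > 0" using By(3) E by linarith
  have K0: "energy_rate lam r \<ge> 0" by (rule energy_rate_nonneg[OF lam r])
  define K where "K = M * (energy_rate lam r + 1 / \<delta>)"
  have K: "K > 0" using M0 K0 \<delta> by (simp add: K_def add_nonneg_pos)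
  have main: "\<bar>energy y - energy z\<bar> \<le> K * homotopy_length lam C" if C: "C \<in> homotopies y z" for C
  proof -
    note H = homotopy_estimates[OF lam yz C]
    define l where "l = homotopy_length lam C"
    show ?thesis
    proof (cases "l \<le> \<delta>")
      case True
      then have "l / sqrt lam \<le> r" using lam by (simp add: \<delta>_def pos_divide_le_eq mult.commute)
      moreover have "len c = 4 * r" by (simp add: r_def)
      ultimately have "r \<le> len y - l / sqrt lam" using By(1) r by linarith
      from H(3)[OF r this[unfolded l_def]]
      have "\<bar>ln (1 + energy z) - ln (1 + energy y)\<bar> \<le> energy_rate lam r * l" unfolding l_def .
      then have "M * \<bar>ln (1 + energy y) - ln (1 + energy z)\<bar> \<le> M * (energy_rate lam r * l)"
        using M0 by (intro mult_left_mono) (simp_all add: abs_minus_commute)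
      moreover have "\<bar>(1 + energy y) - (1 + energy z)\<bar> \<le> M * \<bar>ln (1 + energy y) - ln (1 + energy z)\<bar>"
        using E By(3) Bz(3) by (intro abs_diff_le_ln_diff) simp_all
      moreover have "M * (energy_rate lam r * l) \<le> K * l"
        using M0 \<delta> H(1) by (simp add: K_def l_def algebra_simps)
      ultimately show ?thesis by (simp add: l_def)
    next
      case False
      have "\<bar>energy y - energy z\<bar> \<le> M" using E By(3) Bz(3) by linarith
      also have "M \<le> M * (l / \<delta>)" using False M0 \<delta> by (simp add: le_divide_eq)
      also have "\<dots> \<le> K * l"
        using M0 K0 H(1) by (simp add: K_def l_def algebra_simps)
      finally show ?thesis by (simp add: l_def)
    qed
  qed
  have "ennreal (\<bar>energy y - energy z\<bar> / K) \<le> H2_dist lam y z"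
    unfolding H2_dist_def
  proof (rule INF_greatest)
    fix C assume C: "C \<in> homotopies y z"
    have "\<bar>energy y - energy z\<bar> / K \<le> homotopy_length lam C"
      using main[OF C] K by (simp add: pos_divide_le_eq mult.commute)
    then show "ennreal (\<bar>energy y - energy z\<bar> / K) \<le> ennreal (homotopy_length lam C)"
      by (rule ennreal_leI)
  qed
  then have "ennreal K * ennreal (\<bar>energy y - energy z\<bar> / K) \<le> ennreal K * H2_dist lam y z"
    by (rule mult_left_mono) simp
  moreover have "ennreal K * ennreal (\<bar>energy y - energy z\<bar> / K) = ennreal \<bar>energy y - energy z\<bar>"
    using K by (simp add: ennreal_mult[symmetric])
  ultimately show "ennreal \<bar>energy y - energy z\<bar>
      \<le> ennreal (exp (energy_rate lam r * (sqrt lam * r)) * (energy_rate lam r + 1 / (sqrt lam * r)) * (1 + energy c)) * H2_dist lam y z"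
    by (simp add: K_def M_def \<delta>_def mult_ac)
qed

section \<open>Weak second derivatives from approximations of bounded bending\<close>

text \<open>For curves of unit speed this is the energy; unlike the energy it is a quadratic form in the
  parametrization and obeys the parallelogram law.\<close>

definition bending :: "real \<Rightarrow> (real \<Rightarrow> 'a::euclidean_space) \<Rightarrow> real" where
  "bending p \<eta> = integral {0..p} (\<lambda>t. (norm (vd (vd \<eta>) t))\<^sup>2)"

definition smooth_loops :: "real \<Rightarrow> (real \<Rightarrow> 'a::euclidean_space) set" where
  "smooth_loops p = {\<eta>. smooth \<eta> \<and> periodic p \<eta>}"

lemma bending_nonneg: "smooth \<eta> \<Longrightarrow> bending p \<eta> \<ge> 0"
  unfolding bending_def
  by (intro integral_nonneg integrable_continuous_real continuous_intros smooth_continuous smooth_vd) simp_all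

lemma vd2_combination:
  assumes "smooth f" "smooth g"
  shows "vd (vd (\<lambda>t. a *\<^sub>R f t + b *\<^sub>R g t)) t = a *\<^sub>R vd (vd f) t + b *\<^sub>R vd (vd g) t"
proof -
  have *: "vd (\<lambda>t. a *\<^sub>R f t + b *\<^sub>R g t) t = a *\<^sub>R vd f t + b *\<^sub>R vd g t"
    if "smooth f" "smooth g" for f g :: "real \<Rightarrow> 'a" and t
    using smooth_has_vd[OF that(1)] smooth_has_vd[OF that(2)]
    by (intro vector_derivative_at) (auto intro!: derivative_eq_intros)
  show ?thesis unfolding *[OF assms] *[OF smooth_vd[OF assms(1)] smooth_vd[OF assms(2)]] ..
qed

lemma bending_parallelogram:
  assumes f: "smooth f" and g: "smooth g"
  shows "bending p (\<lambda>t. f t - g t) = 2 * bending p f + 2 * bending p g - 4 * bending p (\<lambda>t. (1/2) *\<^sub>R f t + (1/2) *\<^sub>R g t)"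
proof -
  let ?F = "vd (vd f)" and ?G = "vd (vd g)"
  have c: "continuous_on {0..p} ?F" "continuous_on {0..p} ?G"
    by (intro smooth_continuous smooth_vd f g)+
  have d: "vd (vd (\<lambda>t. f t - g t)) t = ?F t - ?G t" for t
    using vd2_combination[OF f g, of 1 "-1" t] by simp
  have "(norm (?F t - ?G t))\<^sup>2 = 2 * (norm (?F t))\<^sup>2 + 2 * (norm (?G t))\<^sup>2 - 4 * (norm ((1/2) *\<^sub>R ?F t + (1/2) *\<^sub>R ?G t))\<^sup>2" for t
    by (simp add: power2_norm_eq_inner inner_add_left inner_add_right inner_diff_left inner_diff_right inner_commute)
  then have "bending p (\<lambda>t. f t - g t)
    = integral {0..p} (\<lambda>t. 2 * (norm (?F t))\<^sup>2 + 2 * (norm (?G t))\<^sup>2 - 4 * (norm ((1/2) *\<^sub>R ?F t + (1/2) *\<^sub>R ?G t))\<^sup>2)"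
    unfolding bending_def d by simp
  also have "\<dots> = integral {0..p} (\<lambda>t. 2 * (norm (?F t))\<^sup>2) + integral {0..p} (\<lambda>t. 2 * (norm (?G t))\<^sup>2)
     - integral {0..p} (\<lambda>t. 4 * (norm ((1/2) *\<^sub>R ?F t + (1/2) *\<^sub>R ?G t))\<^sup>2)"
  proof -
    have i: "(\<lambda>t. 2 * (norm (?F t))\<^sup>2) integrable_on {0..p}" "(\<lambda>t. 2 * (norm (?G t))\<^sup>2) integrable_on {0..p}"
      "(\<lambda>t. 4 * (norm ((1/2) *\<^sub>R ?F t + (1/2) *\<^sub>R ?G t))\<^sup>2) integrable_on {0..p}"
      by (intro integrable_continuous_real continuous_intros c)+
    show ?thesis using integral_diff[OF integrable_add[OF i(1,2)] i(3)] integral_add[OF i(1,2)] by simp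
  qed
  finally show ?thesis unfolding bending_def vd2_combination[OF f g] by simp
qed

text \<open>A hands-on form of the weak compactness of bounded sets in \<open>L\<^sup>2\<close>, with strong convergence of suitable
  approximations. Let \<open>\<eta>\<^sub>j\<close> nearly minimize the bending among the loops at distance at most \<open>1 / (j + 1)\<close> from \<open>g\<close>. The
  midpoint of two of them competes with the one of lower index, and the infima increase to a finite limit, so the
  parallelogram law forces the bending of the differences to tend to zero.\<close>

lemma minimizing_loops:
  fixes g :: "real \<Rightarrow> 'a::euclidean_space"
  assumes approx: "\<And>\<epsilon>. \<epsilon> > 0 \<Longrightarrow> \<exists>\<eta>\<in>smooth_loops p. (\<forall>t. norm (\<eta> t - g t) \<le> \<epsilon>) \<and> bending p \<eta> \<le> B"
  shows "\<exists>\<eta>. (\<forall>j. \<eta> j \<in> smooth_loops p) \<and> (\<forall>j t. norm (\<eta> j t - g t) \<le> inverse (real (Suc j)))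
    \<and> (\<forall>j. bending p (\<eta> j) \<le> B + 1)
    \<and> (\<forall>\<epsilon>>0. \<exists>N. \<forall>i\<ge>N. \<forall>j\<ge>N. bending p (\<lambda>t. \<eta> i t - \<eta> j t) < \<epsilon>)"
proof -
  define e where "e j = inverse (real (Suc j))" for j
  have e: "e j > 0" "e j \<le> 1" for j by (simp_all add: e_def inverse_le_1_iff)
  have emono: "e j \<le> e i" if "i \<le> j" for i j using that unfolding e_def by (simp add: le_imp_inverse_le)
  define A where "A j = {\<eta> \<in> smooth_loops p. \<forall>t. norm (\<eta> t - g t) \<le> e j}" for j
  define m where "m j = Inf (bending p ` A j)" for j
  have bdd: "bdd_below (bending p ` A j)" for j
    by (rule bdd_belowI[of _ 0]) (auto simp: A_def smooth_loops_def bending_nonneg)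
  have ex: "\<exists>\<eta>\<in>A j. bending p \<eta> \<le> B" for j
    using approx[OF e(1)[of j]] by (auto simp: A_def)
  have mB: "m j \<le> B" for j
    using ex[of j] cInf_lower2[OF _ _ bdd] unfolding m_def by (metis imageI)
  have lower: "m j \<le> bending p \<eta>" if "\<eta> \<in> A j" for \<eta> j
    unfolding m_def by (rule cInf_lower[OF _ bdd]) (use that in auto)
  have sub: "A j \<subseteq> A i" if "i \<le> j" for i j
    using emono[OF that] unfolding A_def by (auto intro: order_trans)
  have mono: "m i \<le> m j" if "i \<le> j" for i j
    unfolding m_def by (rule cInf_superset_mono) (use ex[of j] bdd sub[OF that] in auto)
  have "\<exists>\<eta>\<in>A j. bending p \<eta> < m j + e j" for j
    using cInf_lessD[of "bending p ` A j" "m j + e j"] ex[of j] e(1)[of j] unfolding m_def by auto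
  then obtain \<eta> where \<eta>: "\<And>j. \<eta> j \<in> A j" "\<And>j. bending p (\<eta> j) < m j + e j" by metis
  have sm: "smooth (\<eta> j)" for j using \<eta>(1)[of j] by (auto simp: A_def smooth_loops_def)
  have key: "bending p (\<lambda>t. \<eta> i t - \<eta> j t) \<le> 2 * (m j - m i) + 2 * e i + 2 * e j" if "i \<le> j" for i j
  proof -
    have "(\<lambda>t. (1/2) *\<^sub>R \<eta> i t + (1/2) *\<^sub>R \<eta> j t) \<in> A i"
    proof -
      have "norm ((1/2) *\<^sub>R \<eta> i t + (1/2) *\<^sub>R \<eta> j t - g t) \<le> e i" for t
      proof -
        have "(1/2) *\<^sub>R \<eta> i t + (1/2) *\<^sub>R \<eta> j t - g t = (1/2) *\<^sub>R (\<eta> i t - g t) + (1/2) *\<^sub>R (\<eta> j t - g t)"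
          using scaleR_left_distrib[of "1/2" "1/2" "g t"] by (simp add: algebra_simps)
        also have "norm \<dots> \<le> (1/2) * norm (\<eta> i t - g t) + (1/2) * norm (\<eta> j t - g t)"
          by (rule norm_triangle_le) simp
        also have "\<dots> \<le> e i" using \<eta>(1)[of i] subsetD[OF sub[OF that] \<eta>(1)[of j]] unfolding A_def by (auto dest!: spec[of _ t])
        finally show ?thesis .
      qed
      moreover have "smooth (\<lambda>t. (1/2) *\<^sub>R \<eta> i t + (1/2) *\<^sub>R \<eta> j t)"
        by (intro smooth_add smooth_scaleR smooth_const sm)
      moreover have "periodic p (\<lambda>t. (1/2) *\<^sub>R \<eta> i t + (1/2) *\<^sub>R \<eta> j t)"
        using \<eta>(1)[of i] \<eta>(1)[of j] by (simp add: A_def smooth_loops_def periodic_def)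
      ultimately show ?thesis unfolding A_def smooth_loops_def by simp
    qed
    then have 1: "m i \<le> bending p (\<lambda>t. (1/2) *\<^sub>R \<eta> i t + (1/2) *\<^sub>R \<eta> j t)" by (rule lower)
    have "bending p (\<lambda>t. \<eta> i t - \<eta> j t)
      \<le> 2 * (m i + e i) + 2 * (m j + e j) - 4 * bending p (\<lambda>t. (1/2) *\<^sub>R \<eta> i t + (1/2) *\<^sub>R \<eta> j t)"
      unfolding bending_parallelogram[OF sm sm]
      by (intro diff_right_mono add_mono mult_left_mono less_imp_le[OF \<eta>(2)]) simp_all
    also have "\<dots> \<le> 2 * (m i + e i) + 2 * (m j + e j) - 4 * m i"
      using 1 by (intro diff_left_mono mult_left_mono) simp_all
    finally show ?thesis by (simp add: algebra_simps)
  qed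
  obtain M where M: "m \<longlonglongrightarrow> M"
    using incseq_convergent[of m B] mono mB unfolding incseq_def by metis
  have e0: "e \<longlonglongrightarrow> 0" unfolding e_def by (rule LIMSEQ_inverse_real_of_nat)
  show ?thesis
  proof (intro exI[of _ \<eta>] conjI allI impI)
    show "\<eta> j \<in> smooth_loops p" "norm (\<eta> j t - g t) \<le> inverse (real (Suc j))" for j t
      using \<eta>(1)[of j] by (auto simp: A_def e_def)
    show "bending p (\<eta> j) \<le> B + 1" for j using \<eta>(2)[of j] mB[of j] e(2)[of j] by linarith
    fix \<epsilon> :: real assume \<epsilon>: "\<epsilon> > 0"
    obtain N1 where N1: "\<And>j. j \<ge> N1 \<Longrightarrow> dist (m j) M < \<epsilon> / 16" using M \<epsilon> unfolding lim_sequentially by (metis divide_pos_pos zero_less_numeral)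
    obtain N2 where N2: "\<And>j. j \<ge> N2 \<Longrightarrow> dist (e j) 0 < \<epsilon> / 16" using e0 \<epsilon> unfolding lim_sequentially by (metis divide_pos_pos zero_less_numeral)
    have *: "bending p (\<lambda>t. \<eta> i t - \<eta> j t) < \<epsilon>" if "i \<ge> max N1 N2" "j \<ge> max N1 N2" "i \<le> j" for i j
    proof -
      have "\<bar>m i - M\<bar> < \<epsilon> / 16" "\<bar>m j - M\<bar> < \<epsilon> / 16" "e i < \<epsilon> / 16" "e j < \<epsilon> / 16"
        using N1[of i] N1[of j] N2[of i] N2[of j] that e(1)[of i] e(1)[of j] by (simp_all add: dist_real_def)
      then have "m j - m i < \<epsilon> / 8" unfolding abs_less_iff by linarith
      moreover have "2 * a + 2 * b + 2 * c < \<epsilon>" if "a < \<epsilon> / 8" "b < \<epsilon> / 16" "c < \<epsilon> / 16" for a b c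
        using that \<epsilon> by linarith
      ultimately have "2 * (m j - m i) + 2 * e i + 2 * e j < \<epsilon>"
        using \<open>e i < \<epsilon> / 16\<close> \<open>e j < \<epsilon> / 16\<close> by blast
      then show ?thesis by (rule le_less_trans[OF key[OF that(3)]])
    qed
    have sym: "bending p (\<lambda>t. \<eta> i t - \<eta> j t) = bending p (\<lambda>t. \<eta> j t - \<eta> i t)" for i j
      unfolding bending_parallelogram[OF sm sm] by (simp add: add.commute)
    have "bending p (\<lambda>t. \<eta> i t - \<eta> j t) < \<epsilon>" if "i \<ge> max N1 N2" "j \<ge> max N1 N2" for i j
      using *[of i j] *[of j i] sym[of i j] that by (cases "i \<le> j") simp_all
    then show "\<exists>N. \<forall>i\<ge>N. \<forall>j\<ge>N. bending p (\<lambda>t. \<eta> i t - \<eta> j t) < \<epsilon>" by blast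
  qed
qed

text \<open>The argument of Riesz and Fischer. Increments of the subsequence have \<open>L\<^sup>2\<close> norms below \<open>2\<^sup>-\<^sup>n\<close>,
  hence summable \<open>L\<^sup>1\<close> norms on the bounded interval, so they sum absolutely almost everywhere. The sum
  of their norms is the dominating function \<open>W\<close>.\<close>

lemma L2_Cauchy_subsequence:
  fixes f :: "nat \<Rightarrow> real \<Rightarrow> 'a::euclidean_space"
  assumes p: "p \<ge> 0" and cont: "\<And>j. continuous_on {0..p} (f j)"
    and Cauchy: "\<And>\<epsilon>. \<epsilon> > 0 \<Longrightarrow> \<exists>N. \<forall>i\<ge>N. \<forall>j\<ge>N. integral {0..p} (\<lambda>t. (norm (f i t - f j t))\<^sup>2) < \<epsilon>"
  obtains r k W where "strict_mono (r :: nat \<Rightarrow> nat)" "integrable (lebesgue_on {0..p}) k" "integrable (lebesgue_on {0..p}) (W :: real \<Rightarrow> real)"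
    "AE t in lebesgue_on {0..p}. (\<lambda>n. f (r n) t) \<longlonglongrightarrow> k t"
    "AE t in lebesgue_on {0..p}. \<forall>n. norm (f (r n) t) \<le> W t"
proof -
  let ?M = "lebesgue_on {0..p}"
  obtain N where N: "\<And>n i j. i \<ge> N n \<Longrightarrow> j \<ge> N n \<Longrightarrow> integral {0..p} (\<lambda>t. (norm (f i t - f j t))\<^sup>2) < (1/4) ^ n"
  proof -
    have "\<exists>N. \<forall>i\<ge>N. \<forall>j\<ge>N. integral {0..p} (\<lambda>t. (norm (f i t - f j t))\<^sup>2) < (1/4) ^ n" for n
      by (rule Cauchy) simp
    then have "\<exists>N. \<forall>n. \<forall>i\<ge>N n. \<forall>j\<ge>N n. integral {0..p} (\<lambda>t. (norm (f i t - f j t))\<^sup>2) < (1/4) ^ n"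
      by (intro choice allI)
    then show ?thesis using that by blast
  qed
  define r where "r = rec_nat (N 0) (\<lambda>n x. max (Suc x) (N (Suc n)))"
  have r_Suc: "r (Suc n) = max (Suc (r n)) (N (Suc n))" for n by (simp add: r_def)
  have rmono: "strict_mono r" by (rule strict_monoI_Suc) (simp add: r_Suc)
  have rN: "r n \<ge> N n" for n by (cases n) (simp_all add: r_def)
  define d where "d n t = f (r (Suc n)) t - f (r n) t" for n t
  have cd: "continuous_on {0..p} (d n)" for n unfolding d_def[abs_def] by (intro continuous_intros cont)
  have int: "integrable ?M h" if "continuous_on {0..p} h" for h :: "real \<Rightarrow> 'b::euclidean_space"
    by (rule absolutely_integrable_imp_integrable[OF absolutely_integrable_continuous_real[OF that]]) simp
  have dn: "(\<integral>t. norm (d n t) \<partial>?M) \<le> sqrt p * (1/2) ^ n" for n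
  proof -
    have "(\<integral>t. norm (d n t) \<partial>?M) = integral {0..p} (\<lambda>t. 1 * norm (d n t))"
      using lebesgue_integral_eq_integral[OF int[of "\<lambda>t. norm (d n t)"]] by (simp add: continuous_intros cd)
    also have "\<dots> \<le> sqrt (integral {0..p} (\<lambda>t. 1\<^sup>2)) * sqrt (integral {0..p} (\<lambda>t. (norm (d n t))\<^sup>2))"
      by (intro Cauchy_Schwarz_le continuous_intros cd)
    also have "\<dots> \<le> sqrt p * sqrt ((1/4) ^ n)"
    proof (intro mult_mono real_sqrt_le_mono)
      have "r (Suc n) \<ge> N n" using rN[of n] by (simp add: r_Suc le_max_iff_disj)
      from N[OF this rN[of n]] show "integral {0..p} (\<lambda>t. (norm (d n t))\<^sup>2) \<le> (1/4) ^ n"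
        by (simp add: d_def)
      show "sqrt (integral {0..p} (\<lambda>t. (norm (d n t))\<^sup>2)) \<ge> 0"
        by (intro real_sqrt_ge_zero integral_nonneg integrable_continuous_real continuous_intros cd) simp
    qed (use p in simp_all)
    also have "sqrt ((1/4) ^ n) = (1/2) ^ n"
      by (simp add: real_sqrt_power real_sqrt_divide)
    finally show ?thesis .
  qed
  have sums: "summable (\<lambda>n. \<integral>t. norm (d n t) \<partial>?M)"
    by (rule summable_comparison_test'[of "\<lambda>n. sqrt p * (1/2) ^ n" 0])
      (use dn in \<open>auto intro!: summable_mult summable_geometric integral_nonneg_AE\<close>)
  have AEs: "AE t in ?M. summable (\<lambda>n. norm (d n t))"
  proof -
    have meas: "(\<lambda>t. ennreal (norm (d n t))) \<in> borel_measurable ?M" for n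
      using borel_measurable_integrable[OF int[OF cd[of n]]] by measurable
    have "(\<integral>\<^sup>+t. (\<Sum>n. ennreal (norm (d n t))) \<partial>?M) = (\<Sum>n. \<integral>\<^sup>+t. ennreal (norm (d n t)) \<partial>?M)"
      by (rule nn_integral_suminf[OF meas])
    also have "\<dots> = (\<Sum>n. ennreal (\<integral>t. norm (d n t) \<partial>?M))"
      by (intro suminf_cong nn_integral_eq_integral) (use int[OF cd] in auto)
    also have "\<dots> = ennreal (\<Sum>n. \<integral>t. norm (d n t) \<partial>?M)"
      by (rule suminf_ennreal2[OF _ sums]) (simp add: integral_nonneg_AE)
    also have "\<dots> \<noteq> \<infinity>" by simp
    finally have "AE t in ?M. (\<Sum>n. ennreal (norm (d n t))) \<noteq> \<infinity>"
      by (intro nn_integral_PInf_AE borel_measurable_suminf_order meas) auto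
    then show ?thesis
      by (rule AE_mp) (auto intro!: AE_I2 summable_suminf_not_top simp: infinity_ennreal_def)
  qed
  define k where "k t = f (r 0) t + (\<Sum>n. d n t)" for t
  define W where "W t = norm (f (r 0) t) + (\<Sum>n. norm (d n t))" for t
  have fr: "f (r n) t = f (r 0) t + (\<Sum>i<n. d i t)" for n t
    by (induction n) (simp_all add: d_def)
  show ?thesis
  proof (rule that[OF rmono])
    show "integrable ?M k" unfolding k_def[abs_def]
      by (intro Bochner_Integration.integrable_add int cont integrable_suminf cd AEs sums)
    show "integrable ?M W" unfolding W_def[abs_def]
      using AEs sums by (intro Bochner_Integration.integrable_add integrable_norm int cont integrable_suminf cd) auto
    show "AE t in ?M. (\<lambda>n. f (r n) t) \<longlonglongrightarrow> k t"
      using AEs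
    proof (rule AE_mp, intro AE_I2 impI)
      fix t assume s: "summable (\<lambda>n. norm (d n t))"
      have "(\<lambda>n. \<Sum>i<n. d i t) \<longlonglongrightarrow> (\<Sum>n. d n t)"
        by (rule summable_LIMSEQ[OF summable_norm_cancel[OF s]])
      from tendsto_add[OF tendsto_const[of "f (r 0) t"] this]
      show "(\<lambda>n. f (r n) t) \<longlonglongrightarrow> k t"
        by (simp only: fr[symmetric] k_def)
    qed
    show "AE t in ?M. \<forall>n. norm (f (r n) t) \<le> W t"
      using AEs
    proof (rule AE_mp, intro AE_I2 impI allI)
      fix t n assume s: "summable (\<lambda>n. norm (d n t))"
      have "norm (f (r n) t) \<le> norm (f (r 0) t) + (\<Sum>i<n. norm (d i t))"
        by (subst fr) (intro norm_triangle_le add_left_mono norm_sum)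
      also have "\<dots> \<le> W t"
        unfolding W_def using sum_le_suminf[OF s, of "{..<n}"] by simp
      finally show "norm (f (r n) t) \<le> W t" .
    qed
  qed
qed

lemma integral_by_parts_twice:
  fixes \<psi> :: "real \<Rightarrow> real" and \<eta> :: "real \<Rightarrow> 'a::euclidean_space"
  assumes \<psi>: "smooth \<psi>" "periodic p \<psi>" and \<eta>: "smooth \<eta>" "periodic p \<eta>" and p: "p \<ge> 0"
  shows "integral {0..p} (\<lambda>t. \<psi> t *\<^sub>R vd (vd \<eta>) t) = integral {0..p} (\<lambda>t. vd (vd \<psi>) t *\<^sub>R \<eta> t)"
proof -
  have d: "((\<lambda>t. \<psi> t *\<^sub>R vd \<eta> t - vd \<psi> t *\<^sub>R \<eta> t) has_vector_derivative
      \<psi> t *\<^sub>R vd (vd \<eta>) t - vd (vd \<psi>) t *\<^sub>R \<eta> t) (at t)" for t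
  proof -
    have "((\<lambda>t. \<psi> t *\<^sub>R vd \<eta> t) has_vector_derivative \<psi> t *\<^sub>R vd (vd \<eta>) t + vd \<psi> t *\<^sub>R vd \<eta> t) (at t)"
      "((\<lambda>t. vd \<psi> t *\<^sub>R \<eta> t) has_vector_derivative vd \<psi> t *\<^sub>R vd \<eta> t + vd (vd \<psi>) t *\<^sub>R \<eta> t) (at t)"
      by (intro bounded_bilinear.has_vector_derivative[OF bounded_bilinear_scaleR] smooth_has_vd smooth_vd \<psi> \<eta>)+
    from has_vector_derivative_diff[OF this] show ?thesis by simp
  qed
  have per: "f p = f 0" if "periodic p f" for f :: "real \<Rightarrow> 'b"
    using that unfolding periodic_def by (metis add_0)
  have "integral {0..p} (\<lambda>t. \<psi> t *\<^sub>R vd (vd \<eta>) t - vd (vd \<psi>) t *\<^sub>R \<eta> t) = 0"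
    unfolding integral_antiderivative[OF d p] per[OF \<psi>(2)] per[OF \<eta>(2)]
      per[OF vd_periodic[OF \<psi>]] per[OF vd_periodic[OF \<eta>]] by simp
  moreover have "integral {0..p} (\<lambda>t. \<psi> t *\<^sub>R vd (vd \<eta>) t - vd (vd \<psi>) t *\<^sub>R \<eta> t)
     = integral {0..p} (\<lambda>t. \<psi> t *\<^sub>R vd (vd \<eta>) t) - integral {0..p} (\<lambda>t. vd (vd \<psi>) t *\<^sub>R \<eta> t)"
    by (intro integral_diff integrable_continuous_real continuous_intros smooth_continuous smooth_vd \<psi> \<eta>)
  ultimately show ?thesis by simp
qed

text \<open>The second derivatives of the loops from \<open>minimizing_loops\<close> converge in \<open>L\<^sup>2\<close>. The limit is the
  weak second derivative of \<open>g\<close> by integration by parts for the loops, and Fatou's lemma bounds its square integral.\<close>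

lemma weak_second_derivative_exists:
  fixes g :: "real \<Rightarrow> 'a::euclidean_space"
  assumes p: "p > 0" and g: "continuous_on UNIV g"
    and approx: "\<And>\<epsilon>. \<epsilon> > 0 \<Longrightarrow> \<exists>\<eta>\<in>smooth_loops p. (\<forall>t. norm (\<eta> t - g t) \<le> \<epsilon>) \<and> bending p \<eta> \<le> B"
  obtains \<kappa> where "weak_second_derivative p g \<kappa>"
    "(\<integral>\<^sup>+ s\<in>{0..p}. ennreal ((norm (\<kappa> s))\<^sup>2) \<partial>lebesgue) < \<infinity>"
proof -
  let ?M = "lebesgue_on {0..p}"
  obtain \<eta> where \<eta>: "\<And>j. \<eta> j \<in> smooth_loops p" "\<And>j t. norm (\<eta> j t - g t) \<le> inverse (real (Suc j))"
    "\<And>j. bending p (\<eta> j) \<le> B + 1"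
    "\<And>\<epsilon>. \<epsilon> > 0 \<Longrightarrow> \<exists>N. \<forall>i\<ge>N. \<forall>j\<ge>N. bending p (\<lambda>t. \<eta> i t - \<eta> j t) < \<epsilon>"
    using minimizing_loops[OF approx] by blast
  have sm: "smooth (\<eta> j)" "periodic p (\<eta> j)" for j using \<eta>(1)[of j] by (auto simp: smooth_loops_def)
  have c: "continuous_on A (vd (vd (\<eta> j)))" for A j by (intro smooth_continuous smooth_vd sm)
  have vd2: "vd (vd (\<lambda>t. \<eta> i t - \<eta> j t)) t = vd (vd (\<eta> i)) t - vd (vd (\<eta> j)) t" for i j t
    using vd2_combination[OF sm(1) sm(1), of 1 i "-1" j t] by simp
  obtain r k W where r: "strict_mono (r :: nat \<Rightarrow> nat)" and k: "integrable ?M k" and W: "integrable ?M (W :: real \<Rightarrow> real)"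
    and lim: "AE t in ?M. (\<lambda>n. vd (vd (\<eta> (r n))) t) \<longlonglongrightarrow> k t"
    and dom: "AE t in ?M. \<forall>n. norm (vd (vd (\<eta> (r n))) t) \<le> W t"
  proof (rule L2_Cauchy_subsequence[of p "\<lambda>j. vd (vd (\<eta> j))"])
    show "\<exists>N. \<forall>i\<ge>N. \<forall>j\<ge>N. integral {0..p} (\<lambda>t. (norm (vd (vd (\<eta> i)) t - vd (vd (\<eta> j)) t))\<^sup>2) < \<epsilon>" if "\<epsilon> > 0" for \<epsilon>
      using \<eta>(4)[OF that] unfolding bending_def vd2 .
  qed (use p c in auto)
  have int: "integrable ?M h" if "continuous_on {0..p} h" for h :: "real \<Rightarrow> 'b::euclidean_space"
    by (rule absolutely_integrable_imp_integrable[OF absolutely_integrable_continuous_real[OF that]]) simp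
  have meas: "h \<in> borel_measurable ?M" if "continuous_on {0..p} h" for h :: "real \<Rightarrow> 'b::euclidean_space"
    by (rule borel_measurable_integrable[OF int[OF that]])
  have weak: "integral {0..p} (\<lambda>s. vd (vd \<psi>) s *\<^sub>R g s) = integral {0..p} (\<lambda>s. \<psi> s *\<^sub>R k s)"
    if \<psi>: "smooth \<psi>" "periodic p \<psi>" for \<psi> :: "real \<Rightarrow> real"
  proof -
    have c\<psi>: "continuous_on {0..p} \<psi>" by (rule smooth_continuous[OF \<psi>(1)])
    obtain K where "\<forall>t\<in>{0..p}. norm (\<psi> t) \<le> K"
      using compact_imp_bounded[OF compact_continuous_image[OF c\<psi>]] unfolding bounded_iff by auto
    then have K: "\<And>t. t \<in> {0..p} \<Longrightarrow> norm (\<psi> t) \<le> K" by blast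
    have i\<psi>k: "integrable ?M (\<lambda>t. \<psi> t *\<^sub>R k t)"
    proof (rule Bochner_Integration.integrable_bound)
      show "integrable ?M (\<lambda>t. K * norm (k t))" using k by simp
      show "(\<lambda>t. \<psi> t *\<^sub>R k t) \<in> borel_measurable ?M"
        by (intro borel_measurable_scaleR meas c\<psi> borel_measurable_integrable k)
      show "AE t in ?M. norm (\<psi> t *\<^sub>R k t) \<le> norm (K * norm (k t))"
      proof (rule AE_I2)
        fix t assume "t \<in> space ?M"
        then have "\<bar>\<psi> t\<bar> \<le> K" "0 \<le> K" using K[of t] by auto
        then show "norm (\<psi> t *\<^sub>R k t) \<le> norm (K * norm (k t))" by (simp add: abs_mult mult_right_mono)
      qed
    qed
    have L1: "(\<lambda>n. integral\<^sup>L ?M (\<lambda>t. \<psi> t *\<^sub>R vd (vd (\<eta> (r n))) t)) \<longlonglongrightarrow> integral\<^sup>L ?M (\<lambda>t. \<psi> t *\<^sub>R k t)"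
    proof (rule integral_dominated_convergence)
      show "(\<lambda>t. \<psi> t *\<^sub>R k t) \<in> borel_measurable ?M" using i\<psi>k by simp
      show "(\<lambda>t. \<psi> t *\<^sub>R vd (vd (\<eta> (r n))) t) \<in> borel_measurable ?M" for n
        by (intro meas continuous_intros c\<psi> c)
      show "integrable ?M (\<lambda>t. K * W t)" using W by simp
      show "AE t in ?M. (\<lambda>n. \<psi> t *\<^sub>R vd (vd (\<eta> (r n))) t) \<longlonglongrightarrow> \<psi> t *\<^sub>R k t"
        using lim by (rule AE_mp) (auto intro!: AE_I2 tendsto_intros)
      show "AE t in ?M. norm (\<psi> t *\<^sub>R vd (vd (\<eta> (r n))) t) \<le> K * W t" for n
        using dom
      proof (rule AE_mp, intro AE_I2 impI)
        fix t assume "t \<in> space ?M" and w: "\<forall>n. norm (vd (vd (\<eta> (r n))) t) \<le> W t"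
        then have "\<bar>\<psi> t\<bar> \<le> K" using K[of t] by auto
        then show "norm (\<psi> t *\<^sub>R vd (vd (\<eta> (r n))) t) \<le> K * W t"
          using w unfolding norm_scaleR by (intro mult_mono) auto
      qed
    qed
    have eq1: "integral\<^sup>L ?M (\<lambda>t. \<psi> t *\<^sub>R vd (vd (\<eta> (r n))) t) = integral {0..p} (\<lambda>t. vd (vd \<psi>) t *\<^sub>R \<eta> (r n) t)" for n
      using lebesgue_integral_eq_integral[OF int[of "\<lambda>t. \<psi> t *\<^sub>R vd (vd (\<eta> (r n))) t"]]
        integral_by_parts_twice[OF \<psi> sm, of "r n"] p by (simp add: continuous_intros c\<psi> c)
    have c2: "continuous_on {0..p} (\<lambda>t. vd (vd \<psi>) t)" by (intro smooth_continuous smooth_vd \<psi>)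
    obtain K2 where "\<forall>t\<in>{0..p}. norm (vd (vd \<psi>) t) \<le> K2"
      using compact_imp_bounded[OF compact_continuous_image[OF c2]] unfolding bounded_iff by auto
    then have K2: "\<And>t. t \<in> {0..p} \<Longrightarrow> norm (vd (vd \<psi>) t) \<le> K2" by blast
    have cg: "continuous_on {0..p} g" using g continuous_on_subset by blast
    have L2: "(\<lambda>n. integral {0..p} (\<lambda>t. vd (vd \<psi>) t *\<^sub>R \<eta> (r n) t)) \<longlonglongrightarrow> integral {0..p} (\<lambda>t. vd (vd \<psi>) t *\<^sub>R g t)"
    proof (rule LIMSEQ_iff[THEN iffD2], intro allI impI)
      fix e :: real assume e: "e > 0"
      have K20: "K2 \<ge> 0" using K2[of 0] p by (auto intro: order_trans[OF norm_ge_zero])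
      obtain N :: nat where N: "inverse (real (Suc N)) < e / (K2 * p + 1)"
        using reals_Archimedean[of "e / (K2 * p + 1)"] e K20 p by (auto simp: add_nonneg_pos)
      show "\<exists>no. \<forall>n\<ge>no. norm (integral {0..p} (\<lambda>t. vd (vd \<psi>) t *\<^sub>R \<eta> (r n) t) - integral {0..p} (\<lambda>t. vd (vd \<psi>) t *\<^sub>R g t)) < e"
      proof (intro exI allI impI)
        fix n assume n: "n \<ge> N"
        have "r n \<ge> N" using seq_suble[OF r, of n] n by linarith
        then have h: "inverse (real (Suc (r n))) \<le> inverse (real (Suc N))" by (simp add: le_imp_inverse_le)
        have "integral {0..p} (\<lambda>t. vd (vd \<psi>) t *\<^sub>R \<eta> (r n) t) - integral {0..p} (\<lambda>t. vd (vd \<psi>) t *\<^sub>R g t)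
          = integral {0..p} (\<lambda>t. vd (vd \<psi>) t *\<^sub>R (\<eta> (r n) t - g t))"
          unfolding scaleR_diff_right
          by (intro integral_diff[symmetric] integrable_continuous_real continuous_intros c2 cg smooth_continuous sm)
        also have "norm \<dots> \<le> integral {0..p} (\<lambda>t. K2 * inverse (real (Suc N)))"
        proof (rule integral_norm_bound_integral)
          show "norm (vd (vd \<psi>) t *\<^sub>R (\<eta> (r n) t - g t)) \<le> K2 * inverse (real (Suc N))" if "t \<in> {0..p}" for t
            unfolding norm_scaleR using K2[OF that] K20 order_trans[OF \<eta>(2) h] by (intro mult_mono) simp_all
        qed (intro integrable_continuous_real continuous_intros c2 cg smooth_continuous sm)+
        also have "\<dots> = (K2 * p) * inverse (real (Suc N))" using p by simp
        also have "\<dots> \<le> (K2 * p + 1) * inverse (real (Suc N))" by (intro mult_right_mono) simp_all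
        also have "\<dots> < e" using N K20 p by (simp add: pos_less_divide_eq add_nonneg_pos mult.commute)
        finally show "norm (integral {0..p} (\<lambda>t. vd (vd \<psi>) t *\<^sub>R \<eta> (r n) t) - integral {0..p} (\<lambda>t. vd (vd \<psi>) t *\<^sub>R g t)) < e" .
      qed
    qed
    show ?thesis
      using LIMSEQ_unique[OF L1[unfolded eq1] L2] lebesgue_integral_eq_integral[OF i\<psi>k] by simp
  qed
  have fatou: "(\<integral>\<^sup>+t. ennreal ((norm (k t))\<^sup>2) \<partial>?M) \<le> ennreal (B + 1)"
  proof -
    have "(\<integral>\<^sup>+t. ennreal ((norm (k t))\<^sup>2) \<partial>?M) = (\<integral>\<^sup>+t. liminf (\<lambda>n. ennreal ((norm (vd (vd (\<eta> (r n))) t))\<^sup>2)) \<partial>?M)"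
    proof (rule nn_integral_cong_AE, rule AE_mp[OF lim], intro AE_I2 impI)
      fix t assume "(\<lambda>n. vd (vd (\<eta> (r n))) t) \<longlonglongrightarrow> k t"
      then have "(\<lambda>n. ennreal ((norm (vd (vd (\<eta> (r n))) t))\<^sup>2)) \<longlonglongrightarrow> ennreal ((norm (k t))\<^sup>2)"
        by (intro tendsto_intros)
      then show "ennreal ((norm (k t))\<^sup>2) = liminf (\<lambda>n. ennreal ((norm (vd (vd (\<eta> (r n))) t))\<^sup>2))"
        by (intro lim_imp_Liminf[symmetric]) simp_all
    qed
    also have "\<dots> \<le> liminf (\<lambda>n. \<integral>\<^sup>+t. ennreal ((norm (vd (vd (\<eta> (r n))) t))\<^sup>2) \<partial>?M)"
      by (intro nn_integral_liminf measurable_compose[OF _ measurable_ennreal] meas continuous_intros c)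
    also have "\<dots> \<le> ennreal (B + 1)"
    proof (rule Liminf_le[OF _ always_eventually], simp, rule allI)
      fix n
      have c2: "continuous_on {0..p} (\<lambda>t. (norm (vd (vd (\<eta> (r n))) t))\<^sup>2)" by (intro continuous_intros c)
      have "(\<integral>\<^sup>+t. ennreal ((norm (vd (vd (\<eta> (r n))) t))\<^sup>2) \<partial>?M) = ennreal (integral\<^sup>L ?M (\<lambda>t. (norm (vd (vd (\<eta> (r n))) t))\<^sup>2))"
        by (rule nn_integral_eq_integral[OF int[OF c2]]) simp
      also have "\<dots> = ennreal (bending p (\<eta> (r n)))"
        using lebesgue_integral_eq_integral[OF int[OF c2]] by (simp add: bending_def)
      also have "\<dots> \<le> ennreal (B + 1)" using \<eta>(3) by (rule ennreal_leI)
      finally show "(\<integral>\<^sup>+t. ennreal ((norm (vd (vd (\<eta> (r n))) t))\<^sup>2) \<partial>?M) \<le> ennreal (B + 1)" .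
    qed
    finally show ?thesis .
  qed
  \<comment> \<open>\<open>k\<close> is determined on \<open>{0..p}\<close> only; its periodic extension differs from it there at the point \<open>p\<close> at most.\<close>
  define \<kappa> where "\<kappa> = (\<lambda>t. k (t - p * of_int \<lfloor>t / p\<rfloor>))"
  have \<kappa>: "periodic p \<kappa>" "\<And>t. t \<in> {0..p} - {p} \<Longrightarrow> \<kappa> t = k t"
    using periodic_extension[OF p, where f=k] by (auto simp: \<kappa>_def)
  have abs: "k absolutely_integrable_on {0..p}"
    using k by (simp add: integrable_restrict_space set_integrable_def)
  show ?thesis
  proof (rule that[of \<kappa>])
    show "weak_second_derivative p g \<kappa>"
      unfolding weak_second_derivative_def
    proof (intro conjI allI impI)
      show "periodic p \<kappa>" by (rule \<kappa>)
      show "\<kappa> absolutely_integrable_on {0..p}"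
        by (rule absolutely_integrable_spike[OF abs, of "{p}"]) (use \<kappa> in auto)
      fix \<psi> :: "real \<Rightarrow> real" assume "smooth \<psi> \<and> periodic p \<psi>"
      then have \<psi>: "smooth \<psi>" "periodic p \<psi>" by auto
      have "deriv (deriv \<psi>) = vd (vd \<psi>)"
        unfolding deriv_eq_vd[OF \<psi>(1)] deriv_eq_vd[OF smooth_vd[OF \<psi>(1)]] ..
      moreover have "integral {0..p} (\<lambda>s. \<psi> s *\<^sub>R \<kappa> s) = integral {0..p} (\<lambda>s. \<psi> s *\<^sub>R k s)"
        by (rule integral_spike[of "{p}"]) (use \<kappa>(2) in auto)
      ultimately show "integral {0..p} (\<lambda>s. deriv (deriv \<psi>) s *\<^sub>R g s) = integral {0..p} (\<lambda>s. \<psi> s *\<^sub>R \<kappa> s)"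
        using weak[OF \<psi>] by simp
    qed
    have "(\<integral>\<^sup>+ s\<in>{0..p}. ennreal ((norm (\<kappa> s))\<^sup>2) \<partial>lebesgue) = (\<integral>\<^sup>+ s\<in>{0..p}. ennreal ((norm (k s))\<^sup>2) \<partial>lebesgue)"
    proof (rule nn_integral_cong_AE)
      have "AE s in lebesgue. s \<noteq> p"
        by (rule AE_completion[OF AE_lborel_singleton])
      then show "AE s in lebesgue. ennreal ((norm (\<kappa> s))\<^sup>2) * indicator {0..p} s = ennreal ((norm (k s))\<^sup>2) * indicator {0..p} s"
      proof (rule AE_mp, intro AE_I2 impI)
        fix s assume "s \<noteq> p"
        then show "ennreal ((norm (\<kappa> s))\<^sup>2) * indicator {0..p} s = ennreal ((norm (k s))\<^sup>2) * indicator {0..p} s"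
          using \<kappa>(2)[of s] by (cases "s \<in> {0..p}") simp_all
      qed
    qed
    also have "\<dots> = (\<integral>\<^sup>+t. ennreal ((norm (k t))\<^sup>2) \<partial>?M)"
      by (simp add: nn_integral_restrict_space)
    also have "\<dots> < \<infinity>" by (rule le_less_trans[OF fatou]) simp
    finally show "(\<integral>\<^sup>+ s\<in>{0..p}. ennreal ((norm (\<kappa> s))\<^sup>2) \<partial>lebesgue) < \<infinity>" .
  qed
qed

section \<open>Arc length of rectifiable curves\<close>

fun polygon :: "(real \<Rightarrow> 'a::euclidean_space) \<Rightarrow> real list \<Rightarrow> real" where
  "polygon c (x # y # xs) = dist (c x) (c y) + polygon c (y # xs)"
| "polygon c xs = 0"

lemma polygon_nonneg: "polygon c xs \<ge> 0"
  by (induction c xs rule: polygon.induct) simp_all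

lemma polygon_eq_sum:
  "ennreal (polygon c xs) = (\<Sum>i<length xs - 1. ennreal (dist (c (xs ! i)) (c (xs ! Suc i))))"
proof (induction c xs rule: polygon.induct)
  case (1 c x y xs)
  have "(\<Sum>i<length (x # y # xs) - 1. ennreal (dist (c ((x # y # xs) ! i)) (c ((x # y # xs) ! Suc i))))
    = (\<Sum>i<Suc (length (y # xs) - 1). ennreal (dist (c ((x # y # xs) ! i)) (c ((x # y # xs) ! Suc i))))"
    by simp
  also have "\<dots> = ennreal (dist (c x) (c y)) + (\<Sum>i<length (y # xs) - 1. ennreal (dist (c ((y # xs) ! i)) (c ((y # xs) ! Suc i))))"
    by (subst sum.lessThan_Suc_shift) simp
  finally show ?case using 1 polygon_nonneg[of c "y # xs"] by (simp add: ennreal_plus)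
qed simp_all

lemma polygon_join: "polygon c (xs @ b # ys) = polygon c (xs @ [b]) + polygon c (b # ys)"
proof (induction xs)
  case (Cons x xs)
  then show ?case by (cases xs) simp_all
qed simp

lemma polygon_append_ge: "polygon c xs + polygon c ys \<le> polygon c (xs @ ys)"
proof (induction xs)
  case Nil
  then show ?case by simp
next
  case (Cons x xs)
  show ?case
  proof (cases xs)
    case Nil
    then show ?thesis by (cases ys) simp_all
  next
    case (Cons z zs)
    then show ?thesis using Cons.IH by simp
  qed
qed

lemma polygon_insert: "polygon c (xs @ ys) \<le> polygon c (xs @ b # ys)"
proof (induction xs)
  case Nil
  then show ?case by (cases ys) simp_all
next
  case (Cons x xs)
  show ?case
  proof (cases xs)
    case Nil
    then show ?thesis using dist_triangle[of "c x" _ "c b"] by (cases ys) simp_all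
  next
    case (Cons z zs)
    then show ?thesis using Cons.IH by simp
  qed
qed

text \<open>A weak split suffices for inserting the vertex \<open>b\<close> in a polygon or cutting the polygon there; points equal to
  \<open>b\<close> may go to either side.\<close>

lemma sorted_split:
  fixes b :: real
  assumes "sorted xs"
  obtains ys zs where "xs = ys @ zs" "\<forall>t\<in>set ys. t \<le> b" "\<forall>t\<in>set zs. b \<le> t" "sorted ys" "sorted zs"
proof -
  have "\<exists>ys zs. xs = ys @ zs \<and> (\<forall>t\<in>set ys. t \<le> b) \<and> (\<forall>t\<in>set zs. b \<le> t)"
    using assms
  proof (induction xs)
    case (Cons x xs)
    show ?case
    proof (cases "x \<le> b")
      case True
      from Cons obtain ys zs where "xs = ys @ zs" "\<forall>t\<in>set ys. t \<le> b" "\<forall>t\<in>set zs. b \<le> t" by auto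
      then show ?thesis using True by (intro exI[of _ "x # ys"] exI[of _ zs]) simp
    next
      case False
      then show ?thesis using Cons.prems by (intro exI[of _ "[]"] exI[of _ "x # xs"]) force
    qed
  qed simp
  then show ?thesis using that assms by (metis sorted_append)
qed

lemma polygon_le_step:
  assumes "\<And>x y. x \<in> set xs \<Longrightarrow> y \<in> set xs \<Longrightarrow> dist (c x) (c y) \<le> e"
  shows "polygon c xs \<le> e * (length xs - 1)"
  using assms
proof (induction c xs rule: polygon.induct)
  case (1 c x y xs)
  have "polygon c (y # xs) \<le> e * (length (y # xs) - 1)" by (rule "1.IH") (simp add: "1.prems")
  moreover have "dist (c x) (c y) \<le> e" by (simp add: "1.prems")
  ultimately show ?case by (simp add: algebra_simps)
qed simp_all

lemma polygon_le_increment: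
  assumes F: "\<And>x y. a \<le> x \<Longrightarrow> x \<le> y \<Longrightarrow> y \<le> b \<Longrightarrow> dist (c x) (c y) \<le> F y - F x"
    and xs: "a \<le> b" "sorted xs" "set xs \<subseteq> {a..b}"
  shows "polygon c xs \<le> F b - F a"
proof -
  have mono: "F x \<le> F y" if "a \<le> x" "x \<le> y" "y \<le> b" for x y
    using order_trans[OF zero_le_dist F[OF that]] by simp
  have *: "polygon c (x # xs) \<le> F b - F x" if "sorted (x # xs)" "set (x # xs) \<subseteq> {a..b}" for x xs
    using that
  proof (induction xs arbitrary: x)
    case Nil
    then show ?case using mono by simp
  next
    case (Cons y ys)
    have "polygon c (y # ys) \<le> F b - F y" using Cons by simp
    moreover have "dist (c x) (c y) \<le> F y - F x" using Cons.prems by (intro F) auto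
    ultimately show ?case by simp
  qed
  show ?thesis
  proof (cases xs)
    case Nil
    then show ?thesis using mono xs by simp
  next
    case (Cons y ys)
    then show ?thesis using *[of y ys] mono[of a y] xs by auto
  qed
qed

text \<open>Finiteness of the total length lets \<open>ar a b\<close>, the length between two parameters, be a real number.\<close>

locale rectifiable_arc =
  fixes c :: "real \<Rightarrow> 'a::euclidean_space" and P :: real
  assumes P: "P > 0" and cont: "continuous_on {0..P} c" and fin: "arc_length c 0 P < \<infinity>"
begin

definition ar :: "real \<Rightarrow> real \<Rightarrow> real" where "ar a b = enn2real (arc_length c a b)"

lemma arc_length_polygon: "arc_length c a b = (SUP xs\<in>{xs. sorted xs \<and> set xs \<subseteq> {a..b}}. ennreal (polygon c xs))"
  by (simp add: arc_length_def polygon_eq_sum)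

lemma ennreal_ar:
  assumes "0 \<le> a" "b \<le> P"
  shows "ennreal (ar a b) = arc_length c a b"
proof -
  have "arc_length c a b \<le> arc_length c 0 P"
    unfolding arc_length_polygon by (rule SUP_subset_mono) (use assms in auto)
  then have "arc_length c a b < \<infinity>" using fin by (rule le_less_trans)
  then show ?thesis by (simp add: ar_def)
qed

lemma ar_nonneg: "ar a b \<ge> 0"
  by (simp add: ar_def)

lemma polygon_le_ar:
  assumes "0 \<le> a" "b \<le> P" "sorted xs" "set xs \<subseteq> {a..b}"
  shows "polygon c xs \<le> ar a b"
proof -
  have "ennreal (polygon c xs) \<le> ennreal (ar a b)"
    unfolding ennreal_ar[OF assms(1,2)] arc_length_polygon by (rule SUP_upper) (use assms in simp)
  then show ?thesis using ar_nonneg by (simp add: ennreal_le_iff)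
qed

lemma ar_least:
  assumes "0 \<le> a" "b \<le> P" "\<And>xs. sorted xs \<Longrightarrow> set xs \<subseteq> {a..b} \<Longrightarrow> polygon c xs \<le> M"
  shows "ar a b \<le> M"
proof -
  have M: "M \<ge> 0" using assms(3)[of "[]"] by simp
  have "ennreal (ar a b) \<le> ennreal M"
    unfolding ennreal_ar[OF assms(1,2)] arc_length_polygon
    by (rule SUP_least) (use assms(3) in \<open>auto intro: ennreal_leI\<close>)
  then show ?thesis using M by (simp add: ennreal_le_iff)
qed

lemma ar_approx:
  assumes "0 \<le> a" "b \<le> P" "e > 0"
  obtains xs where "sorted xs" "set xs \<subseteq> {a..b}" "ar a b < polygon c xs + e"
proof -
  have "\<exists>xs. sorted xs \<and> set xs \<subseteq> {a..b} \<and> ar a b < polygon c xs + e"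
  proof (rule ccontr)
    assume "\<not> ?thesis"
    then have "polygon c xs \<le> ar a b - e" if "sorted xs" "set xs \<subseteq> {a..b}" for xs
      using that by (auto simp: not_less le_diff_eq)
    then have "ar a b \<le> ar a b - e" by (rule ar_least[OF assms(1,2)])
    then show False using assms(3) by simp
  qed
  then show ?thesis using that by blast
qed

lemma dist_le_ar: "0 \<le> a \<Longrightarrow> a \<le> b \<Longrightarrow> b \<le> P \<Longrightarrow> dist (c a) (c b) \<le> ar a b"
  using polygon_le_ar[of a b "[a, b]"] by simp

lemma ar_additive:
  assumes "0 \<le> a" "a \<le> b" "b \<le> d" "d \<le> P"
  shows "ar a d = ar a b + ar b d"
proof (rule antisym)
  show "ar a d \<le> ar a b + ar b d"
  proof (rule ar_least)
    fix xs assume xs: "sorted xs" "set xs \<subseteq> {a..d}"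
    obtain ys zs where s: "xs = ys @ zs" "\<forall>t\<in>set ys. t \<le> b" "\<forall>t\<in>set zs. b \<le> t" "sorted ys" "sorted zs"
      by (rule sorted_split[OF xs(1)])
    have "polygon c xs \<le> polygon c (ys @ [b]) + polygon c (b # zs)"
      unfolding s(1) polygon_join[symmetric] by (rule polygon_insert)
    also have "polygon c (ys @ [b]) \<le> ar a b"
      using xs s assms by (intro polygon_le_ar) (auto simp: sorted_append)
    also have "polygon c (b # zs) \<le> ar b d"
      using xs s assms by (intro polygon_le_ar) auto
    finally show "polygon c xs \<le> ar a b + ar b d" by simp
  qed (use assms in auto)
  show "ar a b + ar b d \<le> ar a d"
  proof (rule field_le_epsilon)
    fix e :: real assume e: "e > 0"
    obtain xs where xs: "sorted xs" "set xs \<subseteq> {a..b}" "ar a b < polygon c xs + e / 2"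
      using ar_approx[of a b "e / 2"] assms e by auto
    obtain ys where ys: "sorted ys" "set ys \<subseteq> {b..d}" "ar b d < polygon c ys + e / 2"
      using ar_approx[of b d "e / 2"] assms e by auto
    have "polygon c xs + polygon c ys \<le> polygon c (xs @ ys)" by (rule polygon_append_ge)
    also have "\<dots> \<le> ar a d"
      using xs ys assms by (intro polygon_le_ar) (force simp: sorted_append)+
    finally show "ar a b + ar b d \<le> ar a d + e" using xs(3) ys(3) by linarith
  qed
qed

lemma ar_le_increment:
  assumes "0 \<le> a" "a \<le> b" "b \<le> P"
    and F: "\<And>x y. a \<le> x \<Longrightarrow> x \<le> y \<Longrightarrow> y \<le> b \<Longrightarrow> dist (c x) (c y) \<le> F y - F x"
  shows "ar a b \<le> F b - F a"
  by (rule ar_least[OF assms(1,3)]) (rule polygon_le_increment[OF F assms(2)])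

text \<open>A polygon that almost realizes the total length realizes almost the length of each short piece
  \<open>[x, y]\<close> once \<open>x\<close> and \<open>y\<close> are inserted, and it has boundedly many edges there, each one short.\<close>

lemma ar_uniformly_small:
  assumes e: "e > 0"
  shows "\<exists>\<delta>>0. \<forall>x y. 0 \<le> x \<longrightarrow> x \<le> y \<longrightarrow> y \<le> P \<longrightarrow> y - x < \<delta> \<longrightarrow> ar x y < e"
proof -
  obtain xs where xs: "sorted xs" "set xs \<subseteq> {0..P}" "ar 0 P < polygon c xs + e / 2"
    using ar_approx[of 0 P "e / 2"] e by auto
  define \<eta> where "\<eta> = e / (2 * real (length xs + 1))"
  have \<eta>: "\<eta> > 0" using e by (simp add: \<eta>_def)
  have "uniformly_continuous_on {0..P} c" using cont by (intro compact_uniformly_continuous) auto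
  then obtain \<delta> where \<delta>: "\<delta> > 0" "\<And>s t. s \<in> {0..P} \<Longrightarrow> t \<in> {0..P} \<Longrightarrow> dist t s < \<delta> \<Longrightarrow> dist (c t) (c s) < \<eta>"
    using \<eta> unfolding uniformly_continuous_on_def by metis
  have *: "ar x y < e" if xy: "0 \<le> x" "x \<le> y" "y \<le> P" "y - x < \<delta>" for x y
  proof -
    obtain pre r where 1: "xs = pre @ r" "\<forall>t\<in>set pre. t \<le> x" "\<forall>t\<in>set r. x \<le> t" "sorted pre" "sorted r"
      by (rule sorted_split[OF xs(1)])
    obtain mid post where 2: "r = mid @ post" "\<forall>t\<in>set mid. t \<le> y" "\<forall>t\<in>set post. y \<le> t" "sorted mid" "sorted post"
      by (rule sorted_split[OF 1(5)])
    have sub: "set pre \<subseteq> {0..x}" "set mid \<subseteq> {x..y}" "set post \<subseteq> {y..P}"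
      using xs(2) 1 2 by auto
    have "polygon c xs \<le> polygon c (pre @ x # (mid @ post))" unfolding 1(1) 2(1) by (rule polygon_insert)
    also have "\<dots> \<le> polygon c ((pre @ x # mid) @ y # post)" using polygon_insert[of c "pre @ x # mid" post y] by simp
    also have "\<dots> = polygon c (pre @ [x]) + polygon c (x # mid @ [y]) + polygon c (y # post)"
      using polygon_join[of c "pre @ x # mid" y post] polygon_join[of c pre x "mid @ [y]"] by simp
    also have "polygon c (pre @ [x]) \<le> ar 0 x"
      using sub 1 xy by (intro polygon_le_ar) (auto simp: sorted_append)
    also have "polygon c (y # post) \<le> ar y P"
      using sub 2 xy by (intro polygon_le_ar) auto
    also have "polygon c (x # mid @ [y]) \<le> \<eta> * (length (x # mid @ [y]) - 1)"
    proof (rule polygon_le_step)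
      fix s t assume "s \<in> set (x # mid @ [y])" "t \<in> set (x # mid @ [y])"
      then have "s \<in> {x..y}" "t \<in> {x..y}" using sub(2) xy by auto
      then show "dist (c s) (c t) \<le> \<eta>"
        using xy by (intro less_imp_le \<delta>(2)) (auto simp: dist_real_def)
    qed
    also have "\<eta> * (length (x # mid @ [y]) - 1) \<le> \<eta> * (length xs + 1)"
      using \<eta> 1(1) 2(1) by (intro mult_left_mono) auto
    also have "\<dots> = e / 2"
    proof -
      have "real (length xs + 1) \<noteq> 0" by simp
      then show ?thesis unfolding \<eta>_def by (simp del: of_nat_add of_nat_Suc)
    qed
    finally have "polygon c xs \<le> ar 0 x + e / 2 + ar y P" by simp
    moreover have "ar 0 P = ar 0 x + (ar x y + ar y P)"
      using ar_additive[of 0 x P] ar_additive[of x y P] xy by simp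
    ultimately show ?thesis using xs(3) by linarith
  qed
  show ?thesis using \<delta>(1) * by blast
qed

lemma ar_refl: "0 \<le> a \<Longrightarrow> a \<le> P \<Longrightarrow> ar a a = 0"
  using ar_additive[of a a a] by simp

lemma ar_mono: "0 \<le> a \<Longrightarrow> a \<le> b \<Longrightarrow> b \<le> P \<Longrightarrow> ar 0 a \<le> ar 0 b"
  using ar_additive[of 0 a b] ar_nonneg[of a b] by simp

lemma continuous_ar: "continuous_on {0..P} (ar 0)"
proof (rule uniformly_continuous_imp_continuous, unfold uniformly_continuous_on_def, intro allI impI)
  fix e :: real assume "e > 0"
  then obtain \<delta> where \<delta>: "\<delta> > 0" "\<And>x y. 0 \<le> x \<Longrightarrow> x \<le> y \<Longrightarrow> y \<le> P \<Longrightarrow> y - x < \<delta> \<Longrightarrow> ar x y < e"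
    using ar_uniformly_small by blast
  have *: "\<bar>ar 0 y - ar 0 x\<bar> < e" if "0 \<le> x" "x \<le> y" "y \<le> P" "y - x < \<delta>" for x y
    using \<delta>(2)[OF that] ar_additive[of 0 x y] ar_nonneg[of x y] that by simp
  show "\<exists>d>0. \<forall>x\<in>{0..P}. \<forall>x'\<in>{0..P}. dist x' x < d \<longrightarrow> dist (ar 0 x') (ar 0 x) < e"
  proof (intro exI[of _ \<delta>] conjI ballI impI \<delta>(1))
    fix x y assume "x \<in> {0..P}" "y \<in> {0..P}" "dist y x < \<delta>"
    then show "dist (ar 0 y) (ar 0 x) < e"
      using *[of x y] *[of y x] by (cases "x \<le> y") (auto simp: dist_real_def abs_minus_commute)
  qed
qed

lemma ar_surj: 
  assumes "t \<in> {0..ar 0 P}"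
  obtains u where "u \<in> {0..P}" "ar 0 u = t"
  using IVT'[of "ar 0" 0 t P] assms continuous_ar P ar_refl[of 0] by auto

end

section \<open>Limits of curves with bounded energy\<close>

lemma polygon_perturb:
  assumes "\<And>x. x \<in> set xs \<Longrightarrow> dist (c x) (e x) \<le> \<delta>"
  shows "polygon c xs \<le> polygon e xs + 2 * real (length xs) * \<delta>"
  using assms
proof (induction c xs rule: polygon.induct)
  case (1 c x y xs)
  have "dist (c x) (c y) \<le> dist (e x) (e y) + 2 * \<delta>"
    using dist_triangle[of "c x" "c y" "e x"] dist_triangle[of "e x" "c y" "e y"] "1.prems"[of x] "1.prems"[of y]
    by (simp add: dist_commute)
  moreover have "polygon c (y # xs) \<le> polygon e (y # xs) + 2 * real (length (y # xs)) * \<delta>"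
    by (rule "1.IH") (simp add: "1.prems")
  ultimately show ?case by (simp add: algebra_simps)
next
  case ("2_2" c v)
  then show ?case using order_trans[OF zero_le_dist "2_2"[of v]] by simp
qed simp

text \<open>Length is lower semicontinuous, since inscribed polygons converge and are shorter than the curves; this gives
  one inequality. For the other one, arcs of the approximating curves that are shorter than a fixed \<open>r\<close> are
  almost as short as their chords, and pieces on which the limit curve oscillates little cannot contain
  an arc of length \<open>r\<close>. So on a fine fixed partition the arcs are comparable to the chords of the limit.\<close>

lemma (in rectifiable_arc) arc_length_limit:
  fixes e :: "nat \<Rightarrow> real \<Rightarrow> 'a" and s :: "nat \<Rightarrow> real \<Rightarrow> real"
  assumes s: "\<And>k. continuous_on {0..P} (s k)" "\<And>k. s k 0 = 0"
    and chord: "\<And>k x y. 0 \<le> x \<Longrightarrow> x \<le> y \<Longrightarrow> y \<le> P \<Longrightarrow> dist (e k x) (e k y) \<le> s k y - s k x"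
    and arc: "\<And>k x y. 0 \<le> x \<Longrightarrow> x \<le> y \<Longrightarrow> y \<le> P \<Longrightarrow> (s k y - s k x) * (1 - sqrt (B * (s k y - s k x))) \<le> dist (e k x) (e k y)"
    and B: "B \<ge> 0"
    and conv: "\<And>\<epsilon>. \<epsilon> > 0 \<Longrightarrow> eventually (\<lambda>k. \<forall>x\<in>{0..P}. dist (c x) (e k x) \<le> \<epsilon>) sequentially"
    and u: "u \<in> {0..P}"
  shows "(\<lambda>k. s k u) \<longlonglongrightarrow> ar 0 u"
proof (rule order_tendstoI)
  fix a assume a: "a < ar 0 u"
  define \<epsilon> where "\<epsilon> = ar 0 u - a"
  have \<epsilon>: "\<epsilon> > 0" using a by (simp add: \<epsilon>_def)
  obtain xs where xs: "sorted xs" "set xs \<subseteq> {0..u}" "ar 0 u < polygon c xs + \<epsilon> / 2"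
    using ar_approx[of 0 u "\<epsilon> / 2"] u \<epsilon> by auto
  define \<delta> where "\<delta> = \<epsilon> / (4 * (real (length xs) + 1))"
  have \<delta>: "\<delta> > 0" using \<epsilon> by (simp add: \<delta>_def add_nonneg_pos)
  have "2 * real (length xs) * \<delta> \<le> 2 * (real (length xs) + 1) * \<delta>" using \<delta> by simp
  also have "\<dots> = \<epsilon> / 2"
  proof -
    have "real (length xs) + 1 \<noteq> 0" by simp
    then show ?thesis unfolding \<delta>_def by (simp add: field_simps)
  qed
  finally have le: "2 * real (length xs) * \<delta> \<le> \<epsilon> / 2" .
  show "eventually (\<lambda>k. a < s k u) sequentially"
    using conv[OF \<delta>]
  proof eventually_elim
    case (elim k)
    have "polygon c xs \<le> polygon (e k) xs + 2 * real (length xs) * \<delta>"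
      using elim xs(2) u by (intro polygon_perturb) auto
    moreover have "polygon (e k) xs \<le> s k u - s k 0"
      using chord u xs by (intro polygon_le_increment) auto
    ultimately show ?case using xs(3) le s(2)[of k] \<epsilon>_def by linarith
  qed
next
  fix b assume b: "ar 0 u < b"
  define \<epsilon> where "\<epsilon> = b - ar 0 u"
  define A where "A = ar 0 u"
  have \<epsilon>: "\<epsilon> > 0" and A: "A \<ge> 0" using b ar_nonneg by (simp_all add: \<epsilon>_def A_def)
  \<comment> \<open>The relative loss of length that is tolerated in passing from arcs to chords.\<close>
  define \<eta> where "\<eta> = min (1/2) (\<epsilon> / (4 * (A + 1)))"
  have \<eta>: "0 < \<eta>" "\<eta> \<le> 1/2" "\<eta> * A \<le> \<epsilon> / 4"
  proof -
    show "0 < \<eta>" using \<epsilon> A by (simp add: \<eta>_def)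
    show "\<eta> \<le> 1/2" unfolding \<eta>_def by (rule min.cobounded1)
    have "\<eta> \<le> \<epsilon> / (4 * (A + 1))" unfolding \<eta>_def by (rule min.cobounded2)
    then have "\<eta> * A \<le> \<epsilon> / (4 * (A + 1)) * (A + 1)"
      using A \<epsilon> by (intro mult_mono) simp_all
    also have "\<dots> = \<epsilon> / 4"
    proof -
      have "A + 1 \<noteq> 0" using A by simp
      then show ?thesis by (simp add: divide_simps)
    qed
    finally show "\<eta> * A \<le> \<epsilon> / 4" .
  qed
  \<comment> \<open>Arcs up to this length lose at most the fraction \<open>\<eta>\<close>.\<close>
  define r where "r = \<eta>\<^sup>2 / (B + 1)"
  have r: "r > 0" using \<eta> B by (simp add: r_def add_nonneg_pos)
  have Br: "sqrt (B * a) \<le> \<eta>" if "a \<le> r" for a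
  proof (rule real_le_lsqrt)
    have "B * a \<le> B * r" using that B by (rule mult_left_mono)
    also have "\<dots> \<le> (B + 1) * r" using r by simp
    also have "\<dots> = \<eta>\<^sup>2" using B by (simp add: r_def)
    finally show "B * a \<le> \<eta>\<^sup>2" .
  qed (use \<eta> in simp)
  obtain \<delta>0 where \<delta>0: "\<delta>0 > 0" "\<And>x y. 0 \<le> x \<Longrightarrow> x \<le> y \<Longrightarrow> y \<le> P \<Longrightarrow> y - x < \<delta>0 \<Longrightarrow> ar x y < r / 4"
    using ar_uniformly_small[of "r / 4"] r by auto
  obtain n :: nat where n: "u / \<delta>0 < real n" using reals_Archimedean2 by blast
  have "0 \<le> u / \<delta>0" using u \<delta>0(1) by simp
  then have n0: "real n > 0" using n by linarith
  define t where "t i = u * real i / real n" for i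
  have t: "0 \<le> t i" "t i \<le> t (Suc i)" "t (Suc i) - t i < \<delta>0" for i
  proof -
    have "t (Suc i) - t i = u / real n" by (simp add: t_def distrib_left add_divide_distrib)
    moreover have "u / real n < \<delta>0"
      using n n0 \<delta>0(1) by (simp add: pos_divide_less_eq mult.commute)
    moreover have "0 \<le> u / real n" using u by simp
    ultimately show "t i \<le> t (Suc i)" "t (Suc i) - t i < \<delta>0" by linarith+
    show "0 \<le> t i" using u by (simp add: t_def)
  qed
  have tP: "t i \<le> P" if "i \<le> n" for i
  proof -
    have "t i \<le> u" using that n0 u by (simp add: t_def divide_le_eq mult_left_mono)
    then show ?thesis using u by simp
  qed
  have tn: "t 0 = 0" "t n = u" using n0 by (simp_all add: t_def)
  \<comment> \<open>The first bound excludes arcs of length \<open>r\<close> between partition points, since \<open>r / 4 + 2 \<delta> < r / 2\<close>; the second one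
    controls the sum of the errors over the \<open>n\<close> pieces.\<close>
  define \<delta> where "\<delta> = min (r / 16) (\<epsilon> / (16 * real n))"
  have \<delta>: "\<delta> > 0" "\<delta> \<le> r / 16" "2 * real n * \<delta> \<le> \<epsilon> / 8"
  proof -
    show "\<delta> > 0" using r \<epsilon> n0 by (simp add: \<delta>_def)
    show "\<delta> \<le> r / 16" unfolding \<delta>_def by (rule min.cobounded1)
    have "\<delta> \<le> \<epsilon> / (16 * real n)" unfolding \<delta>_def by (rule min.cobounded2)
    then have "2 * real n * \<delta> \<le> 2 * real n * (\<epsilon> / (16 * real n))" by (intro mult_left_mono) simp_all
    also have "\<dots> = \<epsilon> / 8" using n0 by simp
    finally show "2 * real n * \<delta> \<le> \<epsilon> / 8" .
  qed
  show "eventually (\<lambda>k. s k u < b) sequentially"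
    using conv[OF \<delta>(1)]
  proof eventually_elim
    case (elim k)
    have close: "dist (e k x) (e k y) \<le> dist (c x) (c y) + 2 * \<delta>" if "x \<in> {0..P}" "y \<in> {0..P}" for x y
    proof -
      have "dist (c x) (e k x) \<le> \<delta>" "dist (c y) (e k y) \<le> \<delta>" using elim that by blast+
      then show ?thesis
        using dist_triangle[of "e k x" "e k y" "c x"] dist_triangle[of "c x" "e k y" "c y"]
        by (simp add: dist_commute)
    qed
    have step: "(s k (t (Suc i)) - s k (t i)) * (1 - \<eta>) \<le> dist (c (t i)) (c (t (Suc i))) + 2 * \<delta>" if i: "i < n" for i
    proof -
      have i': "0 \<le> t i" "t i \<le> t (Suc i)" "t (Suc i) \<le> P" "t i \<le> P" using t tP i by simp_all
      \<comment> \<open>Otherwise a point \<open>w\<close> would cut off an arc of length exactly \<open>r\<close>, with a chord of length at least \<open>r / 2\<close>.\<close>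
      have "s k (t (Suc i)) - s k (t i) < r"
      proof (rule ccontr)
        assume "\<not> ?thesis"
        then have "\<exists>w\<ge>t i. w \<le> t (Suc i) \<and> s k w = s k (t i) + r"
          using r i' by (intro IVT' continuous_on_subset[OF s(1)]) auto
        then obtain w where w: "t i \<le> w" "w \<le> t (Suc i)" "s k w - s k (t i) = r" by auto
        have "r * (1/2) \<le> r * (1 - sqrt (B * r))" using Br[of r] \<eta> r by (intro mult_left_mono) simp_all
        also have "\<dots> \<le> dist (e k (t i)) (e k w)"
          using arc[of "t i" w k] w i' by simp
        also have "\<dots> \<le> dist (c (t i)) (c w) + 2 * \<delta>" using w i' by (intro close) auto
        also have "dist (c (t i)) (c w) \<le> ar (t i) w" using w i' by (intro dist_le_ar) auto
        also have "ar (t i) w < r / 4" using w i' t(3)[of i] by (intro \<delta>0(2)) auto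
        finally show False using \<delta>(2) r by simp
      qed
      then have "sqrt (B * (s k (t (Suc i)) - s k (t i))) \<le> \<eta>" by (intro Br) simp
      moreover have "s k (t (Suc i)) - s k (t i) \<ge> 0"
        using chord[OF i'(1,2,3), of k] zero_le_dist order_trans by blast
      ultimately have "(s k (t (Suc i)) - s k (t i)) * (1 - \<eta>)
          \<le> (s k (t (Suc i)) - s k (t i)) * (1 - sqrt (B * (s k (t (Suc i)) - s k (t i))))"
        by (intro mult_left_mono) simp_all
      also have "\<dots> \<le> dist (e k (t i)) (e k (t (Suc i)))" by (rule arc[OF i'(1,2,3)])
      also have "\<dots> \<le> dist (c (t i)) (c (t (Suc i))) + 2 * \<delta>" using i' by (intro close) auto
      finally show ?thesis .
    qed
    have "s k u = (\<Sum>i<n. s k (t (Suc i)) - s k (t i))"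
      using sum_lessThan_telescope[of "\<lambda>i. s k (t i)" n] by (simp add: tn s(2))
    then have "s k u * (1 - \<eta>) = (\<Sum>i<n. (s k (t (Suc i)) - s k (t i)) * (1 - \<eta>))"
      by (simp only: sum_distrib_right)
    also have "\<dots> \<le> (\<Sum>i<n. (ar 0 (t (Suc i)) - ar 0 (t i)) + 2 * \<delta>)"
    proof (rule sum_mono)
      fix i assume "i \<in> {..<n}"
      then have i: "i < n" by simp
      have "dist (c (t i)) (c (t (Suc i))) \<le> ar (t i) (t (Suc i))"
        using t tP i by (intro dist_le_ar) auto
      also have "\<dots> = ar 0 (t (Suc i)) - ar 0 (t i)"
        using ar_additive[of 0 "t i" "t (Suc i)"] t tP i by simp
      finally show "(s k (t (Suc i)) - s k (t i)) * (1 - \<eta>) \<le> (ar 0 (t (Suc i)) - ar 0 (t i)) + 2 * \<delta>"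
        using step[OF i] by simp
    qed
    also have "\<dots> = A + 2 * real n * \<delta>"
      using sum_lessThan_telescope[of "\<lambda>i. ar 0 (t i)" n] P by (simp add: sum.distrib tn A_def ar_refl)
    also have "\<dots> \<le> A + \<epsilon> / 8" using \<delta>(3) by simp
    finally have 1: "s k u * (1 - \<eta>) \<le> A + \<epsilon> / 8" .
    have "s k u = s k u * (1 - \<eta>) * (1 / (1 - \<eta>))" using \<eta> by simp
    also have "\<dots> \<le> (A + \<epsilon> / 8) * (1 + 2 * \<eta>)"
    proof (rule mult_mono[OF 1])
      have "1 \<le> (1 + 2 * \<eta>) * (1 - \<eta>)" using \<eta> mult_left_mono[of "\<eta>" "1/2" \<eta>] by (simp add: algebra_simps)
      then show "1 / (1 - \<eta>) \<le> 1 + 2 * \<eta>" using \<eta> by (simp add: pos_divide_le_eq)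
    qed (use \<eta> A \<epsilon> in simp_all)
    also have "\<dots> = A + 2 * (\<eta> * A) + \<epsilon> / 8 + \<epsilon> / 4 * \<eta>" by (simp add: algebra_simps)
    also have "\<dots> \<le> A + 2 * (\<epsilon> / 4) + \<epsilon> / 8 + \<epsilon> / 4 * (1/2)"
      using \<eta> \<epsilon> by (intro add_mono mult_left_mono) simp_all
    also have "\<dots> < b" using \<epsilon> by (simp add: A_def \<epsilon>_def field_simps)
    finally show ?case .
  qed
qed

lemma constant_speed_chord:
  assumes g: "g \<in> immersed_curves" and sp: "\<And>u. speed g u = r" and xy: "x \<le> y"
  shows "norm (g y - g x) \<le> r * (y - x)"
proof -
  have "((\<lambda>u. vd g u) has_integral (g y - g x)) {x..y}"
    using smooth_has_vd[OF immersed_curvesD(1)[OF g]] has_vector_derivative_at_within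
    by (intro fundamental_theorem_of_calculus[OF xy]) blast
  then have "norm (g y - g x) = norm (integral {x..y} (vd g))" by (simp add: integral_unique)
  also have "\<dots> \<le> integral {x..y} (\<lambda>u. r)"
    using sp by (intro integral_norm_bound_integral integrable_continuous_real continuous_on_const
        smooth_continuous[OF smooth_vd[OF immersed_curvesD(1)[OF g]]]) (auto simp: speed_def)
  finally show ?thesis using xy by (simp add: mult.commute)
qed

text \<open>The unit tangent is Hoelder continuous with exponent \<open>1/2\<close> and constant \<open>\<surd>B\<close>. Over an arc of length \<open>l\<close> it
  thus stays within \<open>\<surd>(B l)\<close> of its initial value, and so does its mean, the chord divided by \<open>l\<close>.\<close>

lemma constant_speed_chord_arc:
  assumes g: "g \<in> immersed_curves" and sp: "\<And>u. speed g u = r" and E: "energy g \<le> B"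
    and xy: "x \<le> y" "y \<le> x + 2 * pi"
  shows "r * (y - x) * (1 - sqrt (B * (r * (y - x)))) \<le> norm (g y - g x)"
proof -
  have r: "r > 0" using smooth_speed(2)[OF g] sp by metis
  note sm = immersed_curvesD(1)[OF g]
  have c: "continuous_on A (vd g)" "continuous_on A (vd (vd g))" for A
    by (intro smooth_continuous smooth_vd sm)+
  define Q where "Q = integral {x..y} (\<lambda>u. (norm (vd (vd g) u))\<^sup>2)"
  have "Q \<le> integral {x..x+2*pi} (\<lambda>u. (norm (vd (vd g) u))\<^sup>2)"
    unfolding Q_def using xy by (intro integral_subset_le integrable_continuous_real continuous_intros c) auto
  also have "\<dots> = integral {0..2*pi} (\<lambda>u. (norm (vd (vd g) u))\<^sup>2)"
    using vd_periodic[OF smooth_vd[OF sm] vd_periodic[OF sm immersed_curvesD(2)[OF g]]]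
    by (intro integral_periodic continuous_intros c) (simp_all add: periodic_def)
  also have "\<dots> = energy g * r ^ 3" using energy_constant_speed[OF g sp] r by simp
  also have "\<dots> \<le> B * r ^ 3" using E r by simp
  finally have Q: "Q \<le> B * r ^ 3" .
  define T where "T = sqrt ((y - x) * (B * r ^ 3))"
  have tangent: "norm (vd g u - vd g x) \<le> T" if u: "u \<in> {x..y}" for u
  proof -
    have "((\<lambda>u. vd (vd g) u) has_integral (vd g u - vd g x)) {x..u}"
      using u smooth_has_vd[OF smooth_vd[OF sm]] has_vector_derivative_at_within
      by (intro fundamental_theorem_of_calculus) (simp, blast)
    then have "norm (vd g u - vd g x) = norm (integral {x..u} (vd (vd g)))" by (simp add: integral_unique)
    also have "\<dots> \<le> integral {x..u} (\<lambda>u. norm (vd (vd g) u))"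
      by (intro integral_norm_bound_integral integrable_continuous_real continuous_intros c) simp
    also have "\<dots> \<le> integral {x..y} (\<lambda>u. 1 * norm (vd (vd g) u))"
      unfolding mult_1 using u by (intro integral_subset_le integrable_continuous_real continuous_intros c) auto
    also have "\<dots> \<le> sqrt (integral {x..y} (\<lambda>u. 1\<^sup>2)) * sqrt Q"
      unfolding Q_def by (intro Cauchy_Schwarz_le continuous_intros c)
    also have "\<dots> = sqrt ((y - x) * Q)" using xy by (simp add: real_sqrt_mult)
    also have "\<dots> \<le> T" unfolding T_def using Q xy by (intro real_sqrt_le_mono mult_left_mono) simp_all
    finally show ?thesis .
  qed
  have "((\<lambda>u. vd g u - vd g x) has_integral (g y - g x) - (y - x) *\<^sub>R vd g x) {x..y}"
  proof (rule has_integral_diff)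
    show "(vd g has_integral g y - g x) {x..y}"
      using smooth_has_vd[OF sm] has_vector_derivative_at_within
      by (intro fundamental_theorem_of_calculus[OF xy(1)]) blast
    show "((\<lambda>u. vd g x) has_integral (y - x) *\<^sub>R vd g x) {x..y}"
      using has_integral_const_real[of "vd g x" x y] xy by simp
  qed
  then have "norm ((g y - g x) - (y - x) *\<^sub>R vd g x) = norm (integral {x..y} (\<lambda>u. vd g u - vd g x))"
    by (simp add: integral_unique)
  also have "\<dots> \<le> integral {x..y} (\<lambda>u. T)"
    using tangent by (intro integral_norm_bound_integral integrable_continuous_real continuous_intros c) auto
  also have "\<dots> = (y - x) * T" using xy by simp
  finally have "norm ((g y - g x) - (y - x) *\<^sub>R vd g x) \<le> (y - x) * T" .
  moreover have "norm ((y - x) *\<^sub>R vd g x) = r * (y - x)" using sp[of x] xy by (simp add: speed_def)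
  ultimately have "r * (y - x) - (y - x) * T \<le> norm (g y - g x)"
    using norm_triangle_ineq2[of "(y - x) *\<^sub>R vd g x" "g y - g x"] by (simp add: norm_minus_commute)
  moreover have "T = r * sqrt (B * (r * (y - x)))"
  proof -
    have "(y - x) * (B * r ^ 3) = r\<^sup>2 * (B * (r * (y - x)))" by (simp add: eval_nat_numeral)
    then show ?thesis using r by (simp only: T_def real_sqrt_mult[of "r\<^sup>2"] real_sqrt_abs abs_of_pos)
  qed
  ultimately show ?thesis by (simp add: algebra_simps)
qed

lemma bending_scale:
  fixes g :: "real \<Rightarrow> 'a::euclidean_space"
  assumes a: "a > 0" and g: "smooth g" and p: "p \<ge> 0"
  shows "bending p (\<lambda>t. g (a * t)) = a ^ 3 * bending (a * p) g"
proof -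
  have at: "smooth (\<lambda>t. a * t)" by (intro smooth_mult smooth_const smooth_id)
  have va: "vd (\<lambda>t. a * t) x = a" for x
    by (rule vector_derivative_at) (auto intro!: derivative_eq_intros)
  have v1: "vd (\<lambda>t. h (a * t)) x = a *\<^sub>R vd h (a * x)" if "smooth h" for h :: "real \<Rightarrow> 'a" and x
    using vd_compose[OF that at, of x] by (simp add: va)
  have v2: "vd (vd (\<lambda>t. g (a * t))) x = (a * a) *\<^sub>R vd (vd g) (a * x)" for x
  proof -
    have "vd (\<lambda>t. a *\<^sub>R vd g t) y = a *\<^sub>R vd (vd g) y" for y
      using smooth_has_vd[OF smooth_vd[OF g]]
      by (intro vector_derivative_at) (auto intro!: derivative_eq_intros)
    then show ?thesis
      unfolding v1[OF g] v1[OF smooth_scaleR[OF smooth_const[of a] smooth_vd[OF g]]] by simp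
  qed
  define f where "f t = (norm (vd (vd g) t))\<^sup>2" for t
  have "continuous_on UNIV f"
    unfolding f_def[abs_def] by (intro continuous_intros smooth_continuous smooth_vd g)
  then obtain F where F: "\<And>x. (F has_vector_derivative f x) (at x)"
    using antiderivative_UNIV[of f] by blast
  have F': "((\<lambda>t. F (a * t) / a) has_vector_derivative f (a * x)) (at x)" for x
  proof -
    have "((\<lambda>t. F (a * t)) has_vector_derivative a *\<^sub>R f (a * x)) (at x)"
      using vector_diff_chain_at[OF smooth_has_vd[OF at] F, of x] by (simp add: o_def va)
    from has_vector_derivative_mult_right[OF this, of "1 / a"] show ?thesis using a by simp
  qed
  have "(norm ((a * a) *\<^sub>R w))\<^sup>2 = a ^ 4 * (norm w)\<^sup>2" for w :: 'a
    by (simp add: power_mult_distrib eval_nat_numeral)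
  then have "bending p (\<lambda>t. g (a * t)) = integral {0..p} (\<lambda>t. a ^ 4 * f (a * t))"
    unfolding bending_def v2 f_def by simp
  also have "\<dots> = a ^ 4 * ((F (a * p) - F 0) / a)"
    using integral_antiderivative[OF F' p] by (simp add: diff_divide_distrib)
  also have "F (a * p) - F 0 = bending (a * p) g"
    using integral_antiderivative[OF F, of 0 "a * p"] a p by (simp add: bending_def f_def)
  also have "a ^ 4 * (bending (a * p) g / a) = a ^ 3 * bending (a * p) g"
    using a by (simp add: eval_nat_numeral)
  finally show ?thesis .
qed

text \<open>Pointwise convergence on a finite net suffices. The factor \<open>2\<close> leaves room for the approximating curves,
  whose speed tends to \<open>1\<close> only in the limit.\<close>

lemma uniform_of_pointwise_lipschitz:
  fixes f :: "nat \<Rightarrow> real \<Rightarrow> 'a::euclidean_space"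
  assumes L: "L > 0"
    and lip: "eventually (\<lambda>k. \<forall>x\<in>{0..L}. \<forall>y\<in>{0..L}. norm (f k x - f k y) \<le> 2 * \<bar>x - y\<bar>) sequentially"
    and lip': "\<And>x y. x \<in> {0..L} \<Longrightarrow> y \<in> {0..L} \<Longrightarrow> norm (g x - g y) \<le> \<bar>x - y\<bar>"
    and lim: "\<And>x. x \<in> {0..L} \<Longrightarrow> (\<lambda>k. f k x) \<longlonglongrightarrow> g x"
    and \<epsilon>: "\<epsilon> > 0"
  shows "eventually (\<lambda>k. \<forall>x\<in>{0..L}. norm (f k x - g x) \<le> \<epsilon>) sequentially"
proof -
  have "\<exists>T. finite T \<and> T \<subseteq> {0..L} \<and> {0..L} \<subseteq> (\<Union>x\<in>T. ball x (\<epsilon> / 8))"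
    by (rule seq_compact_imp_totally_bounded[OF compact_imp_seq_compact, rule_format]) (use \<epsilon> in simp_all)
  then obtain T where T: "finite T" "T \<subseteq> {0..L}" "{0..L} \<subseteq> (\<Union>x\<in>T. ball x (\<epsilon> / 8))"
    by blast
  have "eventually (\<lambda>k. \<forall>x\<in>T. dist (f k x) (g x) < \<epsilon> / 8) sequentially"
    using T(1)
  proof (rule eventually_ball_finite, intro ballI)
    fix x assume "x \<in> T"
    then have "(\<lambda>k. f k x) \<longlonglongrightarrow> g x" using T(2) lim by blast
    then show "eventually (\<lambda>k. dist (f k x) (g x) < \<epsilon> / 8) sequentially" using \<epsilon> by (intro tendstoD) simp_all
  qed
  with lip show ?thesis
  proof eventually_elim
    case (elim k)
    show ?case
    proof
      fix x assume x: "x \<in> {0..L}"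
      obtain t where t: "t \<in> T" "\<bar>x - t\<bar> < \<epsilon> / 8"
        using T(3) x by (force simp: dist_real_def abs_minus_commute)
      have tL: "t \<in> {0..L}" using t T by blast
      have 1: "norm (f k x - f k t) \<le> 2 * \<bar>x - t\<bar>" using elim(1) x tL by blast
      have 2: "norm (g x - g t) \<le> \<bar>x - t\<bar>" by (rule lip'[OF x tL])
      have 3: "norm (f k t - g t) < \<epsilon> / 8" using elim(2) t by (simp add: dist_norm)
      have "f k x - g x = (f k x - f k t) + (f k t - g t) - (g x - g t)" by simp
      then have "norm (f k x - g x) \<le> norm (f k x - f k t) + norm (f k t - g t) + norm (g x - g t)"
        using norm_triangle_ineq4[of "(f k x - f k t) + (f k t - g t)" "g x - g t"]
          norm_triangle_ineq[of "f k x - f k t" "f k t - g t"] by simp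
      moreover have "n \<le> \<epsilon>" if "n \<le> a + b + c" "a \<le> 2 * d" "c \<le> d" "b < \<epsilon> / 8" "d < \<epsilon> / 8" for n a b c d
        using that \<epsilon> by linarith
      ultimately show "norm (f k x - g x) \<le> \<epsilon>" using 1 2 3 t(2) by blast
    qed
  qed
qed

locale rectifiable_loop =
  fixes c :: "real \<Rightarrow> 'a::euclidean_space"
  assumes rect: "rectifiable_closed_curve c" and nonconst: "nonconstant c"
begin

sublocale rectifiable_arc c "2 * pi"
  using rect by unfold_locales (auto simp: rectifiable_closed_curve_def intro: continuous_on_subset)

abbreviation "L \<equiv> ar 0 (2 * pi)"

lemma total_length: "total_length c = L" "enn2real (arc_length c 0 u) = ar 0 u"
  by (simp_all add: total_length_def ar_def)

lemma c_periodic: "periodic (2 * pi) c" and c_cont: "continuous_on UNIV c"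
  using rect by (auto simp: rectifiable_closed_curve_def)

lemma two_points:
  obtains a b where "a \<in> {0..2*pi}" "b \<in> {0..2*pi}" "a < b" "c a \<noteq> c b"
proof -
  obtain u v where uv: "c u \<noteq> c v" using nonconst by (auto simp: nonconstant_def)
  define a where "a = u - 2 * pi * of_int \<lfloor>u / (2 * pi)\<rfloor>"
  define b where "b = v - 2 * pi * of_int \<lfloor>v / (2 * pi)\<rfloor>"
  have ab: "a \<in> {0..<2*pi}" "b \<in> {0..<2*pi}"
    unfolding a_def b_def by (intro periodic_reduce; simp)+
  have "c a = c u" "c b = c v"
    using periodic_int[OF c_periodic, of a "\<lfloor>u / (2 * pi)\<rfloor>"] periodic_int[OF c_periodic, of b "\<lfloor>v / (2 * pi)\<rfloor>"]
    by (simp_all add: a_def b_def)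
  then have ne: "c a \<noteq> c b" using uv by simp
  show ?thesis
  proof (cases "a < b")
    case True
    then show ?thesis using that[of a b] ab ne by auto
  next
    case False
    then have "b < a" using ne by (metis linorder_neqE_linordered_idom)
    then show ?thesis using that[of b a] ab ne by auto
  qed
qed

lemma L_pos: "L > 0"
proof -
  obtain a b where ab: "a \<in> {0..2*pi}" "b \<in> {0..2*pi}" "a < b" "c a \<noteq> c b" by (rule two_points)
  have "0 < dist (c a) (c b)" using ab by simp
  also have "\<dots> \<le> ar a b" using ab by (intro dist_le_ar) auto
  also have "\<dots> \<le> L"
    using ab ar_additive[of 0 a "2*pi"] ar_additive[of a b "2*pi"] ar_nonneg by auto
  finally show ?thesis .
qed

lemma dist_le_ar_diff:
  assumes "u \<in> {0..2*pi}" "v \<in> {0..2*pi}"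
  shows "dist (c u) (c v) \<le> \<bar>ar 0 u - ar 0 v\<bar>"
proof -
  have *: "dist (c u) (c v) \<le> \<bar>ar 0 u - ar 0 v\<bar>" if "u \<in> {0..2*pi}" "v \<in> {0..2*pi}" "u \<le> v" for u v
    using dist_le_ar[of u v] ar_additive[of 0 u v] that by simp
  show ?thesis using *[of u v] *[of v u] assms by (cases "u \<le> v") (auto simp: dist_commute abs_minus_commute)
qed

text \<open>\<open>\<gamma>0\<close> is the arc-length parametrization on one period. It is well defined because parameters with equal arc
  length are joined by an arc of length zero, on which \<open>c\<close> is constant.\<close>

definition \<gamma>0 :: "real \<Rightarrow> 'a" where "\<gamma>0 t = c (SOME u. u \<in> {0..2*pi} \<and> ar 0 u = t)"

definition \<gamma> :: "real \<Rightarrow> 'a" where "\<gamma> t = \<gamma>0 (t - L * of_int \<lfloor>t / L\<rfloor>)"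

lemma \<gamma>0_ar: "u \<in> {0..2*pi} \<Longrightarrow> \<gamma>0 (ar 0 u) = c u"
proof -
  assume u: "u \<in> {0..2*pi}"
  define w where "w = (SOME w. w \<in> {0..2*pi} \<and> ar 0 w = ar 0 u)"
  have "w \<in> {0..2*pi} \<and> ar 0 w = ar 0 u" unfolding w_def by (rule someI[of _ u]) (use u in simp)
  then have "dist (c w) (c u) \<le> 0" using dist_le_ar_diff[of w u] u by simp
  then show "\<gamma>0 (ar 0 u) = c u" by (simp add: \<gamma>0_def w_def)
qed

lemma \<gamma>0_lipschitz:
  assumes "x \<in> {0..L}" "y \<in> {0..L}"
  shows "norm (\<gamma>0 x - \<gamma>0 y) \<le> \<bar>x - y\<bar>"
proof -
  obtain u where u: "u \<in> {0..2*pi}" "ar 0 u = x" by (rule ar_surj[OF assms(1)])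
  obtain v where v: "v \<in> {0..2*pi}" "ar 0 v = y" by (rule ar_surj[OF assms(2)])
  show ?thesis using dist_le_ar_diff[OF u(1) v(1)] \<gamma>0_ar[OF u(1)] \<gamma>0_ar[OF v(1)] u v by (simp add: dist_norm)
qed

lemma \<gamma>_eq: "t \<in> {0..L} \<Longrightarrow> \<gamma> t = \<gamma>0 t"
proof (cases "t = L")
  case True
  have "\<gamma>0 L = c (2 * pi)" "\<gamma>0 0 = c 0" using \<gamma>0_ar[of "2*pi"] \<gamma>0_ar[of 0] ar_refl[of 0] by simp_all
  moreover have "c (2 * pi) = c 0" using c_periodic unfolding periodic_def by (metis add_0)
  ultimately show ?thesis using True L_pos by (simp add: \<gamma>_def)
next
  case False
  assume "t \<in> {0..L}"
  then have "t \<in> {0..<L}" using False by simp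
  then show ?thesis unfolding \<gamma>_def by (rule periodic_extension(2)[OF L_pos])
qed

lemma \<gamma>_arc_parametrization: "arc_parametrization c \<gamma>"
  unfolding arc_parametrization_def total_length
proof (intro conjI ballI)
  show "periodic L \<gamma>" unfolding \<gamma>_def[abs_def] by (rule periodic_extension(1)[OF L_pos])
  fix u assume u: "u \<in> {0..2*pi}"
  then have "ar 0 u \<in> {0..L}" using ar_nonneg ar_mono[of u "2*pi"] by simp
  then show "\<gamma> (ar 0 u) = c u" using \<gamma>_eq \<gamma>0_ar[OF u] by simp
qed

lemma \<gamma>_periodic: "periodic L \<gamma>"
  using \<gamma>_arc_parametrization by (simp add: arc_parametrization_def total_length)

lemma \<gamma>_continuous: "continuous_on UNIV \<gamma>"
  unfolding \<gamma>_def[abs_def]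
proof (rule periodic_extension_continuous[OF L_pos])
  show "continuous_on {0..L} \<gamma>0"
  proof (rule continuous_onI)
    fix x e :: real assume x: "x \<in> {0..L}" and e: "e > 0"
    show "\<exists>d>0. \<forall>x'\<in>{0..L}. dist x' x < d \<longrightarrow> dist (\<gamma>0 x') (\<gamma>0 x) \<le> e"
    proof (intro exI[of _ e] conjI ballI impI e)
      fix x' assume "x' \<in> {0..L}" "dist x' x < e"
      then show "dist (\<gamma>0 x') (\<gamma>0 x) \<le> e"
        using \<gamma>0_lipschitz[of x' x] x by (simp add: dist_norm)
    qed
  qed
  show "\<gamma>0 L = \<gamma>0 0" using \<gamma>_eq[of L] \<gamma>_eq[of 0] \<gamma>_periodic L_pos unfolding periodic_def by (metis add_0 atLeastAtMost_iff less_imp_le order_refl)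
qed

text \<open>Convergence of the arc lengths turns uniform convergence of the curves into uniform convergence of their
  constant-speed parametrizations to \<open>\<gamma>\<close>. At constant speed, energy and bending are proportional, with a factor that
  stays bounded because the lengths converge.\<close>

lemma weak_curvature_of_limit:
  fixes e :: "nat \<Rightarrow> real \<Rightarrow> 'a"
  assumes e: "\<And>k. e k \<in> immersed_curves" and E: "\<And>k. energy (e k) \<le> B"
    and conv: "\<And>\<epsilon>. \<epsilon> > 0 \<Longrightarrow> eventually (\<lambda>k. \<forall>u. norm (c u - e k u) \<le> \<epsilon>) sequentially"
  shows "\<exists>\<kappa>. weak_curvature c \<kappa> \<and> weak_energy c \<kappa> < \<infinity>"
proof -
  have B: "B \<ge> 0" using energy_nonneg[OF e] E order_trans by blast
  define \<Lambda> where "\<Lambda> k = len (e k)" for k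
  have \<Lambda>: "\<Lambda> k > 0" for k unfolding \<Lambda>_def by (rule smooth_speed(4)[OF e])
  define r where "r k = \<Lambda> k / (2 * pi)" for k
  have r: "r k > 0" for k using \<Lambda> by (simp add: r_def)
  have "\<exists>g \<sigma>. g \<in> immersed_curves \<and> \<sigma> \<in> diff_circle \<and> e k = (\<lambda>u. g (\<sigma> u)) \<and> (\<forall>u. speed g u = r k)
     \<and> mono \<sigma> \<and> \<sigma> 0 = 0 \<and> \<sigma> (2 * pi) = 2 * pi" for k
    unfolding r_def \<Lambda>_def by (rule constant_speed_reparam[OF e])
  then obtain g \<sigma> where g: "\<And>k. g k \<in> immersed_curves" and \<sigma>: "\<And>k. \<sigma> k \<in> diff_circle"
    and eg: "\<And>k. e k = (\<lambda>u. g k (\<sigma> k u))" and sp: "\<And>k u. speed (g k) u = r k"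
    and \<sigma>_mono: "\<And>k. mono (\<sigma> k)" and \<sigma>0: "\<And>k. \<sigma> k 0 = 0" and \<sigma>2: "\<And>k. \<sigma> k (2 * pi) = 2 * pi" by metis
  have Eg: "energy (g k) \<le> B" for k
    using energy_reparam[OF g \<sigma>, of k k] E[of k] eg[of k] by simp
  have s\<sigma>: "smooth (\<sigma> k)" for k using \<sigma>[of k] by (simp add: diff_circle_def)
  have mono: "\<sigma> k x \<le> \<sigma> k y" if "x \<le> y" for k x y
    using \<sigma>_mono that by (rule monoD)
  have range: "\<sigma> k x \<in> {0..2*pi}" if "x \<in> {0..2*pi}" for k x
    using mono[of 0 x k] mono[of x "2*pi" k] \<sigma>0[of k] \<sigma>2[of k] that by simp
  define s where "s k u = r k * \<sigma> k u" for k u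
  have lim: "(\<lambda>k. s k u) \<longlonglongrightarrow> ar 0 u" if "u \<in> {0..2*pi}" for u
  proof (rule arc_length_limit[where e=e and B=B])
    show "continuous_on {0..2*pi} (s k)" for k
      unfolding s_def[abs_def] by (intro continuous_intros smooth_continuous s\<sigma>)
    show "s k 0 = 0" for k by (simp add: s_def \<sigma>0)
    fix k x y assume xy: "0 \<le> x" "x \<le> y" "y \<le> 2 * pi"
    have 1: "s k y - s k x = r k * (\<sigma> k y - \<sigma> k x)" by (simp add: s_def right_diff_distrib)
    have d: "dist (e k x) (e k y) = norm (g k (\<sigma> k y) - g k (\<sigma> k x))"
      unfolding eg by (simp add: dist_norm norm_minus_commute)
    show "dist (e k x) (e k y) \<le> s k y - s k x"
      unfolding d 1 by (rule constant_speed_chord[OF g sp mono[OF xy(2)]])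
    show "(s k y - s k x) * (1 - sqrt (B * (s k y - s k x))) \<le> dist (e k x) (e k y)"
      unfolding d 1
    proof (rule constant_speed_chord_arc[OF g sp Eg mono[OF xy(2)]])
      show "\<sigma> k y \<le> \<sigma> k x + 2 * pi" using range[of x k] range[of y k] xy by simp
    qed
  next
    show "eventually (\<lambda>k. \<forall>x\<in>{0..2*pi}. dist (c x) (e k x) \<le> \<epsilon>) sequentially" if "\<epsilon> > 0" for \<epsilon>
      using conv[OF that] by eventually_elim (simp add: dist_norm)
  qed (use B that in auto)
  have s2: "s k (2 * pi) = \<Lambda> k" for k by (simp add: s_def \<sigma>2 r_def)
  have \<Lambda>lim: "\<Lambda> \<longlonglongrightarrow> L" using lim[of "2*pi"] unfolding s2 by simp
  define a where "a = 2 * pi / L"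
  have a: "a > 0" "a * L = 2 * pi" using L_pos by (simp_all add: a_def)
  \<comment> \<open>All curves are rescaled to the common period \<open>L\<close>; their speed is then \<open>\<Lambda> k / L\<close> rather than \<open>1\<close>.\<close>
  define \<eta> where "\<eta> k t = g k (a * t)" for k t
  have \<eta>_loop: "\<eta> k \<in> smooth_loops L" for k
  proof -
    have "g k (a * (t + L)) = g k (a * t)" for t
      using immersed_curvesD(2)[OF g[of k]] a by (simp add: periodic_def distrib_left)
    then show ?thesis
      unfolding smooth_loops_def \<eta>_def[abs_def]
      using smooth_compose[OF immersed_curvesD(1)[OF g[of k]], of "\<lambda>t. a * t"] smooth_mult[OF smooth_const smooth_id, of a]
      by (simp add: periodic_def)
  qed
  have \<eta>_lip: "norm (\<eta> k x - \<eta> k y) \<le> \<Lambda> k / L * \<bar>x - y\<bar>" for k x y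
  proof -
    have *: "norm (\<eta> k x - \<eta> k y) \<le> \<Lambda> k / L * \<bar>x - y\<bar>" if "y \<le> x" for x y
    proof -
      have "norm (g k (a * x) - g k (a * y)) \<le> r k * (a * x - a * y)"
        using that a(1) by (intro constant_speed_chord[OF g sp] mult_left_mono) simp_all
      also have "\<dots> = \<Lambda> k / L * \<bar>x - y\<bar>"
        using that L_pos by (simp add: r_def a_def field_simps)
      finally show ?thesis by (simp add: \<eta>_def)
    qed
    show ?thesis using *[of x y] *[of y x] by (cases "y \<le> x") (simp_all add: norm_minus_commute abs_minus_commute)
  qed
  have near: "eventually (\<lambda>k. \<Lambda> k \<le> 2 * L) sequentially"
    using order_tendstoD(2)[OF \<Lambda>lim, of "2 * L"] L_pos by (auto elim: eventually_mono)
  have pointwise: "(\<lambda>k. \<eta> k t) \<longlonglongrightarrow> \<gamma>0 t" if t: "t \<in> {0..L}" for t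
  proof -
    obtain u where u: "u \<in> {0..2*pi}" "ar 0 u = t" by (rule ar_surj[OF t])
    have "(\<lambda>k. \<eta> k t - c u) \<longlonglongrightarrow> 0"
    proof (rule tendsto_norm_zero_cancel, rule tendsto_sandwich[of "\<lambda>_. 0"])
      have "norm (\<eta> k t - c u) \<le> \<bar>\<Lambda> k / L * t - s k u\<bar> + norm (c u - e k u)" for k
      proof -
        have "e k u = \<eta> k (\<sigma> k u / a)" using a by (simp add: \<eta>_def eg)
        then have "norm (\<eta> k t - e k u) \<le> \<Lambda> k / L * \<bar>t - \<sigma> k u / a\<bar>" using \<eta>_lip by simp
        also have "\<dots> = \<bar>\<Lambda> k / L * (t - \<sigma> k u / a)\<bar>" using \<Lambda>[of k] L_pos by (simp add: abs_mult)
        also have "\<Lambda> k / L * (t - \<sigma> k u / a) = \<Lambda> k / L * t - s k u"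
          using L_pos by (simp add: s_def r_def a_def right_diff_distrib)
        finally show ?thesis
          using norm_triangle_ineq4[of "\<eta> k t - e k u" "c u - e k u"] by simp
      qed
      then show "eventually (\<lambda>k. norm (\<eta> k t - c u) \<le> \<bar>\<Lambda> k / L * t - s k u\<bar> + norm (c u - e k u)) sequentially"
        by (intro always_eventually) simp
      have "(\<lambda>k. norm (c u - e k u)) \<longlonglongrightarrow> 0"
      proof (rule tendstoI)
        fix \<epsilon> :: real assume "\<epsilon> > 0"
        then have "eventually (\<lambda>k. \<forall>u. norm (c u - e k u) \<le> \<epsilon> / 2) sequentially" by (intro conv) simp
        then show "eventually (\<lambda>k. dist (norm (c u - e k u)) 0 < \<epsilon>) sequentially"
        proof eventually_elim
          case (elim k)
          have "norm (c u - e k u) \<le> \<epsilon> / 2" using elim by blast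
          then show ?case using \<open>\<epsilon> > 0\<close> by simp
        qed
      qed
      moreover have "(\<lambda>k. \<bar>\<Lambda> k / L * t - s k u\<bar>) \<longlonglongrightarrow> \<bar>L / L * t - ar 0 u\<bar>"
        using L_pos by (intro tendsto_intros \<Lambda>lim lim u) simp
      ultimately show "(\<lambda>k. \<bar>\<Lambda> k / L * t - s k u\<bar> + norm (c u - e k u)) \<longlonglongrightarrow> 0"
        using tendsto_add[of "\<lambda>k. \<bar>\<Lambda> k / L * t - s k u\<bar>" "\<bar>L / L * t - ar 0 u\<bar>" sequentially "\<lambda>k. norm (c u - e k u)" 0]
          u L_pos by simp
    qed simp_all
    then show ?thesis using \<gamma>0_ar[OF u(1)] u(2) by (simp add: LIM_zero_iff)
  qed
  have uniform: "eventually (\<lambda>k. \<forall>t. norm (\<eta> k t - \<gamma> t) \<le> \<epsilon>) sequentially" if \<epsilon>: "\<epsilon> > 0" for \<epsilon>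
  proof -
    have "eventually (\<lambda>k. \<forall>x\<in>{0..L}. norm (\<eta> k x - \<gamma>0 x) \<le> \<epsilon>) sequentially"
    proof (rule uniform_of_pointwise_lipschitz[OF L_pos _ \<gamma>0_lipschitz pointwise \<epsilon>])
      show "eventually (\<lambda>k. \<forall>x\<in>{0..L}. \<forall>y\<in>{0..L}. norm (\<eta> k x - \<eta> k y) \<le> 2 * \<bar>x - y\<bar>) sequentially"
        using near
      proof eventually_elim
        case (elim k)
        then have "\<Lambda> k / L \<le> 2" using L_pos by (simp add: pos_divide_le_eq)
        then show ?case using order_trans[OF \<eta>_lip mult_right_mono] abs_ge_zero by blast
      qed
    qed
    then show ?thesis
    proof eventually_elim
      case (elim k)
      show ?case
      proof
        fix t
        have "\<eta> k t = \<eta> k (t - L * of_int \<lfloor>t / L\<rfloor>)"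
          using periodic_int[of L "\<eta> k" "t - L * of_int \<lfloor>t / L\<rfloor>" "\<lfloor>t / L\<rfloor>"] \<eta>_loop[of k]
          by (simp add: smooth_loops_def)
        then show "norm (\<eta> k t - \<gamma> t) \<le> \<epsilon>"
          using elim periodic_reduce[OF L_pos, of t] by (simp add: \<gamma>_def)
      qed
    qed
  qed
  have bend: "bending L (\<eta> k) = (\<Lambda> k / L) ^ 3 * energy (g k)" for k
  proof -
    have "bending L (\<eta> k) = a ^ 3 * bending (2 * pi) (g k)"
      using bending_scale[OF a(1) immersed_curvesD(1)[OF g[of k]], of L] L_pos a(2) by (simp add: \<eta>_def[abs_def])
    also have "bending (2 * pi) (g k) = r k ^ 3 * energy (g k)"
      using energy_constant_speed[OF g sp, of k] r[of k] by (simp add: bending_def)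
    also have "a ^ 3 * (r k ^ 3 * energy (g k)) = (\<Lambda> k / L) ^ 3 * energy (g k)"
      by (simp add: a_def r_def power_mult_distrib[symmetric] mult.assoc[symmetric])
    finally show ?thesis .
  qed
  obtain \<kappa> where \<kappa>: "weak_second_derivative L \<gamma> \<kappa>"
    "(\<integral>\<^sup>+ s\<in>{0..L}. ennreal ((norm (\<kappa> s))\<^sup>2) \<partial>lebesgue) < \<infinity>"
  proof (rule weak_second_derivative_exists[OF L_pos \<gamma>_continuous])
    fix \<epsilon> :: real assume "\<epsilon> > 0"
    obtain k where k: "\<forall>t. norm (\<eta> k t - \<gamma> t) \<le> \<epsilon>" "\<Lambda> k \<le> 2 * L"
      using eventually_happens[OF eventually_conj[OF uniform[OF \<open>\<epsilon> > 0\<close>] near]] by (auto simp: trivial_limit_sequentially)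
    have "\<Lambda> k / L \<le> 2" using k(2) L_pos by (simp add: pos_divide_le_eq)
    then have "(\<Lambda> k / L) ^ 3 \<le> 2 ^ 3" using \<Lambda>[of k] L_pos by (intro power_mono) simp_all
    then have "bending L (\<eta> k) \<le> 2 ^ 3 * B"
      unfolding bend using Eg energy_nonneg[OF g] by (intro mult_mono) simp_all
    then show "\<exists>\<eta>\<in>smooth_loops L. (\<forall>t. norm (\<eta> t - \<gamma> t) \<le> \<epsilon>) \<and> bending L \<eta> \<le> 2 ^ 3 * B"
      using k(1) \<eta>_loop by blast
  qed
  then show ?thesis
    using \<gamma>_arc_parametrization unfolding weak_curvature_def weak_energy_def total_length by blast
qed

end

lemma frechet_distE:
  assumes "\<epsilon> > 0"
  obtains \<phi> where "\<phi> \<in> diff_circle" "(SUP u. ennreal (norm (c1 (\<phi> u) - c0 u))) \<le> frechet_dist c0 c1 + ennreal \<epsilon>"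
proof (cases "frechet_dist c0 c1 = \<infinity>")
  case True
  then show ?thesis using that[OF diff_circle_id] by simp
next
  case False
  then have "frechet_dist c0 c1 < frechet_dist c0 c1 + ennreal \<epsilon>"
    using assms ennreal_add_left_cancel_less[of "frechet_dist c0 c1" 0 "ennreal \<epsilon>"] by (simp add: less_top)
  then obtain \<phi> where "\<phi> \<in> diff_circle" "(SUP u. ennreal (norm (c1 (\<phi> u) - c0 u))) < frechet_dist c0 c1 + ennreal \<epsilon>"
    unfolding frechet_dist_def INF_less_iff by blast
  then show ?thesis using that[of \<phi>] by simp
qed

text \<open>The energy bound on balls needs a lower bound on the lengths, which comes from two distinct points of the
  limit. Diffeomorphisms that nearly attain the Frechet distance are absorbed in the approximating curves, as
  they change neither length nor energy.\<close>

lemma (in rectifiable_loop) weak_curvature_of_Cauchy_limit: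
  fixes cs :: "nat \<Rightarrow> real \<Rightarrow> 'a"
  assumes lam: "lam > 0" and cs: "\<And>k. cs k \<in> immersed_curves" and Cauchy: "H2_Cauchy lam cs"
    and lim: "(\<lambda>k. frechet_dist (cs k) c) \<longlonglongrightarrow> 0"
  shows "\<exists>\<kappa>. weak_curvature c \<kappa> \<and> weak_energy c \<kappa> < \<infinity>"
proof -
  have "\<exists>\<phi>. \<phi> \<in> diff_circle \<and> (SUP u. ennreal (norm (c (\<phi> u) - cs k u))) \<le> frechet_dist (cs k) c + ennreal (inverse (real (Suc k)))" for k
    by (rule frechet_distE[of "inverse (real (Suc k))" c "cs k"]) auto
  then obtain \<phi> where \<phi>: "\<And>k. \<phi> k \<in> diff_circle"
    and le: "\<And>k. (SUP u. ennreal (norm (c (\<phi> k u) - cs k u))) \<le> frechet_dist (cs k) c + ennreal (inverse (real (Suc k)))"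
    by metis
  define e where "e k = (\<lambda>u. cs k (inv (\<phi> k) u))" for k
  have e: "e k \<in> immersed_curves" "len (e k) = len (cs k)" "energy (e k) = energy (cs k)" for k
    unfolding e_def using cs diff_circle_inv(1)[OF \<phi>]
    by (simp_all add: immersed_reparam len_reparam energy_reparam)
  have conv: "eventually (\<lambda>k. \<forall>u. norm (c u - e k u) \<le> \<epsilon>) sequentially" if \<epsilon>: "\<epsilon> > 0" for \<epsilon>
  proof -
    have "(\<lambda>k. frechet_dist (cs k) c + ennreal (inverse (real (Suc k)))) \<longlonglongrightarrow> 0 + ennreal 0"
      by (intro tendsto_add lim tendsto_ennrealI LIMSEQ_inverse_real_of_nat)
    moreover have "0 + ennreal 0 < ennreal \<epsilon>" using \<epsilon> by (simp add: ennreal_less_zero_iff)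
    ultimately have "eventually (\<lambda>k. frechet_dist (cs k) c + ennreal (inverse (real (Suc k))) < ennreal \<epsilon>) sequentially"
      by (rule order_tendstoD(2))
    then show ?thesis
    proof eventually_elim
      case (elim k)
      show ?case
      proof
        fix u
        have "c u - e k u = c (\<phi> k (inv (\<phi> k) u)) - cs k (inv (\<phi> k) u)"
          using diff_circle_inv(2)[OF \<phi>] by (simp add: e_def)
        then have "ennreal (norm (c u - e k u)) \<le> (SUP u. ennreal (norm (c (\<phi> k u) - cs k u)))"
          by (simp only:) (rule SUP_upper, simp)
        also have "\<dots> < ennreal \<epsilon>" using le[of k] elim by (rule le_less_trans)
        finally show "norm (c u - e k u) \<le> \<epsilon>" by (simp add: ennreal_less_iff)
      qed
    qed
  qed
  obtain a b where ab: "a \<in> {0..2*pi}" "b \<in> {0..2*pi}" "a < b" "c a \<noteq> c b" by (rule two_points)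
  \<comment> \<open>Curves within \<open>r\<close> of \<open>c\<close> contain points at distance at least \<open>2 r\<close>.\<close>
  define r where "r = norm (c a - c b) / 4"
  have r: "r > 0" using ab by (simp add: r_def)
  have len_ge: "2 * r \<le> len (e k)" if k: "\<forall>u. norm (c u - e k u) \<le> r" for k
  proof -
    have "norm (c a - c b) \<le> norm (c a - e k a) + norm (e k a - e k b) + norm (c b - e k b)"
      using norm_triangle_ineq[of "c a - e k a" "e k a - e k b"] norm_triangle_ineq4[of "c a - e k b" "c b - e k b"] by simp
    also have "\<dots> \<le> r + norm (e k a - e k b) + r" using k by (intro add_mono) simp_all
    finally have 1: "2 * r \<le> norm (e k a - e k b)" by (simp add: r_def)
    obtain g \<sigma> where g: "g \<in> immersed_curves" "\<sigma> \<in> diff_circle" "e k = (\<lambda>u. g (\<sigma> u))"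
      "\<And>u. speed g u = len (e k) / (2 * pi)" "mono \<sigma>" "\<sigma> 0 = 0" "\<sigma> (2 * pi) = 2 * pi"
      using constant_speed_reparam[OF e(1)[of k]] by blast
    have mono: "\<sigma> x \<le> \<sigma> y" if "x \<le> y" for x y
      using g(5) that by (rule monoD)
    have "norm (e k b - e k a) \<le> len (e k) / (2 * pi) * (\<sigma> b - \<sigma> a)"
      using constant_speed_chord[OF g(1,4) mono[of a b]] ab(3) g(3) by simp
    also have "\<dots> \<le> len (e k) / (2 * pi) * (2 * pi)"
      using mono[of 0 a] mono[of b "2*pi"] g(6,7) ab smooth_speed(4)[OF e(1)[of k]] by (intro mult_left_mono) auto
    finally show ?thesis using 1 by (simp add: norm_minus_commute)
  qed
  obtain N1 where N1: "\<And>k. k \<ge> N1 \<Longrightarrow> \<forall>u. norm (c u - e k u) \<le> r"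
    using conv[OF r] unfolding eventually_sequentially by blast
  have "sqrt lam * r > 0" using lam r by simp
  then obtain N2 where N2: "\<And>i j. i \<ge> N2 \<Longrightarrow> j \<ge> N2 \<Longrightarrow> H2_dist lam (cs i) (cs j) < ennreal (sqrt lam * r)"
    using Cauchy unfolding H2_Cauchy_def by blast
  define N where "N = max N1 N2"
  define B where "B = (1 + energy (cs N)) * exp (energy_rate lam r * (sqrt lam * r))"
  have "energy (e (k + N)) \<le> B" for k
  proof -
    have "2 * r \<le> len (cs N)" using len_ge[OF N1[of N]] e(2)[of N] by (simp add: N_def)
    moreover have "N2 \<le> N" "N2 \<le> k + N" by (simp_all add: N_def le_max_iff_disj trans_le_add2)
    ultimately have "1 + energy (cs (k + N)) \<le> B"
      using H2_ball_bounds(3)[OF lam cs cs N2 r] unfolding B_def by blast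
    then show ?thesis using e(3)[of "k + N"] by simp
  qed
  then show ?thesis
  proof (rule weak_curvature_of_limit[where e="\<lambda>k. e (k + N)", rotated 1])
    show "e (k + N) \<in> immersed_curves" for k by (rule e(1))
    show "eventually (\<lambda>k. \<forall>u. norm (c u - e (k + N) u) \<le> \<epsilon>) sequentially" if "\<epsilon> > 0" for \<epsilon>
      by (rule sequentially_offset[OF conv[OF that]])
  qed
qed

section \<open>Mollification of periodic functions\<close>

definition mollify :: "real \<Rightarrow> (real \<Rightarrow> real) \<Rightarrow> (real \<Rightarrow> 'a::euclidean_space) \<Rightarrow> real \<Rightarrow> 'a" where
  "mollify p \<rho> f t = integral {0..p} (\<lambda>s. \<rho> (t - s) *\<^sub>R f s)"

lemma mollify_has_vd:
  fixes f :: "real \<Rightarrow> 'a::euclidean_space"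
  assumes \<rho>: "smooth \<rho>" and f: "continuous_on UNIV f"
  shows "(mollify p \<rho> f has_vector_derivative mollify p (vd \<rho>) f t) (at t)"
proof -
  have sub: "((\<lambda>t. \<rho> (t - s)) has_vector_derivative vd \<rho> (t - s)) (at t)" for s t
  proof -
    have "((\<lambda>t. t - s) has_vector_derivative 1) (at t)" by (auto intro!: derivative_eq_intros)
    from vector_diff_chain_at[OF this smooth_has_vd[OF \<rho>]] show ?thesis by (simp add: o_def)
  qed
  have c\<rho>: "continuous_on A (\<lambda>x. g (fst x - snd x))" if "smooth g" for A and g :: "real \<Rightarrow> real"
    by (rule continuous_on_compose2[OF smooth_continuous[OF that, of UNIV]]) (auto intro!: continuous_intros)
  have cf: "continuous_on A (\<lambda>x. f (snd x))" for A :: "(real \<times> real) set"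
    by (rule continuous_on_compose2[OF f]) (auto intro!: continuous_intros)
  have "((\<lambda>t. integral (cbox 0 p) (\<lambda>s. \<rho> (t - s) *\<^sub>R f s)) has_vector_derivative
      integral (cbox 0 p) (\<lambda>s. vd \<rho> (t - s) *\<^sub>R f s)) (at t within UNIV)"
  proof (rule leibniz_rule_vector_derivative)
    show "((\<lambda>t. \<rho> (t - s) *\<^sub>R f s) has_vector_derivative vd \<rho> (t - s) *\<^sub>R f s) (at t within UNIV)" for t s
      using bounded_bilinear.has_vector_derivative[OF bounded_bilinear_scaleR sub has_vector_derivative_const] by simp
    show "(\<lambda>s. \<rho> (t - s) *\<^sub>R f s) integrable_on cbox 0 p" for t
      unfolding cbox_interval
      by (intro integrable_continuous_real continuous_intros continuous_on_compose2[OF smooth_continuous[OF \<rho>, of UNIV]]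
          continuous_on_subset[OF f]) auto
    show "continuous_on (UNIV \<times> cbox 0 p) (\<lambda>(t, s). vd \<rho> (t - s) *\<^sub>R f s)"
      unfolding case_prod_beta by (intro continuous_on_scaleR c\<rho> smooth_vd \<rho> cf)
  qed auto
  then show ?thesis by (simp add: mollify_def[abs_def])
qed

lemma smooth_mollify:
  fixes f :: "real \<Rightarrow> 'a::euclidean_space"
  assumes \<rho>: "smooth \<rho>" and f: "continuous_on UNIV f"
  shows "smooth (mollify p \<rho> f)"
proof (rule smooth_on_closed_family[of "{mollify p \<rho> f |\<rho>. smooth \<rho>}"])
  fix h assume "h \<in> {mollify p \<rho> f |\<rho>. smooth \<rho>}"
  then obtain \<rho> where h: "h = mollify p \<rho> f" "smooth \<rho>" by blast
  show "\<exists>h'\<in>{mollify p \<rho> f |\<rho>. smooth \<rho>}. \<forall>x. (h has_vector_derivative h' x) (at x)"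
    using mollify_has_vd[OF h(2) f, of p] smooth_vd[OF h(2)] unfolding h(1) by blast
qed (use \<rho> in blast)

lemma periodic_mollify: "periodic p \<rho> \<Longrightarrow> periodic p (mollify p \<rho> f)"
proof -
  assume "periodic p \<rho>"
  then have "\<rho> (t + p - s) = \<rho> (t - s)" for t s
    unfolding periodic_def by (metis add_diff_eq add.commute diff_add_eq)
  then show ?thesis by (simp add: mollify_def periodic_def)
qed

text \<open>Both sides integrate the same periodic function, over the periods \<open>{0..p}\<close> and \<open>{t - p..t}\<close>.\<close>

lemma mollify_commute:
  fixes f :: "real \<Rightarrow> 'a::euclidean_space"
  assumes \<rho>: "continuous_on UNIV \<rho>" "periodic p \<rho>" and f: "continuous_on UNIV f" "periodic p f" and p: "p \<ge> 0"
  shows "mollify p \<rho> f t = integral {0..p} (\<lambda>s. \<rho> s *\<^sub>R f (t - s))"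
proof -
  define F where "F s = \<rho> (t - s) *\<^sub>R f s" for s
  have F: "continuous_on UNIV F"
    unfolding F_def[abs_def] by (intro continuous_intros continuous_on_compose2[OF \<rho>(1)] f) auto
  have per: "periodic p F"
  proof -
    have "\<rho> (t - (s + p)) = \<rho> (t - s)" for s
      using \<rho>(2)[unfolded periodic_def, rule_format, of "t - (s + p)"] by simp
    then show ?thesis using f(2) by (simp add: periodic_def F_def)
  qed
  obtain G where G: "\<And>x. (G has_vector_derivative F x) (at x)" using antiderivative_UNIV[OF F] by blast
  have G': "((\<lambda>s. - G (t - s)) has_vector_derivative F (t - s)) (at s)" for s
  proof -
    have "((\<lambda>s. t - s) has_vector_derivative -1) (at s)" by (auto intro!: derivative_eq_intros)
    from has_vector_derivative_minus[OF vector_diff_chain_at[OF this G]] show ?thesis by (simp add: o_def)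
  qed
  have "mollify p \<rho> f t = G p - G 0"
    unfolding mollify_def F_def[symmetric] by (rule integral_antiderivative[OF G p])
  also have "\<dots> = G t - G (t - p)" using antiderivative_periodic[OF G per, of "t - p"] by simp
  also have "\<dots> = integral {0..p} (\<lambda>s. F (t - s))" using integral_antiderivative[OF G' p] by simp
  finally show ?thesis by (simp add: F_def)
qed

lemma periodic_modulus:
  fixes f :: "real \<Rightarrow> 'a::euclidean_space"
  assumes p: "p > 0" and f: "continuous_on UNIV f" "periodic p f" and \<epsilon>: "\<epsilon> > 0"
  shows "\<exists>\<delta>>0. \<forall>x y. \<bar>x - y\<bar> < \<delta> \<longrightarrow> norm (f x - f y) \<le> \<epsilon>"
proof -
  have "uniformly_continuous_on {-p..2*p} f"
    by (intro compact_uniformly_continuous continuous_on_subset[OF f(1)]) auto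
  then obtain d where d: "d > 0" "\<And>x y. x \<in> {-p..2*p} \<Longrightarrow> y \<in> {-p..2*p} \<Longrightarrow> dist y x < d \<Longrightarrow> dist (f y) (f x) < \<epsilon>"
    using \<epsilon> unfolding uniformly_continuous_on_def by metis
  show ?thesis
  proof (intro exI[of _ "min d p"] conjI allI impI)
    show "min d p > 0" using d p by simp
    fix x y assume xy: "\<bar>x - y\<bar> < min d p"
    define n where "n = \<lfloor>x / p\<rfloor>"
    have x: "x - p * of_int n \<in> {0..<p}" unfolding n_def by (rule periodic_reduce[OF p])
    then have "y - p * of_int n \<in> {-p..2*p}" using xy by auto
    then have "dist (f (x - p * of_int n)) (f (y - p * of_int n)) < \<epsilon>"
      using x xy p by (intro d(2)) (auto simp: dist_real_def)
    moreover have "f (x - p * of_int n) = f x" "f (y - p * of_int n) = f y"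
      using periodic_int[OF f(2), of "x - p * of_int n" n] periodic_int[OF f(2), of "y - p * of_int n" n] by simp_all
    ultimately show "norm (f x - f y) \<le> \<epsilon>" by (simp add: dist_norm)
  qed
qed

text \<open>Away from the period lattice \<open>1 - cos\<close> is bounded below, which lets the moment in the next definition
  measure the mass there.\<close>

lemma cos_gap:
  assumes p: "p > 0" and \<delta>: "0 < \<delta>" "\<delta> \<le> p / 2" and s: "\<delta> \<le> s" "s \<le> p - \<delta>"
  shows "1 - cos (2 * pi / p * s) \<ge> 1 - cos (2 * pi / p * \<delta>)"
proof -
  define a where "a = 2 * pi / p"
  have a: "a > 0" "a * p = 2 * pi" using p by (simp_all add: a_def)
  have "a * \<delta> \<le> a * (p / 2)" using a \<delta> by (intro mult_left_mono) auto
  then have d: "0 \<le> a * \<delta>" "a * \<delta> \<le> pi" using a \<delta> by simp_all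
  have "cos (a * s) \<le> cos (a * \<delta>)"
  proof (cases "a * s \<le> pi")
    case True
    then show ?thesis using a s d by (intro cos_monotone_0_pi_le) auto
  next
    case False
    have "cos (a * s) = cos (2 * pi - a * s)" by simp
    also have "\<dots> = cos (a * (p - s))" using a by (simp add: right_diff_distrib)
    also have "\<dots> \<le> cos (a * \<delta>)"
    proof (rule cos_monotone_0_pi_le)
      show "a * \<delta> \<le> a * (p - s)" using a s by (intro mult_left_mono) auto
      show "a * (p - s) \<le> pi" using False a by (simp add: right_diff_distrib)
    qed (use d in auto)
    finally show ?thesis .
  qed
  then show ?thesis by (simp add: a_def)
qed

text \<open>A smooth periodic probability density whose mass is concentrated near \<open>p\<int>\<close>. Concentration is
  measured by the first Fourier coefficient, because it can be computed exactly for powers of \<open>1 + cos\<close>.\<close>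

definition kernel :: "real \<Rightarrow> real \<Rightarrow> (real \<Rightarrow> real) \<Rightarrow> bool" where
  "kernel p \<epsilon> \<rho> \<longleftrightarrow> smooth \<rho> \<and> periodic p \<rho> \<and> (\<forall>t. \<rho> t \<ge> 0) \<and> integral {0..p} \<rho> = 1
     \<and> integral {0..p} (\<lambda>t. (1 - cos (2 * pi / p * t)) * \<rho> t) \<le> \<epsilon>"

text \<open>For \<open>s\<close> near \<open>p\<int>\<close> the difference \<open>f (t - s) - f t\<close> is small, elsewhere it is bounded by a multiple of
  \<open>1 - cos\<close>, which the kernel integrates to something small.\<close>

lemma mollify_close:
  fixes f :: "real \<Rightarrow> 'a::euclidean_space"
  assumes p: "p > 0" and f: "continuous_on UNIV f" "periodic p f" and \<epsilon>: "\<epsilon> > 0"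
  shows "\<exists>\<delta>>0. \<forall>\<rho>. kernel p \<delta> \<rho> \<longrightarrow> (\<forall>t. norm (mollify p \<rho> f t - f t) \<le> \<epsilon>)"
proof -
  obtain d where d: "d > 0" "\<And>x y. \<bar>x - y\<bar> < d \<Longrightarrow> norm (f x - f y) \<le> \<epsilon> / 2"
    using periodic_modulus[OF p f, of "\<epsilon> / 2"] \<epsilon> by auto
  define d' where "d' = min d (p / 2)"
  have d': "0 < d'" "d' \<le> p / 2" "d' \<le> d" using d p by (auto simp: d'_def)
  define \<mu> where "\<mu> = 1 - cos (2 * pi / p * d')"
  have \<mu>: "\<mu> > 0"
  proof -
    have "2 * pi / p * d' \<le> 2 * pi / p * (p / 2)" using p d' by (intro mult_left_mono) auto
    then have "2 * pi / p * d' \<le> pi" using p by simp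
    then have "cos (2 * pi / p * d') < cos 0" using p d' by (intro cos_monotone_0_pi) auto
    then show ?thesis by (simp add: \<mu>_def)
  qed
  obtain M where M: "norm (f x) \<le> M" for x using periodic_bounded[OF p f] by blast
  have M0: "M \<ge> 0" using M[of 0] norm_ge_zero order_trans by blast
  define K where "K = 2 * M / \<mu>"
  have K0: "K \<ge> 0" using M0 \<mu> by (simp add: K_def)
  have est: "norm (f (t - s) - f t) \<le> \<epsilon> / 2 + K * (1 - cos (2 * pi / p * s))" if s: "s \<in> {0..p}" for s t
  proof -
    have nn: "K * (1 - cos (2 * pi / p * s)) \<ge> 0" using K0 by simp
    consider "s < d'" | "s > p - d'" | "d' \<le> s" "s \<le> p - d'" by linarith
    then show ?thesis
    proof cases
      case 1
      then have "norm (f (t - s) - f t) \<le> \<epsilon> / 2" using s d' by (intro d(2)) auto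
      then show ?thesis using nn by simp
    next
      case 2
      have "f (t - s) = f (t - s + p)" using f(2) by (simp add: periodic_def)
      moreover have "norm (f (t - s + p) - f t) \<le> \<epsilon> / 2" using s 2 d' by (intro d(2)) auto
      ultimately show ?thesis using nn by simp
    next
      case 3
      have "norm (f (t - s) - f t) \<le> 2 * M" using norm_triangle_ineq4[of "f (t - s)" "f t"] M[of "t - s"] M[of t] by simp
      also have "\<dots> = K * \<mu>" using \<mu> by (simp add: K_def)
      also have "\<dots> \<le> K * (1 - cos (2 * pi / p * s))"
        using cos_gap[OF p d'(1,2) 3] K0 unfolding \<mu>_def by (intro mult_left_mono) auto
      finally show ?thesis using \<epsilon> by simp
    qed
  qed
  show ?thesis
  proof (intro exI[of _ "\<epsilon> / (2 * (K + 1))"] conjI allI impI)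
    show "\<epsilon> / (2 * (K + 1)) > 0" using \<epsilon> K0 by simp
    fix \<rho> t assume "kernel p (\<epsilon> / (2 * (K + 1))) \<rho>"
    then have \<rho>: "smooth \<rho>" "periodic p \<rho>" "\<And>t. \<rho> t \<ge> 0" "integral {0..p} \<rho> = 1"
      "integral {0..p} (\<lambda>t. (1 - cos (2 * pi / p * t)) * \<rho> t) \<le> \<epsilon> / (2 * (K + 1))"
      by (auto simp: kernel_def)
    have c\<rho>: "continuous_on A \<rho>" for A by (rule smooth_continuous[OF \<rho>(1)])
    have cf: "continuous_on A (\<lambda>s. f (t - s))" for A
      by (rule continuous_on_compose2[OF f(1)]) (auto intro!: continuous_intros)
    have "f t = integral {0..p} (\<lambda>s. \<rho> s *\<^sub>R f t)"
    proof -
      have "(\<rho> has_integral 1) {0..p}"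
        using integrable_integral[OF integrable_continuous_real[OF c\<rho>], of 0 p] \<rho>(4) by simp
      from has_integral_scaleR_left[OF this, of "f t"] show ?thesis by (simp add: integral_unique)
    qed
    then have "mollify p \<rho> f t - f t = integral {0..p} (\<lambda>s. \<rho> s *\<^sub>R f (t - s)) - integral {0..p} (\<lambda>s. \<rho> s *\<^sub>R f t)"
      using mollify_commute[OF c\<rho> \<rho>(2) f, of t] p by simp
    also have "\<dots> = integral {0..p} (\<lambda>s. \<rho> s *\<^sub>R (f (t - s) - f t))"
      unfolding scaleR_diff_right
      by (intro integral_diff[symmetric] integrable_continuous_real continuous_intros c\<rho> cf)
    finally have "norm (mollify p \<rho> f t - f t) = norm (integral {0..p} (\<lambda>s. \<rho> s *\<^sub>R (f (t - s) - f t)))" by simp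
    also have "\<dots> \<le> integral {0..p} (\<lambda>s. \<epsilon> / 2 * \<rho> s + K * ((1 - cos (2 * pi / p * s)) * \<rho> s))"
    proof (rule integral_norm_bound_integral)
      show "norm (\<rho> s *\<^sub>R (f (t - s) - f t)) \<le> \<epsilon> / 2 * \<rho> s + K * ((1 - cos (2 * pi / p * s)) * \<rho> s)" if "s \<in> {0..p}" for s
      proof -
        have "norm (\<rho> s *\<^sub>R (f (t - s) - f t)) = \<rho> s * norm (f (t - s) - f t)" using \<rho>(3)[of s] by simp
        also have "\<dots> \<le> \<rho> s * (\<epsilon> / 2 + K * (1 - cos (2 * pi / p * s)))"
          by (rule mult_left_mono[OF est[OF that] \<rho>(3)])
        finally show ?thesis by (simp add: algebra_simps)
      qed
    qed (intro integrable_continuous_real continuous_intros c\<rho> cf)+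
    also have "\<dots> = \<epsilon> / 2 + K * integral {0..p} (\<lambda>t. (1 - cos (2 * pi / p * t)) * \<rho> t)"
    proof -
      have "(\<lambda>s. \<epsilon> / 2 * \<rho> s) integrable_on {0..p}" "(\<lambda>s. K * ((1 - cos (2 * pi / p * s)) * \<rho> s)) integrable_on {0..p}"
        by (intro integrable_continuous_real continuous_intros c\<rho>)+
      from integral_add[OF this] show ?thesis using \<rho>(4) by simp
    qed
    also have "\<dots> \<le> \<epsilon> / 2 + K * (\<epsilon> / (2 * (K + 1)))" using \<rho>(5) K0 by (intro add_left_mono mult_left_mono)
    also have "\<dots> \<le> \<epsilon> / 2 + (K + 1) * (\<epsilon> / (2 * (K + 1)))" using \<epsilon> K0 by (intro add_left_mono mult_right_mono) auto
    also have "\<dots> = \<epsilon>"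
    proof -
      have "K + 1 \<noteq> 0" using K0 by simp
      then show ?thesis by (simp add: field_simps)
    qed
    finally show "norm (mollify p \<rho> f t - f t) \<le> \<epsilon>" .
  qed
qed

text \<open>The kernels are the normalized powers \<open>w\<^sup>j\<close> of \<open>w = (1 + cos) / 2\<close>. Their integrals satisfy Wallis'
  recursion, which is the vanishing of the integral of the derivative of \<open>sin \<cdot> w\<^sup>j\<close>.\<close>

lemma kernel_exists:
  assumes p: "p > 0" and \<epsilon>: "\<epsilon> > 0"
  shows "\<exists>\<rho>. kernel p \<epsilon> \<rho>"
proof -
  define a where "a = 2 * pi / p"
  have a: "a > 0" "a * p = 2 * pi" using p by (simp_all add: a_def)
  define w where "w t = (1 + cos (a * t)) / 2" for t
  have sw: "smooth w"
  proof -
    have "smooth (\<lambda>t. (1/2) * (1 + cos (a * t)))"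
      by (intro smooth_mult smooth_add smooth_const smooth_compose[OF smooth_cos] smooth_id)
    moreover have "(\<lambda>t. (1/2) * (1 + cos (a * t))) = w" by (simp add: w_def fun_eq_iff)
    ultimately show ?thesis by simp
  qed
  have swj: "smooth (\<lambda>t. w t ^ j)" for j by (rule smooth_power[OF sw])
  have cw: "continuous_on A (\<lambda>t. w t ^ j)" for j A by (rule smooth_continuous[OF swj])
  have "0 \<le> 1 + cos x" for x :: real using cos_ge_minus_one[of x] by linarith
  then have w0: "w t \<ge> 0" for t by (simp add: w_def)
  define I where "I j = integral {0..p} (\<lambda>t. w t ^ j)" for j
  have Ipos: "I j > 0" for j
  proof (rule ccontr)
    assume "\<not> I j > 0"
    moreover have "I j \<ge> 0" unfolding I_def by (intro integral_nonneg integrable_continuous_real cw) (simp add: w0)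
    ultimately have "I j = 0" by simp
    then have "\<forall>t\<in>{0..p}. w t ^ j = 0"
      unfolding I_def using integral_eq_0_iff[of 0 p "\<lambda>t. w t ^ j"] cw p w0 by simp
    then have "w 0 ^ j = 0" by (rule bspec) (use p in simp)
    moreover have "w 0 = 1" by (simp add: w_def)
    ultimately show False by simp
  qed
  have rec: "(2 * real j + 2) * I (Suc j) = (2 * real j + 1) * I j" for j
  proof -
    define F where "F t = sin (a * t) * w t ^ j" for t
    have dF: "(F has_vector_derivative a * ((2 * real j + 2) * w t ^ Suc j - (2 * real j + 1) * w t ^ j)) (at t)" for t
    proof -
      have dw: "(w has_real_derivative - (a * sin (a * t)) / 2) (at t)"
        unfolding w_def[abs_def] by (auto intro!: derivative_eq_intros)
      have "(F has_real_derivative a * cos (a * t) * w t ^ j + real j * w t ^ (j - 1) * (- (a * sin (a * t)) / 2) * sin (a * t)) (at t)"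
      proof -
        have "((\<lambda>t. sin (a * t)) has_real_derivative a * cos (a * t)) (at t)"
          by (auto intro!: derivative_eq_intros)
        from DERIV_mult[OF this DERIV_power[OF dw, of j]] show ?thesis
          unfolding F_def[abs_def] by (simp add: mult_ac)
      qed
      moreover have "a * cos (a * t) * w t ^ j + real j * w t ^ (j - 1) * (- (a * sin (a * t)) / 2) * sin (a * t)
        = a * ((2 * real j + 2) * w t ^ Suc j - (2 * real j + 1) * w t ^ j)"
      proof -
        have c: "cos (a * t) = 2 * w t - 1" by (simp add: w_def add_divide_distrib)
        have "sin (a * t) * sin (a * t) = 1 - cos (a * t) * cos (a * t)"
          using sin_squared_eq[of "a * t"] by (simp only: power2_eq_square)
        then have s: "sin (a * t) * sin (a * t) = 4 * w t * (1 - w t)"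
          unfolding c by (simp only:) (simp add: algebra_simps)
        have j: "real j * w t ^ (j - 1) * w t = real j * w t ^ j" by (cases j) simp_all
        have "real j * w t ^ (j - 1) * (- (a * sin (a * t)) / 2) * sin (a * t)
          = - (a / 2) * (real j * w t ^ (j - 1)) * (sin (a * t) * sin (a * t))" by simp
        also have "\<dots> = - 2 * a * (1 - w t) * (real j * w t ^ (j - 1) * w t)" unfolding s by simp
        also have "\<dots> = - 2 * a * (1 - w t) * (real j * w t ^ j)" unfolding j ..
        finally show ?thesis unfolding c by (simp add: algebra_simps)
      qed
      ultimately show ?thesis by (simp only: has_real_derivative_iff_has_vector_derivative)
    qed
    have "F p - F 0 = 0" using a by (simp add: F_def)
    then have "integral {0..p} (\<lambda>t. a * ((2 * real j + 2) * w t ^ Suc j - (2 * real j + 1) * w t ^ j)) = 0"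
      using integral_antiderivative[OF dF, of 0 p] p by simp
    moreover have "integral {0..p} (\<lambda>t. (2 * real j + 2) * w t ^ Suc j - (2 * real j + 1) * w t ^ j)
       = (2 * real j + 2) * I (Suc j) - (2 * real j + 1) * I j"
    proof -
      have "(\<lambda>t. (2 * real j + 2) * w t ^ Suc j) integrable_on {0..p}" "(\<lambda>t. (2 * real j + 1) * w t ^ j) integrable_on {0..p}"
        by (intro integrable_continuous_real continuous_intros cw)+
      from integral_diff[OF this] show ?thesis unfolding I_def integral_mult_right .
    qed
    ultimately show ?thesis using a by simp
  qed
  obtain j where j: "inverse (real (Suc j)) < \<epsilon>" using reals_Archimedean[OF \<epsilon>] by blast
  define \<rho> where "\<rho> t = inverse (I j) * w t ^ j" for t
  have "kernel p \<epsilon> \<rho>"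
    unfolding kernel_def
  proof (intro conjI allI)
    show "smooth \<rho>" unfolding \<rho>_def[abs_def] by (intro smooth_mult smooth_const swj)
    show "periodic p \<rho>"
      using a by (simp add: periodic_def \<rho>_def w_def distrib_left)
    show "\<rho> t \<ge> 0" for t using w0 Ipos[of j] by (simp add: \<rho>_def)
    show "integral {0..p} \<rho> = 1"
      unfolding \<rho>_def[abs_def] integral_mult_right I_def[symmetric] using Ipos[of j] by simp
    have "(1 - cos (2 * pi / p * t)) * \<rho> t = 2 * inverse (I j) * (w t ^ j - w t ^ Suc j)" for t
    proof -
      have c: "1 - cos (2 * pi / p * t) = 2 * (1 - w t)"
        by (simp add: w_def a_def add_divide_distrib diff_divide_distrib)
      show ?thesis unfolding c \<rho>_def by (simp add: algebra_simps)
    qed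
    then have "(\<lambda>t. (1 - cos (2 * pi / p * t)) * \<rho> t) = (\<lambda>t. 2 * inverse (I j) * (w t ^ j - w t ^ Suc j))"
      by (rule ext)
    then have "integral {0..p} (\<lambda>t. (1 - cos (2 * pi / p * t)) * \<rho> t) = 2 * inverse (I j) * (I j - I (Suc j))"
      using integral_diff[OF integrable_continuous_real[OF cw] integrable_continuous_real[OF cw], of 0 p j "Suc j"]
      unfolding I_def by (simp only: integral_mult_right)
    also have "\<dots> = inverse (real (Suc j))"
    proof -
      have Irec: "I (Suc j) = (2 * real j + 1) / (2 * real j + 2) * I j"
        using rec[of j] by (simp add: eq_divide_eq mult.commute)
      have "2 * inverse (I j) * (I j - I (Suc j)) = 2 * (1 - (2 * real j + 1) / (2 * real j + 2))"
      proof -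
        define q where "q = (2 * real j + 1) / (2 * real j + 2)"
        have "I (Suc j) = q * I j" using Irec by (simp only: q_def)
        then have "I j - I (Suc j) = I j * (1 - q)" by (simp add: algebra_simps)
        then have "2 * inverse (I j) * (I j - I (Suc j)) = 2 * (inverse (I j) * I j) * (1 - q)"
          by (simp only: mult.assoc)
        moreover have "inverse (I j) * I j = 1" using Ipos[of j] by simp
        ultimately show ?thesis unfolding q_def[symmetric] by simp
      qed
      also have "\<dots> = inverse (real (Suc j))"
      proof -
        have "2 * (1 - (2 * x + 1) / (2 * x + 2)) = inverse (1 + x)" if "x \<ge> 0" for x :: real
        proof -
          have "2 * x + 2 = 2 * (1 + x)" "1 + x \<noteq> 0" using that by simp_all
          then show ?thesis by (simp add: field_simps)
        qed
        then show ?thesis by simp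
      qed
      finally show ?thesis .
    qed
    finally show "integral {0..p} (\<lambda>t. (1 - cos (2 * pi / p * t)) * \<rho> t) \<le> \<epsilon>" using j by simp
  qed
  then show ?thesis by blast
qed

text \<open>Jensen's inequality for the probability density \<open>\<rho>(t - \<cdot>)\<close>, integrated over \<open>t\<close> with Tonelli's theorem. It is
  obtained from the nonnegative variance \<open>\<integral> \<rho>(t - s) \<bar>\<kappa>(s) - h(t)\<bar>\<^sup>2 ds\<close>.\<close>

lemma integral_mollify_square_le:
  fixes \<kappa> :: "real \<Rightarrow> 'a::euclidean_space"
  assumes p: "p > 0" and \<rho>: "kernel p \<epsilon> \<rho>" and \<kappa>: "\<kappa> absolutely_integrable_on {0..p}"
    and fin: "(\<integral>\<^sup>+ s\<in>{0..p}. ennreal ((norm (\<kappa> s))\<^sup>2) \<partial>lebesgue) < \<infinity>"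
    and h: "continuous_on {0..p} h" "\<And>t. h t = integral {0..p} (\<lambda>s. \<rho> (t - s) *\<^sub>R \<kappa> s)"
  shows "integral {0..p} (\<lambda>t. (norm (h t))\<^sup>2) \<le> enn2real (\<integral>\<^sup>+ s\<in>{0..p}. ennreal ((norm (\<kappa> s))\<^sup>2) \<partial>lebesgue)"
proof -
  let ?M = "lebesgue_on {0..p}"
  define Q where "Q = (\<integral>\<^sup>+ s. ennreal ((norm (\<kappa> s))\<^sup>2) \<partial>?M)"
  have Q_eq: "(\<integral>\<^sup>+ s\<in>{0..p}. ennreal ((norm (\<kappa> s))\<^sup>2) \<partial>lebesgue) = Q"
    by (simp add: Q_def nn_integral_restrict_space)
  have Qfin: "Q < \<infinity>" using fin by (simp add: Q_eq)
  have s\<rho>: "smooth \<rho>" "periodic p \<rho>" "\<And>t. \<rho> t \<ge> 0" "integral {0..p} \<rho> = 1" using \<rho> by (auto simp: kernel_def)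
  have i\<kappa>: "integrable ?M \<kappa>" by (rule absolutely_integrable_imp_integrable[OF \<kappa>]) simp
  have m\<kappa>: "\<kappa> \<in> borel_measurable ?M" by (rule borel_measurable_integrable[OF i\<kappa>])
  have i\<kappa>2: "integrable ?M (\<lambda>s. (norm (\<kappa> s))\<^sup>2)"
    using m\<kappa> Qfin by (intro integrableI_bounded) (simp_all add: Q_def)
  have c\<rho>: "continuous_on A (\<lambda>s. \<rho> (t - s))" for A t
    by (rule continuous_on_compose2[OF smooth_continuous[OF s\<rho>(1), of UNIV]]) (auto intro!: continuous_intros)
  have int: "integrable ?M g" if "continuous_on {0..p} g" for g :: "real \<Rightarrow> 'b::euclidean_space"
    by (rule absolutely_integrable_imp_integrable[OF absolutely_integrable_continuous_real[OF that]]) simp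
  have m\<rho>: "(\<lambda>s. \<rho> (t - s)) \<in> borel_measurable ?M" for t by (rule borel_measurable_integrable[OF int[OF c\<rho>]])
  have mult_int: "integrable ?M (\<lambda>s. \<rho> (t - s) *\<^sub>R g s)" if g: "integrable ?M g" for g :: "real \<Rightarrow> 'b::euclidean_space" and t
  proof -
    obtain K where K: "\<forall>s\<in>{0..p}. norm (\<rho> (t - s)) \<le> K"
      using compact_imp_bounded[OF compact_continuous_image[OF c\<rho>[of "{0..p}" t]]] unfolding bounded_iff by auto
    show ?thesis
    proof (rule Bochner_Integration.integrable_bound)
      show "integrable ?M (\<lambda>s. K * norm (g s))" using g by simp
      show "(\<lambda>s. \<rho> (t - s) *\<^sub>R g s) \<in> borel_measurable ?M"
        by (intro borel_measurable_scaleR m\<rho> borel_measurable_integrable g)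
      show "AE s in ?M. norm (\<rho> (t - s) *\<^sub>R g s) \<le> norm (K * norm (g s))"
      proof (rule AE_I2)
        fix s assume "s \<in> space ?M"
        then have "s \<in> {0..p}" by simp
        then have "norm (\<rho> (t - s)) \<le> K" using K by blast
        then have "\<bar>\<rho> (t - s)\<bar> * norm (g s) \<le> K * norm (g s)" by (intro mult_right_mono) simp_all
        also have "\<dots> \<le> \<bar>K * norm (g s)\<bar>" by (rule abs_ge_self)
        finally show "norm (\<rho> (t - s) *\<^sub>R g s) \<le> norm (K * norm (g s))" by simp
      qed
    qed
  qed
  have mass: "(\<integral>s. \<rho> (t - s) \<partial>?M) = 1" for t
  proof -
    have "(\<integral>s. \<rho> (t - s) \<partial>?M) = mollify p \<rho> (\<lambda>s. 1::real) t"
      using lebesgue_integral_eq_integral[OF int[OF c\<rho>], of t] by (simp add: mollify_def)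
    also have "\<dots> = 1"
      using mollify_commute[OF smooth_continuous[OF s\<rho>(1)] s\<rho>(2), of "\<lambda>s. 1::real" t] p s\<rho>(4)
      by (simp add: periodic_def)
    finally show ?thesis .
  qed
  have jensen: "(norm (h t))\<^sup>2 \<le> (\<integral>s. \<rho> (t - s) * (norm (\<kappa> s))\<^sup>2 \<partial>?M)" for t
  proof -
    define a where "a = h t"
    have i1: "integrable ?M (\<lambda>s. \<rho> (t - s) *\<^sub>R \<kappa> s)" by (rule mult_int[OF i\<kappa>])
    have i2: "integrable ?M (\<lambda>s. \<rho> (t - s) * (norm (\<kappa> s))\<^sup>2)" using mult_int[OF i\<kappa>2] by simp
    have i3: "integrable ?M (\<lambda>s. \<rho> (t - s))" by (rule int[OF c\<rho>])
    have a: "(\<integral>s. \<rho> (t - s) *\<^sub>R \<kappa> s \<partial>?M) = a"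
      using lebesgue_integral_eq_integral[OF i1] h(2)[of t] by (simp add: a_def)
    have "0 \<le> (\<integral>s. \<rho> (t - s) * (norm (\<kappa> s - a))\<^sup>2 \<partial>?M)"
      by (intro integral_nonneg_AE AE_I2) (simp add: s\<rho>(3))
    also have "(\<lambda>s. \<rho> (t - s) * (norm (\<kappa> s - a))\<^sup>2)
      = (\<lambda>s. \<rho> (t - s) * (norm (\<kappa> s))\<^sup>2 - 2 * (a \<bullet> (\<rho> (t - s) *\<^sub>R \<kappa> s)) + (norm a)\<^sup>2 * \<rho> (t - s))"
      by (simp add: fun_eq_iff power2_norm_eq_inner inner_diff_left inner_diff_right inner_commute algebra_simps)
    also have "(\<integral>s. \<dots> s \<partial>?M) = (\<integral>s. \<rho> (t - s) * (norm (\<kappa> s))\<^sup>2 \<partial>?M) - 2 * (a \<bullet> a) + (norm a)\<^sup>2"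
    proof -
      have i4: "integrable ?M (\<lambda>s. 2 * (a \<bullet> (\<rho> (t - s) *\<^sub>R \<kappa> s)))"
        by (intro integrable_mult_right integrable_inner_right i1)
      have "(\<integral>s. 2 * (a \<bullet> (\<rho> (t - s) *\<^sub>R \<kappa> s)) \<partial>?M) = 2 * (a \<bullet> a)"
        using integral_inner_right[of a ?M "\<lambda>s. \<rho> (t - s) *\<^sub>R \<kappa> s"] i1 a by simp
      then show ?thesis
        using Bochner_Integration.integral_add[OF Bochner_Integration.integrable_diff[OF i2 i4] integrable_mult_right[OF i3, of "(norm a)\<^sup>2"]]
          Bochner_Integration.integral_diff[OF i2 i4] mass by simp
    qed
    finally show ?thesis by (simp add: a_def power2_norm_eq_inner)
  qed
  interpret M: finite_measure ?M by (rule finite_measure_lebesgue_on) simp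
  interpret MM: pair_sigma_finite ?M ?M ..
  have mid: "(\<lambda>t. t) \<in> borel_measurable ?M" by (rule borel_measurable_integrable[OF int]) (rule continuous_intros)
  have m2: "(\<lambda>(t, s). ennreal (\<rho> (t - s) * (norm (\<kappa> s))\<^sup>2)) \<in> borel_measurable (?M \<Otimes>\<^sub>M ?M)"
  proof -
    have f: "(\<lambda>x. fst x) \<in> borel_measurable (?M \<Otimes>\<^sub>M ?M)" "(\<lambda>x. snd x) \<in> borel_measurable (?M \<Otimes>\<^sub>M ?M)"
      by (rule measurable_compose[OF measurable_fst mid], rule measurable_compose[OF measurable_snd mid])
    have "\<rho> \<in> borel_measurable borel" by (rule borel_measurable_continuous_onI[OF smooth_continuous[OF s\<rho>(1)]])
    then have 1: "(\<lambda>x. \<rho> (fst x - snd x)) \<in> borel_measurable (?M \<Otimes>\<^sub>M ?M)"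
      by (rule measurable_compose[OF borel_measurable_diff[OF f]])
    have 2: "(\<lambda>x. \<kappa> (snd x)) \<in> borel_measurable (?M \<Otimes>\<^sub>M ?M)" by (rule measurable_compose[OF measurable_snd m\<kappa>])
    show ?thesis unfolding case_prod_beta using 1 2 by measurable
  qed
  have ch2: "continuous_on {0..p} (\<lambda>t. (norm (h t))\<^sup>2)" by (intro continuous_intros h(1))
  have nn: "integral {0..p} (\<lambda>t. (norm (h t))\<^sup>2) \<ge> 0" by (intro integral_nonneg integrable_continuous_real ch2) simp
  have "ennreal (integral {0..p} (\<lambda>t. (norm (h t))\<^sup>2)) = (\<integral>\<^sup>+t. ennreal ((norm (h t))\<^sup>2) \<partial>?M)"
    using nn_integral_eq_integral[OF int[OF ch2]] lebesgue_integral_eq_integral[OF int[OF ch2]] by simp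
  also have "\<dots> \<le> (\<integral>\<^sup>+t. (\<integral>\<^sup>+s. ennreal (\<rho> (t - s) * (norm (\<kappa> s))\<^sup>2) \<partial>?M) \<partial>?M)"
  proof (rule nn_integral_mono)
    fix t
    have "(\<integral>\<^sup>+s. ennreal (\<rho> (t - s) * (norm (\<kappa> s))\<^sup>2) \<partial>?M) = ennreal (\<integral>s. \<rho> (t - s) * (norm (\<kappa> s))\<^sup>2 \<partial>?M)"
      using mult_int[OF i\<kappa>2, of t] by (intro nn_integral_eq_integral) (simp_all add: s\<rho>(3))
    then show "ennreal ((norm (h t))\<^sup>2) \<le> (\<integral>\<^sup>+s. ennreal (\<rho> (t - s) * (norm (\<kappa> s))\<^sup>2) \<partial>?M)"
      using ennreal_leI[OF jensen[of t]] by simp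
  qed
  also have "\<dots> = (\<integral>\<^sup>+s. (\<integral>\<^sup>+t. ennreal (\<rho> (t - s) * (norm (\<kappa> s))\<^sup>2) \<partial>?M) \<partial>?M)"
    using MM.Fubini'[OF m2] by simp
  also have "\<dots> = (\<integral>\<^sup>+s. ennreal ((norm (\<kappa> s))\<^sup>2) \<partial>?M)"
  proof (rule nn_integral_cong)
    fix s
    have c: "continuous_on A (\<lambda>t. \<rho> (t - s))" for A
      by (rule continuous_on_compose2[OF smooth_continuous[OF s\<rho>(1), of UNIV]]) (auto intro!: continuous_intros)
    have "integral {0..p} (\<lambda>t. \<rho> (t - s)) = integral {-s..-s+p} \<rho>"
      using integral_shift_Icc_real[of 0 p \<rho> "-s"] by (simp add: o_def)
    also have "\<dots> = 1" using integral_periodic[OF smooth_continuous[OF s\<rho>(1)] s\<rho>(2), of "-s"] p s\<rho>(4) by simp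
    finally have "(\<integral>\<^sup>+t. ennreal (\<rho> (t - s)) \<partial>?M) = 1"
      using nn_integral_eq_integral[OF int[OF c]] lebesgue_integral_eq_integral[OF int[OF c]] s\<rho>(3) by simp
    moreover have "(\<integral>\<^sup>+t. ennreal (\<rho> (t - s) * (norm (\<kappa> s))\<^sup>2) \<partial>?M) = (\<integral>\<^sup>+t. ennreal (\<rho> (t - s)) \<partial>?M) * ennreal ((norm (\<kappa> s))\<^sup>2)"
    proof -
      have "(\<lambda>t. ennreal (\<rho> (t - s))) \<in> borel_measurable ?M"
        using borel_measurable_integrable[OF int[OF c]] by measurable
      then show ?thesis by (simp add: ennreal_mult s\<rho>(3) nn_integral_multc)
    qed
    ultimately show "(\<integral>\<^sup>+t. ennreal (\<rho> (t - s) * (norm (\<kappa> s))\<^sup>2) \<partial>?M) = ennreal ((norm (\<kappa> s))\<^sup>2)" by simp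
  qed
  also have "\<dots> = Q" by (simp add: Q_def)
  finally have "ennreal (integral {0..p} (\<lambda>t. (norm (h t))\<^sup>2)) \<le> Q" .
  then have "enn2real (ennreal (integral {0..p} (\<lambda>t. (norm (h t))\<^sup>2))) \<le> enn2real Q"
    using Qfin by (intro enn2real_mono) simp_all
  then show ?thesis using nn by (simp add: Q_eq)
qed

text \<open>The definition of the weak derivative, tested with translates of the kernel, says that the second
  derivative of the mollified curve is the mollified weak derivative.\<close>

lemma approximation_of_weak_curvature:
  fixes \<gamma> :: "real \<Rightarrow> 'a::euclidean_space"
  assumes p: "p > 0" and \<gamma>: "continuous_on UNIV \<gamma>" "periodic p \<gamma>"
    and \<kappa>: "weak_second_derivative p \<gamma> \<kappa>"
    and fin: "(\<integral>\<^sup>+ s\<in>{0..p}. ennreal ((norm (\<kappa> s))\<^sup>2) \<partial>lebesgue) < \<infinity>"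
    and \<epsilon>: "\<epsilon> > 0"
  shows "\<exists>\<eta>\<in>smooth_loops p. (\<forall>t. norm (\<eta> t - \<gamma> t) \<le> \<epsilon>)
     \<and> bending p \<eta> \<le> enn2real (\<integral>\<^sup>+ s\<in>{0..p}. ennreal ((norm (\<kappa> s))\<^sup>2) \<partial>lebesgue)"
proof -
  obtain \<delta> where \<delta>: "\<delta> > 0" "\<forall>\<rho>. kernel p \<delta> \<rho> \<longrightarrow> (\<forall>t. norm (mollify p \<rho> \<gamma> t - \<gamma> t) \<le> \<epsilon>)"
    using mollify_close[OF p \<gamma> \<epsilon>] by blast
  obtain \<rho> where \<rho>: "kernel p \<delta> \<rho>" using kernel_exists[OF p \<delta>(1)] by blast
  have s\<rho>: "smooth \<rho>" "periodic p \<rho>" using \<rho> by (auto simp: kernel_def)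
  define \<eta> where "\<eta> = mollify p \<rho> \<gamma>"
  have sm: "smooth \<eta>" unfolding \<eta>_def by (rule smooth_mollify[OF s\<rho>(1) \<gamma>(1)])
  have "periodic p \<eta>" unfolding \<eta>_def by (rule periodic_mollify[OF s\<rho>(2)])
  then have loop: "\<eta> \<in> smooth_loops p" using sm by (simp add: smooth_loops_def)
  have "vd \<eta> t = mollify p (vd \<rho>) \<gamma> t" for t
    unfolding \<eta>_def by (rule vector_derivative_at[OF mollify_has_vd[OF s\<rho>(1) \<gamma>(1)]])
  then have "vd \<eta> = mollify p (vd \<rho>) \<gamma>" by (rule ext)
  then have v2: "vd (vd \<eta>) t = mollify p (vd (vd \<rho>)) \<gamma> t" for t
    using vector_derivative_at[OF mollify_has_vd[OF smooth_vd[OF s\<rho>(1)] \<gamma>(1)]] by simp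
  have "vd (vd \<eta>) t = integral {0..p} (\<lambda>s. \<rho> (t - s) *\<^sub>R \<kappa> s)" for t
  proof -
    define \<psi> where "\<psi> s = \<rho> (t - s)" for s
    have sts: "smooth (\<lambda>s. t - s)" by (intro smooth_diff smooth_const smooth_id)
    have vts: "vd (\<lambda>s. t - s) s = -1" for s by (rule vector_derivative_at) (auto intro!: derivative_eq_intros)
    have \<psi>: "smooth \<psi>" unfolding \<psi>_def[abs_def] by (rule smooth_compose[OF s\<rho>(1) sts])
    have "\<psi> (s + p) = \<psi> s" for s
      using s\<rho>(2)[unfolded periodic_def, rule_format, of "t - (s + p)"] by (simp add: \<psi>_def)
    then have \<psi>p: "periodic p \<psi>" by (simp add: periodic_def)
    have d: "vd (\<lambda>s. g (t - s)) s = - vd g (t - s)" if "smooth g" for g :: "real \<Rightarrow> real" and s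
      using vd_compose[OF that sts, of s] by (simp add: vts)
    have "vd \<psi> s = - vd \<rho> (t - s)" for s unfolding \<psi>_def[abs_def] by (rule d[OF s\<rho>(1)])
    then have "vd \<psi> = (\<lambda>s. - vd \<rho> (t - s))" by (rule ext)
    moreover have "vd (\<lambda>s. - vd \<rho> (t - s)) s = vd (vd \<rho>) (t - s)" for s
    proof -
      have sm': "smooth (\<lambda>s. vd \<rho> (t - s))" by (rule smooth_compose[OF smooth_vd[OF s\<rho>(1)] sts])
      show ?thesis
        using vector_derivative_at[OF has_vector_derivative_minus[OF smooth_has_vd[OF sm', of s]]] d[OF smooth_vd[OF s\<rho>(1)], of s]
        by simp
    qed
    ultimately have dd: "deriv (deriv \<psi>) s = vd (vd \<rho>) (t - s)" for s
      unfolding deriv_eq_vd[OF \<psi>] deriv_eq_vd[OF smooth_vd[OF \<psi>]] by simp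
    have "integral {0..p} (\<lambda>s. deriv (deriv \<psi>) s *\<^sub>R \<gamma> s) = integral {0..p} (\<lambda>s. \<psi> s *\<^sub>R \<kappa> s)"
      using \<kappa> \<psi> \<psi>p unfolding weak_second_derivative_def by blast
    then show ?thesis unfolding v2 mollify_def dd \<psi>_def .
  qed
  then have "bending p \<eta> \<le> enn2real (\<integral>\<^sup>+ s\<in>{0..p}. ennreal ((norm (\<kappa> s))\<^sup>2) \<partial>lebesgue)"
    unfolding bending_def using \<kappa>
    by (intro integral_mollify_square_le[OF p \<rho> _ fin] smooth_continuous smooth_vd sm) (simp_all add: weak_second_derivative_def)
  then show ?thesis using loop \<delta>(2) \<rho> unfolding \<eta>_def by blast
qed

section \<open>Linear homotopies between nearby curves\<close>

lemma smooth_loopsD: "\<eta> \<in> smooth_loops p \<Longrightarrow> smooth \<eta>" "\<eta> \<in> smooth_loops p \<Longrightarrow> periodic p \<eta>"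
  by (auto simp: smooth_loops_def)

lemma smooth_loops_diff: "f \<in> smooth_loops p \<Longrightarrow> g \<in> smooth_loops p \<Longrightarrow> (\<lambda>t. f t - g t) \<in> smooth_loops p"
  by (auto simp: smooth_loops_def periodic_def intro: smooth_diff)

text \<open>For a constant unit vector \<open>X\<close>, \<open>D\<^sub>s\<close> in \<open>arc_derivative_bound\<close> is the ordinary derivative.\<close>

lemma smooth_loop_derivative_bound:
  fixes h :: "real \<Rightarrow> 'a::euclidean_space"
  assumes h: "h \<in> smooth_loops (2 * pi)"
  shows "norm (vd h u) \<le> sqrt (2 * pi * bending (2 * pi) h)"
proof -
  note sm = smooth_loopsD[OF h]
  obtain b :: 'a where b: "b \<in> Basis" using nonempty_Basis by blast
  have nb: "norm b = 1" "b \<noteq> 0" using b by auto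
  have D: "D2s b 0 z w = w" for z w by (simp add: D2s_def nb)
  have *: "norm (vd h u) \<le> sqrt (2 * pi * bending (2 * pi) h)" if "u \<in> {0..2*pi}" for u
  proof -
    have "norm (vd h u) \<le> sqrt (integral {0..2*pi} (\<lambda>u. norm b) * integral {0..2*pi} (\<lambda>u. (norm (D2s b 0 (vd h u) (vd (vd h) u)))\<^sup>2 * norm b)) * norm b"
    proof (rule arc_derivative_bound(1)[where X="\<lambda>_. b" and Y="\<lambda>_. 0" and h=h])
      show "h (2 * pi) = h 0" using sm(2) unfolding periodic_def by (metis add_0)
    qed (use nb that in \<open>auto intro!: smooth_has_vd smooth_vd sm smooth_continuous continuous_intros\<close>)
    then show ?thesis by (simp add: D nb bending_def)
  qed
  have "vd h u = vd h (u - 2 * pi * of_int \<lfloor>u / (2 * pi)\<rfloor>)"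
    using periodic_int[OF vd_periodic[OF sm], of "u - 2 * pi * of_int \<lfloor>u / (2 * pi)\<rfloor>" "\<lfloor>u / (2 * pi)\<rfloor>"] by simp
  then show ?thesis using *[of "u - 2 * pi * of_int \<lfloor>u / (2 * pi)\<rfloor>"] periodic_reduce[of "2 * pi" u] by simp
qed

text \<open>Homotopies that are affine in the time are closed under partial derivatives, since the derivatives in the two
  directions are again affine in the time.\<close>

lemma linear_homotopy_smooth:
  fixes f h :: "real \<Rightarrow> 'a::euclidean_space"
  assumes "smooth f" "smooth h"
  shows "smooth_on strip (\<lambda>x. f (fst x) + snd x *\<^sub>R h (fst x))"
proof -
  have "Ck_on k strip (\<lambda>x. f (fst x) + snd x *\<^sub>R h (fst x))" if "smooth f" "smooth h" for k and f h :: "real \<Rightarrow> 'a"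
    using that
  proof (induction k arbitrary: f h)
    case 0
    have "continuous_on strip (\<lambda>x. g (fst x))" if "smooth g" for g :: "real \<Rightarrow> 'a"
      by (rule continuous_on_compose2[OF smooth_continuous[OF that, of UNIV]]) (auto intro!: continuous_intros)
    then show ?case using 0 by (auto intro!: continuous_intros)
  next
    case (Suc k)
    let ?C = "\<lambda>x. f (fst x) + snd x *\<^sub>R h (fst x)"
    have D: "(?C has_derivative (\<lambda>w. fst w *\<^sub>R vd f (fst x) + (snd x *\<^sub>R (fst w *\<^sub>R vd h (fst x)) + snd w *\<^sub>R h (fst x)))) (at x within strip)" for x
    proof -
      have d: "((\<lambda>x. g (fst x)) has_derivative (\<lambda>w. fst w *\<^sub>R vd g (fst x))) (at x within strip)" if "smooth g" for g :: "real \<Rightarrow> 'a"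
      proof -
        have "(g has_derivative (\<lambda>w. w *\<^sub>R vd g (fst x))) (at (fst x))"
          using smooth_has_vd[OF that] by (simp add: has_vector_derivative_def)
        from has_derivative_compose[OF has_derivative_fst[OF has_derivative_ident] this] show ?thesis .
      qed
      have s: "(snd has_derivative snd) (at x within strip)"
        by (rule has_derivative_snd[OF has_derivative_ident])
      show ?thesis
        by (intro has_derivative_add d Suc.prems bounded_bilinear.FDERIV[OF bounded_bilinear_scaleR s d[OF Suc.prems(2)]])
    qed
    have cb: "cbox (fst x - 1, 0) (fst x + 1, 1) \<subseteq> strip" for x :: "real \<times> real"
      by (auto simp: cbox_Pair_eq)
    have fd: "frechet_derivative ?C (at x within strip) w = fst w *\<^sub>R vd f (fst x) + (snd x *\<^sub>R (fst w *\<^sub>R vd h (fst x)) + snd w *\<^sub>R h (fst x))"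
      if x: "x \<in> strip" for x w
    proof -
      have sub: "(?C has_derivative F) (at x within cbox (fst x - 1, 0) (fst x + 1, 1))" if "(?C has_derivative F) (at x within strip)" for F
        by (rule has_derivative_subset[OF that cb])
      have xb: "x \<in> cbox (fst x - 1, 0) (fst x + 1, 1)" using x by (cases x) (auto simp: cbox_Pair_eq)
      have 1: "(?C has_derivative frechet_derivative ?C (at x within strip)) (at x within strip)"
        using D[of x] frechet_derivative_works differentiable_def by blast
      show ?thesis
      proof -
        have "(fst x - 1, 0) \<bullet> i < (fst x + 1, 1) \<bullet> i" if "i \<in> Basis" for i :: "real \<times> real"
          using that by (auto simp: Basis_prod_def)
        from frechet_derivative_unique_within_closed_interval[OF this xb sub[OF 1] sub[OF D]]
        show ?thesis by (simp only:)
      qed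
    qed
    have "Ck_on k strip (\<lambda>x. frechet_derivative ?C (at x within strip) w)" for w
    proof -
      have "smooth (\<lambda>t. fst w *\<^sub>R vd f t + snd w *\<^sub>R h t)" "smooth (\<lambda>t. fst w *\<^sub>R vd h t)"
        by (intro smooth_add smooth_scaleR smooth_const smooth_vd Suc.prems)+
      from Suc.IH[OF this]
      have "Ck_on k strip (\<lambda>x. fst w *\<^sub>R vd f (fst x) + (snd x *\<^sub>R (fst w *\<^sub>R vd h (fst x)) + snd w *\<^sub>R h (fst x)))"
        by (simp add: algebra_simps)
      then show ?thesis by (rule Ck_on_cong) (rule fd[symmetric])
    qed
    moreover have "?C differentiable_on strip"
      unfolding differentiable_on_def differentiable_def using D by blast
    ultimately show ?case by simp
  qed
  then show ?thesis using assms by (simp add: smooth_on_def)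
qed

lemma square_sum_le: "(x + y)\<^sup>2 \<le> 2 * x\<^sup>2 + 2 * (y::real)\<^sup>2"
  using zero_le_power2[of "x - y"] by (simp add: power2_eq_square algebra_simps)

lemma D2s_square_bound:
  fixes x y z w :: "'a::euclidean_space"
  assumes m: "m > 0" "m \<le> norm x" and z: "(norm z)\<^sup>2 \<le> q"
  shows "(norm (D2s x y z w))\<^sup>2 \<le> 2 / m ^ 4 * (norm w)\<^sup>2 + 2 * q / m ^ 6 * (norm y)\<^sup>2"
proof -
  define n where "n = inverse (norm x)"
  have x: "norm x > 0" using m by linarith
  have n: "0 \<le> n" "n \<le> inverse m" using m x by (auto simp: n_def le_imp_inverse_le)
  have "norm (((x \<bullet> y) * n ^ 4) *\<^sub>R z) \<le> (norm x * norm y * n ^ 4) * norm z"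
    using Cauchy_Schwarz_ineq2[of x y] n by (simp add: abs_mult mult_right_mono)
  also have "norm x * norm y * n ^ 4 = norm y * n ^ 3" using x by (simp add: n_def eval_nat_numeral)
  finally have 2: "norm (((x \<bullet> y) * n ^ 4) *\<^sub>R z) \<le> norm y * n ^ 3 * norm z" .
  have "norm (D2s x y z w) \<le> norm (n\<^sup>2 *\<^sub>R w) + norm (((x \<bullet> y) * n ^ 4) *\<^sub>R z)"
    unfolding D2s_def n_def[symmetric] by (rule norm_triangle_ineq4)
  also have "\<dots> \<le> n\<^sup>2 * norm w + norm y * n ^ 3 * norm z" using 2 by simp
  finally have "(norm (D2s x y z w))\<^sup>2 \<le> (n\<^sup>2 * norm w + norm y * n ^ 3 * norm z)\<^sup>2" by (rule power_mono) simp
  also have "\<dots> \<le> 2 * (n\<^sup>2 * norm w)\<^sup>2 + 2 * (norm y * n ^ 3 * norm z)\<^sup>2" by (rule square_sum_le)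
  also have "\<dots> = 2 * n ^ 4 * (norm w)\<^sup>2 + 2 * (n ^ 6 * (norm z)\<^sup>2) * (norm y)\<^sup>2"
    by (simp add: power_mult_distrib flip: power_mult)
  also have "\<dots> \<le> 2 * (inverse m) ^ 4 * (norm w)\<^sup>2 + 2 * ((inverse m) ^ 6 * q) * (norm y)\<^sup>2"
    using n z by (intro add_mono mult_right_mono mult_left_mono mult_mono power_mono) simp_all
  finally show ?thesis by (simp add: divide_inverse power_inverse mult_ac)
qed

text \<open>The factor \<open>\<lambda> L\<^sup>3\<close> of the metric with \<open>L \<le> 2 \<pi> M\<close>, times the integral of the bound in
  \<open>D2s_square_bound\<close> with \<open>q = 2 \<pi> b\<close>, divided by \<open>b\<close>. The bending along the straight path is at most \<open>2 B + 2\<close>.\<close>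

definition linear_path_const :: "real \<Rightarrow> real \<Rightarrow> real \<Rightarrow> real \<Rightarrow> real" where
  "linear_path_const lam m M B = lam * (2 * pi * M) ^ 3 * (M * (2 / m ^ 4 + 4 * pi / m ^ 6 * (2 * B + 2)))"

text \<open>Along the straight homotopy the velocity is \<open>h = g - f\<close> at all times. By \<open>D2s_square_bound\<close>,
  \<open>\<bar>D\<^sub>s\<^sup>2h\<bar>\<^sup>2\<close> is controlled by \<open>\<bar>h''\<bar>\<^sup>2\<close> and by \<open>sup \<bar>h'\<bar>\<^sup>2\<close> times the squared second derivative of the curve, and both
  \<open>\<integral>\<bar>h''\<bar>\<^sup>2\<close> and \<open>sup \<bar>h'\<bar>\<^sup>2\<close> are at most a multiple of \<open>b\<close>.\<close>

lemma H2_dist_linear_path: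
  fixes f g :: "real \<Rightarrow> 'a::euclidean_space"
  assumes lam: "lam > 0" and f: "f \<in> smooth_loops (2 * pi)" and g: "g \<in> smooth_loops (2 * pi)"
    and m: "m > 0"
    and low: "\<And>u v. v \<in> {0..1} \<Longrightarrow> m \<le> norm (vd f u + v *\<^sub>R (vd g u - vd f u))"
    and up: "\<And>u v. v \<in> {0..1} \<Longrightarrow> norm (vd f u + v *\<^sub>R (vd g u - vd f u)) \<le> M"
    and near: "\<And>u. norm (g u - f u) \<le> s"
    and B: "bending (2 * pi) f \<le> B" and b: "bending (2 * pi) (\<lambda>u. g u - f u) \<le> b" "b \<le> 1"
  shows "f \<in> immersed_curves" "g \<in> immersed_curves"
    and "H2_dist lam f g \<le> ennreal (sqrt (s\<^sup>2 + linear_path_const lam m M B * b))"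
proof -
  define h where "h u = g u - f u" for u
  note F = smooth_loopsD[OF f] and G = smooth_loopsD[OF g]
  have hl: "h \<in> smooth_loops (2 * pi)" unfolding h_def[abs_def] by (rule smooth_loops_diff[OF g f])
  note Hs = smooth_loopsD[OF hl]
  have vh: "vd h u = vd g u - vd f u" for u
    using has_vector_derivative_diff[OF smooth_has_vd[OF G(1)] smooth_has_vd[OF F(1)], of u]
    by (simp add: h_def[abs_def] vector_derivative_at)
  define C where "C x = f (fst x) + snd x *\<^sub>R h (fst x)" for x :: "real \<times> real"
  have dC: "((\<lambda>u. C (u, v)) has_vector_derivative vd f u + v *\<^sub>R vd h u) (at u)" for u v
    unfolding C_def using smooth_has_vd[OF F(1)] smooth_has_vd[OF Hs(1)] by (auto intro!: derivative_eq_intros)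
  have sC: "smooth_on strip C" unfolding C_def[abs_def] by (rule linear_homotopy_smooth[OF F(1) Hs(1)])
  have imm: "(\<lambda>u. C (u, v)) \<in> immersed_curves" if v: "v \<in> {0..1}" for v
    unfolding immersed_curves_def
  proof (intro CollectI conjI allI)
    show "periodic (2 * pi) (\<lambda>u. C (u, v))" using F(2) Hs(2) by (simp add: periodic_def C_def)
    show "smooth (\<lambda>u. C (u, v))" unfolding C_def fst_conv snd_conv by (intro smooth_add smooth_scaleR smooth_const F Hs)
    show "vd (\<lambda>u. C (u, v)) u \<noteq> 0" for u
      using low[OF v, of u] m vector_derivative_at[OF dC, of v u] by (auto simp: vh)
  qed
  have C01: "(\<lambda>u. C (u, 0)) = f" "(\<lambda>u. C (u, 1)) = g" by (simp_all add: C_def h_def fun_eq_iff)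
  show "f \<in> immersed_curves" "g \<in> immersed_curves" using imm[of 0] imm[of 1] C01 by simp_all
  have hom: "C \<in> homotopies f g"
    unfolding homotopies_def
  proof (intro CollectI conjI ballI allI bexI[OF _ diff_circle_id])
    show "C (u, 0) = f u" "C (u, 1) = g u" for u using fun_cong[OF C01(1)] fun_cong[OF C01(2)] by simp_all
  qed (use sC imm in simp_all)
  interpret curve_homotopy C lam by unfold_locales (use sC lam imm in auto)
  have X: "X u v = vd f u + v *\<^sub>R vd h u" if "v \<in> {0..1}" for u v
    using vector_derivative_unique_at[OF derivatives_in_u(1)[OF that] dC] .
  have Y: "Y u v = vd (vd f) u + v *\<^sub>R vd (vd h) u" if v: "v \<in> {0..1}" for u v
  proof -
    have "((\<lambda>u. vd f u + v *\<^sub>R vd h u) has_vector_derivative vd (vd f) u + v *\<^sub>R vd (vd h) u) (at u)"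
      by (intro has_vector_derivative_add smooth_has_vd smooth_vd F Hs
          bounded_linear.has_vector_derivative[OF bounded_linear_scaleR_right])
    moreover have "((\<lambda>u. vd f u + v *\<^sub>R vd h u) has_vector_derivative Y u v) (at u)"
      using derivatives_in_u(2)[OF v, of u] unfolding X[OF v] .
    ultimately show ?thesis by (rule vector_derivative_unique_at[rotated])
  qed
  have P2C: "P2 C (u, v) = h u" if v: "v \<in> {0..1}" for u v
  proof -
    have "((\<lambda>v. C (u, v)) has_vector_derivative h u) (at v within {0..1})"
      unfolding C_def by (auto intro!: derivative_eq_intros)
    from vector_derivative_within_closed_interval[OF _ v this]
      vector_derivative_within_closed_interval[OF _ v P2_has_vd[OF sC v, of u]]
    show ?thesis by simp
  qed
  have Z: "Z u v = vd h u" if v: "v \<in> {0..1}" for u v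
    using vector_derivative_unique_at[OF derivatives_in_u(3)[OF v, unfolded P2C[OF v]] smooth_has_vd[OF Hs(1)]] .
  have W: "W u v = vd (vd h) u" if v: "v \<in> {0..1}" for u v
    using vector_derivative_unique_at[OF derivatives_in_u(4)[OF v, unfolded Z[OF v]] smooth_has_vd[OF smooth_vd[OF Hs(1)]]] .
  have b0: "bending (2 * pi) h \<ge> 0" by (rule bending_nonneg[OF Hs(1)])
  have bh: "bending (2 * pi) h \<le> b" using b(1) by (simp add: h_def[abs_def])
  have Z2: "(norm (vd h u))\<^sup>2 \<le> 2 * pi * b" for u
  proof -
    have "(norm (vd h u))\<^sup>2 \<le> (sqrt (2 * pi * bending (2 * pi) h))\<^sup>2"
      by (rule power_mono[OF smooth_loop_derivative_bound[OF hl]]) simp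
    also have "\<dots> = 2 * pi * bending (2 * pi) h" using b0 by simp
    also have "\<dots> \<le> 2 * pi * b" using bh by simp
    finally show ?thesis .
  qed
  have M: "M > 0" using low[of 0 0] up[of 0 0] m by simp
  have c: "continuous_on A (vd (vd f))" "continuous_on A (vd (vd h))" for A
    by (intro smooth_continuous smooth_vd F Hs)+
  have norm_at_le: "norm_at v \<le> sqrt (s\<^sup>2 + linear_path_const lam m M B * b)" if v: "v \<in> {0..1}" for v
  proof -
    have Xb: "m \<le> norm (X u v)" "norm (X u v) \<le> M" for u
      using low[OF v, of u] up[OF v, of u] by (simp_all add: X[OF v] vh)
    note cX = slice[OF continuous_partials(1) v] and cV = slice[OF continuous_D2s_partials(2) v]
    have iX: "(\<lambda>u. norm (X u v)) integrable_on {0..2*pi}" by (intro integrable_continuous_real continuous_intros cX)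
    have L: "len_at v > 0" "len_at v \<le> 2 * pi * M"
    proof -
      show "len_at v > 0" by (rule len_at_pos[OF v])
      have "integral {0..2*pi} (\<lambda>u. norm (X u v)) \<le> integral {0..2*pi} (\<lambda>u. M)"
        using Xb(2) by (intro integral_le iX) auto
      then show "len_at v \<le> 2 * pi * M" by (simp add: functionals_by_partials(1)[OF v])
    qed
    have "integral {0..2*pi} (\<lambda>u. (norm (P2 C (u, v)))\<^sup>2 * norm (X u v)) \<le> integral {0..2*pi} (\<lambda>u. s\<^sup>2 * norm (X u v))"
    proof (rule integral_le)
      show "(\<lambda>u. (norm (P2 C (u, v)))\<^sup>2 * norm (X u v)) integrable_on {0..2*pi}"
        by (intro integrable_continuous_real continuous_intros slice[OF continuous_partials(5) v] cX)
      show "(\<lambda>u. s\<^sup>2 * norm (X u v)) integrable_on {0..2*pi}"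
        by (intro integrable_continuous_real continuous_intros cX)
      show "(norm (P2 C (u, v)))\<^sup>2 * norm (X u v) \<le> s\<^sup>2 * norm (X u v)" for u
        using near[of u] by (intro mult_right_mono power_mono) (simp_all add: P2C[OF v] h_def)
    qed
    also have "\<dots> = s\<^sup>2 * len_at v" by (simp add: functionals_by_partials(1)[OF v])
    finally have 1: "1 / len_at v * integral {0..2*pi} (\<lambda>u. (norm (P2 C (u, v)))\<^sup>2 * norm (X u v)) \<le> s\<^sup>2"
      using L(1) by (simp add: pos_divide_le_eq)
    have "accel_at v \<le> integral {0..2*pi} (\<lambda>u. M * (2 / m ^ 4 * (norm (vd (vd h) u))\<^sup>2
        + 4 * pi * b / m ^ 6 * (2 * (norm (vd (vd f) u))\<^sup>2 + 2 * (norm (vd (vd h) u))\<^sup>2)))"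
      unfolding accel_at_def
    proof (rule integral_le)
      fix u
      have y: "(norm (Y u v))\<^sup>2 \<le> 2 * (norm (vd (vd f) u))\<^sup>2 + 2 * (norm (vd (vd h) u))\<^sup>2"
      proof -
        have "norm (Y u v) \<le> norm (vd (vd f) u) + norm (v *\<^sub>R vd (vd h) u)"
          unfolding Y[OF v] by (rule norm_triangle_ineq)
        also have "norm (v *\<^sub>R vd (vd h) u) \<le> 1 * norm (vd (vd h) u)"
          unfolding norm_scaleR using v by (intro mult_right_mono) auto
        finally have "(norm (Y u v))\<^sup>2 \<le> (norm (vd (vd f) u) + norm (vd (vd h) u))\<^sup>2"
          by (intro power_mono) simp_all
        also have "\<dots> \<le> 2 * (norm (vd (vd f) u))\<^sup>2 + 2 * (norm (vd (vd h) u))\<^sup>2" by (rule square_sum_le)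
        finally show ?thesis .
      qed
      have b00: "b \<ge> 0" using b0 bh by linarith
      have "(norm (vel2 u v))\<^sup>2 \<le> 2 / m ^ 4 * (norm (vd (vd h) u))\<^sup>2 + 2 * (2 * pi * b) / m ^ 6 * (norm (Y u v))\<^sup>2"
        unfolding vel2_def W[OF v] Z[OF v] by (rule D2s_square_bound[OF m Xb(1) Z2])
      also have "\<dots> \<le> 2 / m ^ 4 * (norm (vd (vd h) u))\<^sup>2 + 2 * (2 * pi * b) / m ^ 6 * (2 * (norm (vd (vd f) u))\<^sup>2 + 2 * (norm (vd (vd h) u))\<^sup>2)"
        using y m b00 by (intro add_left_mono mult_left_mono) simp_all
      finally have "(norm (vel2 u v))\<^sup>2 * norm (X u v) \<le> (2 / m ^ 4 * (norm (vd (vd h) u))\<^sup>2 + 2 * (2 * pi * b) / m ^ 6 * (2 * (norm (vd (vd f) u))\<^sup>2 + 2 * (norm (vd (vd h) u))\<^sup>2)) * M"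
        using Xb(2) m b00 by (intro mult_mono) simp_all
      then show "(norm (vel2 u v))\<^sup>2 * norm (X u v) \<le> M * (2 / m ^ 4 * (norm (vd (vd h) u))\<^sup>2
        + 4 * pi * b / m ^ 6 * (2 * (norm (vd (vd f) u))\<^sup>2 + 2 * (norm (vd (vd h) u))\<^sup>2))"
        by (simp add: mult_ac)
    qed (use m in \<open>intro integrable_continuous_real continuous_intros cX cV c; simp\<close>)+
    also have "\<dots> = M * (2 / m ^ 4 * bending (2 * pi) h + 4 * pi * b / m ^ 6 * (2 * bending (2 * pi) f + 2 * bending (2 * pi) h))"
    proof -
      have i: "(\<lambda>u. (norm (vd (vd h) u))\<^sup>2) integrable_on {0..2*pi}" "(\<lambda>u. (norm (vd (vd f) u))\<^sup>2) integrable_on {0..2*pi}"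
        by (intro integrable_continuous_real continuous_intros c)+
      have "((\<lambda>u. M * (2 / m ^ 4 * (norm (vd (vd h) u))\<^sup>2
        + 4 * pi * b / m ^ 6 * (2 * (norm (vd (vd f) u))\<^sup>2 + 2 * (norm (vd (vd h) u))\<^sup>2))) has_integral
        M * (2 / m ^ 4 * bending (2 * pi) h + 4 * pi * b / m ^ 6 * (2 * bending (2 * pi) f + 2 * bending (2 * pi) h))) {0..2*pi}"
        unfolding bending_def
        by (intro has_integral_mult_right has_integral_add integrable_integral i)
      then show ?thesis by (rule integral_unique)
    qed
    also have "\<dots> \<le> M * (2 / m ^ 4 * b + 4 * pi * b / m ^ 6 * (2 * B + 2))"
      using M m bh b0 b B by (intro mult_left_mono add_mono) simp_all
    also have "\<dots> = (M * (2 / m ^ 4 + 4 * pi / m ^ 6 * (2 * B + 2))) * b" by (simp add: algebra_simps)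
    finally have H: "accel_at v \<le> (M * (2 / m ^ 4 + 4 * pi / m ^ 6 * (2 * B + 2))) * b" .
    have "lam * len_at v ^ 3 * accel_at v \<le> lam * (2 * pi * M) ^ 3 * ((M * (2 / m ^ 4 + 4 * pi / m ^ 6 * (2 * B + 2))) * b)"
      using lam L H field_bounds(1)[OF v] M by (intro mult_mono power_mono) simp_all
    also have "\<dots> = linear_path_const lam m M B * b" by (simp add: linear_path_const_def)
    finally show ?thesis unfolding functionals_by_partials(3)[OF v] using 1 by (intro real_sqrt_le_mono add_mono)
  qed
  have "homotopy_length lam C = integral {0..1} norm_at" by (simp add: homotopy_length_def norm_at_def[abs_def])
  also have "\<dots> \<le> integral {0..1} (\<lambda>v::real. sqrt (s\<^sup>2 + linear_path_const lam m M B * b))"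
    by (intro integral_le norm_at_integrable norm_at_le) auto
  finally have "homotopy_length lam C \<le> sqrt (s\<^sup>2 + linear_path_const lam m M B * b)" by simp
  then show "H2_dist lam f g \<le> ennreal (sqrt (s\<^sup>2 + linear_path_const lam m M B * b))"
    unfolding H2_dist_def by (intro INF_lower2[OF hom] ennreal_leI)
qed

section \<open>Approximation of curves with square integrable curvature\<close>

text \<open>A monotone circle map, possibly with intervals of constancy, is a uniform limit of diffeomorphisms:
  mollification keeps it monotone, and a convex combination with the identity has positive derivative.\<close>

lemma monotone_map_approx_diff_circle:
  fixes q :: "real \<Rightarrow> real"
  assumes q: "continuous_on UNIV q" "periodic (2 * pi) q"
    and mono: "\<And>x y. x \<le> y \<Longrightarrow> x + q x \<le> y + q y" and \<epsilon>: "\<epsilon> > 0"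
  shows "\<exists>\<Phi>\<in>diff_circle. \<forall>u. \<bar>\<Phi> u - (u + q u)\<bar> \<le> \<epsilon>"
proof -
  obtain K where "norm (q x) \<le> K" for x using periodic_bounded[OF _ q] by auto
  then have qK: "\<bar>q x\<bar> \<le> K" for x by simp
  have K0: "K \<ge> 0" using order_trans[OF abs_ge_zero qK] .
  obtain \<delta> where \<delta>: "\<delta> > 0" "\<forall>\<rho>. kernel (2 * pi) \<delta> \<rho> \<longrightarrow> (\<forall>t. norm (mollify (2 * pi) \<rho> q t - q t) \<le> \<epsilon> / 2)"
    using mollify_close[of "2 * pi" q "\<epsilon> / 2"] q \<epsilon> by auto
  obtain \<rho> where \<rho>: "kernel (2 * pi) \<delta> \<rho>" using kernel_exists[of "2 * pi" \<delta>] \<delta>(1) by auto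
  have s\<rho>: "smooth \<rho>" "periodic (2 * pi) \<rho>" "\<And>t. \<rho> t \<ge> 0" "integral {0..2*pi} \<rho> = 1" using \<rho> by (auto simp: kernel_def)
  define Q where "Q = mollify (2 * pi) \<rho> q"
  have Qq: "\<bar>Q u - q u\<bar> \<le> \<epsilon> / 2" for u using \<delta>(2) \<rho> by (simp add: Q_def)
  have sQ: "smooth Q" unfolding Q_def by (rule smooth_mollify[OF s\<rho>(1) q(1)])
  have pQ: "periodic (2 * pi) Q" unfolding Q_def by (rule periodic_mollify[OF s\<rho>(2)])
  have Q_eq: "Q t = integral {0..2*pi} (\<lambda>s. \<rho> s *\<^sub>R q (t - s))" for t
    unfolding Q_def using mollify_commute[OF smooth_continuous[OF s\<rho>(1)] s\<rho>(2) q] by simp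
  have Qmono: "Q x - Q y \<le> y - x" if "x \<le> y" for x y
  proof -
    have cq: "continuous_on A (\<lambda>s. q (t - s))" for A t
      by (rule continuous_on_compose2[OF q(1)]) (auto intro!: continuous_intros)
    have c\<rho>: "continuous_on A \<rho>" for A by (rule smooth_continuous[OF s\<rho>(1)])
    have "Q x - Q y = integral {0..2*pi} (\<lambda>s. \<rho> s *\<^sub>R q (x - s) - \<rho> s *\<^sub>R q (y - s))"
      unfolding Q_eq by (intro integral_diff[symmetric] integrable_continuous_real continuous_intros cq c\<rho>)
    also have "\<dots> \<le> integral {0..2*pi} (\<lambda>s. \<rho> s * (y - x))"
    proof (rule integral_le)
      show "\<rho> s *\<^sub>R q (x - s) - \<rho> s *\<^sub>R q (y - s) \<le> \<rho> s * (y - x)" for s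
      proof -
        have "\<rho> s * (q (x - s) - q (y - s)) \<le> \<rho> s * (y - x)"
          using mono[of "x - s" "y - s"] that by (intro mult_left_mono s\<rho>(3)) simp
        then show ?thesis by (simp add: right_diff_distrib)
      qed
    qed (intro integrable_continuous_real continuous_intros cq c\<rho>)+
    also have "\<dots> = y - x" using s\<rho>(4) by simp
    finally show ?thesis .
  qed
  define \<tau> where "\<tau> = min (1/2) (\<epsilon> / (2 * (K + \<epsilon>)))"
  have \<tau>: "\<tau> > 0" "\<tau> \<le> 1/2" using \<epsilon> K0 by (auto simp: \<tau>_def)
  have \<tau>K: "\<tau> * (K + \<epsilon>) \<le> \<epsilon> / 2"
  proof -
    have "\<tau> \<le> \<epsilon> / (2 * (K + \<epsilon>))" unfolding \<tau>_def by (rule min.cobounded2)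
    then have "\<tau> * (K + \<epsilon>) \<le> \<epsilon> / (2 * (K + \<epsilon>)) * (K + \<epsilon>)" using K0 \<epsilon> by (intro mult_right_mono) simp_all
    also have "\<dots> = \<epsilon> / 2"
    proof -
      have "K + \<epsilon> \<noteq> 0" using K0 \<epsilon> by simp
      then show ?thesis by (simp add: divide_simps)
    qed
    finally show ?thesis .
  qed
  define \<Phi> where "\<Phi> u = u + (1 - \<tau>) * Q u" for u
  have s\<Phi>: "smooth \<Phi>" unfolding \<Phi>_def[abs_def] by (intro smooth_add smooth_mult smooth_const smooth_id sQ)
  have "\<Phi> \<in> diff_circle"
  proof (rule diff_circleI[OF s\<Phi>])
    show "\<Phi> (u + 2 * pi) = \<Phi> u + 2 * pi" for u using pQ by (simp add: \<Phi>_def periodic_def)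
    fix u
    have "((\<lambda>u. \<Phi> u - \<tau> * u) has_real_derivative vd \<Phi> u - \<tau>) (at u)"
      using smooth_has_vd[OF s\<Phi>, of u]
      by (auto simp flip: has_real_derivative_iff_has_vector_derivative intro!: derivative_eq_intros)
    moreover have "mono_on UNIV (\<lambda>u. \<Phi> u - \<tau> * u)"
    proof (rule mono_onI)
      fix x y :: real assume xy: "x \<le> y"
      have "(1 - \<tau>) * (Q x - Q y) \<le> (1 - \<tau>) * (y - x)" using Qmono[OF xy] \<tau> by (intro mult_left_mono) simp_all
      then show "\<Phi> x - \<tau> * x \<le> \<Phi> y - \<tau> * y" by (simp add: \<Phi>_def algebra_simps)
    qed
    ultimately have "vd \<Phi> u - \<tau> \<ge> 0" by (intro mono_on_imp_deriv_nonneg[of UNIV "\<lambda>u. \<Phi> u - \<tau> * u" "vd \<Phi> u - \<tau>" u]) simp_all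
    then show "vd \<Phi> u > 0" using \<tau>(1) by linarith
  qed
  moreover have "\<bar>\<Phi> u - (u + q u)\<bar> \<le> \<epsilon>" for u
  proof -
    have QK: "\<bar>Q u\<bar> \<le> K + \<epsilon>"
    proof -
      have "\<bar>Q u\<bar> \<le> \<bar>Q u - q u\<bar> + \<bar>q u\<bar>" using abs_triangle_ineq[of "Q u - q u" "q u"] by simp
      also have "\<dots> \<le> \<epsilon> / 2 + K" by (intro add_mono Qq qK)
      also have "\<dots> \<le> K + \<epsilon>" using \<epsilon> by simp
      finally show ?thesis .
    qed
    have "\<Phi> u - (u + q u) = (Q u - q u) - \<tau> * Q u" by (simp add: \<Phi>_def algebra_simps)
    also have "\<bar>\<dots>\<bar> \<le> \<bar>Q u - q u\<bar> + \<bar>\<tau> * Q u\<bar>" by (rule abs_triangle_ineq4)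
    also have "\<bar>\<tau> * Q u\<bar> \<le> \<tau> * (K + \<epsilon>)" using QK \<tau> by (simp add: abs_mult mult_left_mono)
    finally show ?thesis using Qq[of u] \<tau>K by linarith
  qed
  ultimately show ?thesis by blast
qed

context rectifiable_loop
begin

lemma arc_parametrization_unique:
  assumes "arc_parametrization c \<gamma>'"
  shows "\<gamma>' = \<gamma>"
proof
  fix t
  have p: "periodic L \<gamma>'" and u: "\<And>u. u \<in> {0..2*pi} \<Longrightarrow> \<gamma>' (ar 0 u) = c u"
    using assms by (simp_all add: arc_parametrization_def total_length)
  have u2: "\<And>u. u \<in> {0..2*pi} \<Longrightarrow> \<gamma> (ar 0 u) = c u"
    using \<gamma>_arc_parametrization by (simp add: arc_parametrization_def total_length)
  define s where "s = t - L * of_int \<lfloor>t / L\<rfloor>"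
  have "s \<in> {0..L}" using periodic_reduce[OF L_pos, of t] by (simp add: s_def)
  then obtain w where w: "w \<in> {0..2*pi}" "ar 0 w = s" by (rule ar_surj)
  have "\<gamma>' t = \<gamma>' s" "\<gamma> t = \<gamma> s"
    using periodic_int[OF p, of s "\<lfloor>t / L\<rfloor>"] periodic_int[OF \<gamma>_periodic, of s "\<lfloor>t / L\<rfloor>"] by (simp_all add: s_def)
  then show "\<gamma>' t = \<gamma> t" using u[OF w(1)] u2[OF w(1)] w(2) by simp
qed

text \<open>\<open>g\<close> is \<open>\<gamma>\<close> on the standard circle, and \<open>c\<close> is \<open>g\<close> after the monotone circle map \<open>u + shift u\<close>. The
  displacement \<open>shift\<close>, unlike the map, is periodic, so that it can be mollified.\<close>

definition g :: "real \<Rightarrow> 'a" where "g u = \<gamma> (L / (2 * pi) * u)"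

definition shift :: "real \<Rightarrow> real" where
  "shift u = (\<lambda>a. 2 * pi / L * ar 0 a - a) (u - 2 * pi * of_int \<lfloor>u / (2 * pi)\<rfloor>)"

lemma g_periodic: "periodic (2 * pi) g"
  using \<gamma>_periodic by (simp add: periodic_def g_def distrib_left)

lemma g_continuous: "continuous_on UNIV g"
  unfolding g_def[abs_def] by (rule continuous_on_compose2[OF \<gamma>_continuous]) (auto intro!: continuous_intros)

lemma shift_periodic: "periodic (2 * pi) shift"
  unfolding shift_def[abs_def] by (rule periodic_extension(1)) simp

lemma shift_continuous: "continuous_on UNIV shift"
  unfolding shift_def[abs_def]
proof (rule periodic_extension_continuous)
  show "continuous_on {0..2*pi} (\<lambda>a. 2 * pi / L * ar 0 a - a)"
    by (intro continuous_intros continuous_ar)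
  show "2 * pi / L * ar 0 (2 * pi) - 2 * pi = 2 * pi / L * ar 0 0 - 0" using L_pos ar_refl[of 0] by simp
qed simp

lemma shift_reduced:
  defines "a u \<equiv> u - 2 * pi * of_int \<lfloor>u / (2 * pi)\<rfloor>"
  shows "u + shift u = 2 * pi / L * ar 0 (a u) + 2 * pi * of_int \<lfloor>u / (2 * pi)\<rfloor>" and "a u \<in> {0..<2*pi}"
  using periodic_reduce[of "2 * pi" u] by (simp_all add: shift_def a_def)

lemma g_shift: "g (u + shift u) = c u"
proof -
  define a where "a = u - 2 * pi * of_int \<lfloor>u / (2 * pi)\<rfloor>"
  have a: "a \<in> {0..2*pi}" using shift_reduced(2)[of u] by (simp add: a_def)
  have "g (u + shift u) = g (2 * pi / L * ar 0 a + 2 * pi * of_int \<lfloor>u / (2 * pi)\<rfloor>)"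
    using shift_reduced(1)[of u] by (simp add: a_def)
  also have "\<dots> = g (2 * pi / L * ar 0 a)" by (rule periodic_int[OF g_periodic])
  also have "\<dots> = \<gamma> (ar 0 a)" using L_pos by (simp add: g_def)
  also have "\<dots> = c a"
    using \<gamma>_arc_parametrization a by (simp add: arc_parametrization_def total_length)
  also have "\<dots> = c u" using periodic_int[OF c_periodic, of a "\<lfloor>u / (2 * pi)\<rfloor>"] by (simp add: a_def)
  finally show ?thesis .
qed

lemma shift_mono:
  assumes "x \<le> y"
  shows "x + shift x \<le> y + shift y"
proof -
  define n where "n z = \<lfloor>z / (2 * pi)\<rfloor>" for z
  define a where "a z = z - 2 * pi * of_int (n z)" for z
  have e: "z + shift z = 2 * pi / L * ar 0 (a z) + 2 * pi * of_int (n z)" and az: "a z \<in> {0..<2*pi}" for z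
    using shift_reduced[of z] by (simp_all add: a_def n_def)
  have n: "n x \<le> n y" unfolding n_def using assms by (intro floor_mono divide_right_mono) simp_all
  have k: "2 * pi / L \<ge> 0" using L_pos by simp
  show ?thesis
  proof (cases "n x = n y")
    case True
    then have "a x \<le> a y" using assms by (simp add: a_def)
    then have "ar 0 (a x) \<le> ar 0 (a y)" using az[of x] az[of y] by (intro ar_mono) auto
    then show ?thesis unfolding e True using k by (intro add_right_mono mult_left_mono)
  next
    case False
    then have "n x + 1 \<le> n y" using n by simp
    then have "of_int (n x) + 1 \<le> (of_int (n y) :: real)" by (metis of_int_1 of_int_add of_int_le_iff)
    then have 1: "2 * pi * (of_int (n x) + 1) \<le> 2 * pi * of_int (n y)" by (intro mult_left_mono) simp_all
    have "ar 0 (a x) \<le> L" using az[of x] by (intro ar_mono) auto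
    then have "2 * pi / L * ar 0 (a x) \<le> 2 * pi / L * L" using k by (intro mult_left_mono)
    then have "2 * pi / L * ar 0 (a x) \<le> 2 * pi" using L_pos by simp
    moreover have "0 \<le> 2 * pi / L * ar 0 (a y)" using k ar_nonneg by simp
    ultimately show ?thesis unfolding e using 1 by (simp add: distrib_left)
  qed
qed

text \<open>The change of parameter is in general not invertible; approximating diffeomorphisms are, and it is their inverses
  that bring \<open>c\<close> close to \<open>g\<close>.\<close>

lemma frechet_approx:
  assumes \<epsilon>: "\<epsilon> > 0"
  shows "\<exists>\<phi>\<in>diff_circle. \<forall>u. norm (c (\<phi> u) - g u) \<le> \<epsilon>"
proof -
  obtain \<delta> where \<delta>: "\<delta> > 0" "\<forall>x y. \<bar>x - y\<bar> < \<delta> \<longrightarrow> norm (g x - g y) \<le> \<epsilon>"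
    using periodic_modulus[OF _ g_continuous g_periodic \<epsilon>] by auto
  obtain \<Phi> where \<Phi>: "\<Phi> \<in> diff_circle" "\<forall>u. \<bar>\<Phi> u - (u + shift u)\<bar> \<le> \<delta> / 2"
    using monotone_map_approx_diff_circle[OF shift_continuous shift_periodic shift_mono, of "\<delta> / 2"] \<delta>(1) by auto
  show ?thesis
  proof (rule bexI[OF _ diff_circle_inv(1)[OF \<Phi>(1)]], rule allI)
    fix u
    have "\<bar>u - (inv \<Phi> u + shift (inv \<Phi> u))\<bar> \<le> \<delta> / 2"
      using \<Phi>(2)[rule_format, of "inv \<Phi> u"] diff_circle_inv(2)[OF \<Phi>(1)] by simp
    then have "\<bar>(inv \<Phi> u + shift (inv \<Phi> u)) - u\<bar> < \<delta>" using \<delta>(1) by (simp add: abs_minus_commute)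
    then show "norm (c (inv \<Phi> u) - g u) \<le> \<epsilon>"
      using \<delta>(2) g_shift[of "inv \<Phi> u"] by metis
  qed
qed

text \<open>Arc length is additive, so \<open>g\<close> cannot have a Lipschitz constant smaller than its speed on any interval.\<close>

lemma g_not_shorter:
  assumes ab: "0 \<le> a" "a < b" "b \<le> 2 * pi"
    and lip: "\<And>x y. a \<le> x \<Longrightarrow> x \<le> y \<Longrightarrow> y \<le> b \<Longrightarrow> norm (g y - g x) \<le> K * (y - x)"
  shows "L / (2 * pi) \<le> K"
proof -
  define k where "k = L / (2 * pi)"
  have k: "k > 0" "k * (2 * pi) = L" using L_pos by (simp_all add: k_def)
  have "k * t \<in> {0..L}" if "0 \<le> t" "t \<le> 2 * pi" for t
    using that k mult_left_mono[of t "2 * pi" k] by simp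
  then have range: "k * a \<in> {0..L}" "k * b \<in> {0..L}" using ab by simp_all
  obtain u where u: "u \<in> {0..2*pi}" "ar 0 u = k * a" by (rule ar_surj[OF range(1)])
  obtain v where v: "v \<in> {0..2*pi}" "ar 0 v = k * b" by (rule ar_surj[OF range(2)])
  have "k * a < k * b" using k ab by simp
  then have uv: "u \<le> v" using ar_mono[of v u] u v by (metis atLeastAtMost_iff leD linear)
  have c: "c x = g (ar 0 x / k)" if "x \<in> {0..2*pi}" for x
    using \<gamma>_arc_parametrization that k by (simp add: arc_parametrization_def total_length g_def k_def[symmetric])
  have "ar u v \<le> K / k * ar 0 v - K / k * ar 0 u"
  proof (rule ar_le_increment)
    fix x y assume xy: "u \<le> x" "x \<le> y" "y \<le> v"
    have uv': "0 \<le> u" "v \<le> 2 * pi" using u v by simp_all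
    have m: "ar 0 u \<le> ar 0 x" "ar 0 x \<le> ar 0 y" "ar 0 y \<le> ar 0 v"
      using xy uv' by (intro ar_mono; linarith)+
    have "dist (c x) (c y) = norm (g (ar 0 y / k) - g (ar 0 x / k))"
      using xy u v by (simp add: c dist_norm norm_minus_commute)
    also have "\<dots> \<le> K * (ar 0 y / k - ar 0 x / k)"
      using m u(2) v(2) k(1) by (intro lip) (simp_all add: pos_le_divide_eq pos_divide_le_eq divide_right_mono mult.commute)
    also have "\<dots> = K / k * ar 0 y - K / k * ar 0 x" by (simp add: right_diff_distrib)
    finally show "dist (c x) (c y) \<le> K / k * ar 0 y - K / k * ar 0 x" .
  qed (use u v uv in auto)
  moreover have "ar u v = k * b - k * a" using ar_additive[of 0 u v] u v uv by auto
  ultimately have "k * b - k * a \<le> K / k * (k * b) - K / k * (k * a)" using u v by simp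
  then have "k * (b - a) \<le> K * (b - a)" using k(1) by (simp add: algebra_simps)
  then have "k \<le> K" using ab by simp
  then show ?thesis unfolding k_def .
qed

text \<open>Mollifications of \<open>\<gamma>\<close> have uniformly bounded bending, so \<open>minimizing_loops\<close> applies to \<open>\<gamma>\<close>.\<close>

lemma smooth_approximations:
  assumes \<kappa>: "weak_curvature c \<kappa>" "weak_energy c \<kappa> < \<infinity>"
  shows "\<exists>cs B. (\<forall>j. cs j \<in> smooth_loops (2 * pi)) \<and> (\<forall>j u. norm (cs j u - g u) \<le> inverse (real (Suc j)))
    \<and> (\<forall>j. bending (2 * pi) (cs j) \<le> B)
    \<and> (\<forall>\<epsilon>>0. \<exists>N. \<forall>i\<ge>N. \<forall>j\<ge>N. bending (2 * pi) (\<lambda>t. cs i t - cs j t) < \<epsilon>)"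
proof -
  have w: "weak_second_derivative L \<gamma> \<kappa>"
    using \<kappa>(1) arc_parametrization_unique unfolding weak_curvature_def total_length by blast
  have fin: "(\<integral>\<^sup>+ s\<in>{0..L}. ennreal ((norm (\<kappa> s))\<^sup>2) \<partial>lebesgue) < \<infinity>"
    using \<kappa>(2) by (simp add: weak_energy_def total_length)
  define B where "B = enn2real (\<integral>\<^sup>+ s\<in>{0..L}. ennreal ((norm (\<kappa> s))\<^sup>2) \<partial>lebesgue)"
  obtain \<eta> where \<eta>: "\<And>j. \<eta> j \<in> smooth_loops L" "\<And>j t. norm (\<eta> j t - \<gamma> t) \<le> inverse (real (Suc j))"
    "\<And>j. bending L (\<eta> j) \<le> B + 1"
    "\<And>\<epsilon>. \<epsilon> > 0 \<Longrightarrow> \<exists>N. \<forall>i\<ge>N. \<forall>j\<ge>N. bending L (\<lambda>t. \<eta> i t - \<eta> j t) < \<epsilon>"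
    using minimizing_loops[OF approximation_of_weak_curvature[OF L_pos \<gamma>_continuous \<gamma>_periodic w fin]]
    unfolding B_def by blast
  define k where "k = L / (2 * pi)"
  have k: "k > 0" "k * (2 * pi) = L" using L_pos by (simp_all add: k_def)
  define cs where "cs j u = \<eta> j (k * u)" for j u
  have sm: "smooth (\<eta> j)" for j by (rule smooth_loopsD(1)[OF \<eta>(1)])
  have bend: "bending (2 * pi) (cs j) = k ^ 3 * bending L (\<eta> j)" for j
    using bending_scale[OF k(1) sm, of "2 * pi" j] k(2) by (simp add: cs_def[abs_def])
  have bend2: "bending (2 * pi) (\<lambda>t. cs i t - cs j t) = k ^ 3 * bending L (\<lambda>t. \<eta> i t - \<eta> j t)" for i j
    using bending_scale[OF k(1) smooth_diff[OF sm sm], of "2 * pi" i j] k(2) by (simp add: cs_def[abs_def])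
  show ?thesis
  proof (intro exI[of _ cs] exI[of _ "k ^ 3 * (B + 1)"] conjI allI impI)
    fix j
    have "\<eta> j (k * (u + 2 * pi)) = \<eta> j (k * u)" for u
      using smooth_loopsD(2)[OF \<eta>(1)[of j]] k(2) by (simp add: periodic_def distrib_left)
    then show "cs j \<in> smooth_loops (2 * pi)"
      using smooth_compose[OF sm[of j] smooth_mult[OF smooth_const smooth_id, of k]]
      by (simp add: smooth_loops_def periodic_def cs_def[abs_def])
    show "norm (cs j u - g u) \<le> inverse (real (Suc j))" for u
      using \<eta>(2)[of j "k * u"] by (simp add: cs_def g_def k_def)
    show "bending (2 * pi) (cs j) \<le> k ^ 3 * (B + 1)"
      unfolding bend using \<eta>(3) k(1) by (intro mult_left_mono) simp_all
    fix \<epsilon> :: real assume "\<epsilon> > 0"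
    then obtain N where N: "\<forall>i\<ge>N. \<forall>j\<ge>N. bending L (\<lambda>t. \<eta> i t - \<eta> j t) < \<epsilon> / k ^ 3"
      using \<eta>(4)[of "\<epsilon> / k ^ 3"] k(1) by auto
    show "\<exists>N. \<forall>i\<ge>N. \<forall>j\<ge>N. bending (2 * pi) (\<lambda>t. cs i t - cs j t) < \<epsilon>"
    proof (intro exI[of _ N] allI impI)
      fix i j assume "N \<le> i" "N \<le> j"
      then have "bending L (\<lambda>t. \<eta> i t - \<eta> j t) < \<epsilon> / k ^ 3" using N by blast
      then show "bending (2 * pi) (\<lambda>t. cs i t - cs j t) < \<epsilon>"
        unfolding bend2 using k(1) by (simp add: pos_less_divide_eq mult.commute)
    qed
  qed
qed

text \<open>The target speed is \<open>4 m\<close> with \<open>m = L / (8 \<pi>)\<close>. If one curve had speed below \<open>2 m\<close> somewhere, hence on an interval,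
  then all those of index at least \<open>N\<close>, and in the limit \<open>g\<close>, would have Lipschitz constant \<open>3 m\<close> there.\<close>

lemma eventually_uniformly_immersed:
  assumes cs: "\<And>j. cs j \<in> smooth_loops (2 * pi)" and near: "\<And>j u. norm (cs j u - g u) \<le> inverse (real (Suc j))"
    and diff: "\<And>i j u. i \<ge> N \<Longrightarrow> j \<ge> N \<Longrightarrow> norm (vd (cs i) u - vd (cs j) u) \<le> L / (8 * pi)"
    and j: "j \<ge> N"
  shows "norm (vd (cs j) u) \<ge> 2 * (L / (8 * pi))"
proof (rule ccontr)
  define m where "m = L / (8 * pi)"
  have m: "m > 0" using L_pos by (simp add: m_def)
  note sm = smooth_loopsD[OF cs]
  assume neg: "\<not> ?thesis"
  define w where "w = u - 2 * pi * of_int \<lfloor>u / (2 * pi)\<rfloor>"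
  have w: "w \<in> {0..<2*pi}" unfolding w_def by (rule periodic_reduce) simp
  have "vd (cs j) w = vd (cs j) u"
    using periodic_int[OF vd_periodic[OF sm], of j w "\<lfloor>u / (2 * pi)\<rfloor>"] by (simp add: w_def)
  then have small: "norm (vd (cs j) w) < 2 * m" using neg by (simp add: m_def)
  have "isCont (\<lambda>x. norm (vd (cs j) x)) w"
    using smooth_continuous[OF smooth_vd[OF sm(1)], of UNIV j]
    by (intro continuous_intros) (simp add: continuous_on_eq_continuous_at)
  then have "eventually (\<lambda>x. norm (vd (cs j) x) < 2 * m) (at w)"
    using small by (intro order_tendstoD(2)) (auto simp: isCont_def)
  then obtain d where d: "d > 0" "\<And>x. x \<noteq> w \<Longrightarrow> dist x w < d \<Longrightarrow> norm (vd (cs j) x) < 2 * m"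
    unfolding eventually_at by auto
  define b where "b = min (w + d / 2) (2 * pi)"
  have b: "w < b" "b \<le> 2 * pi" "b \<le> w + d / 2" using w d(1) by (auto simp: b_def)
  have sp: "norm (vd (cs i) x) \<le> 3 * m" if "x \<in> {w..b}" "i \<ge> N" for x i
  proof -
    have "norm (vd (cs j) x) < 2 * m"
      using d(2)[of x] small that(1) b d(1) by (cases "x = w") (auto simp: dist_real_def)
    moreover have "norm (vd (cs i) x - vd (cs j) x) \<le> m" unfolding m_def by (rule diff[OF that(2) j])
    moreover have "norm (vd (cs i) x) \<le> norm (vd (cs i) x - vd (cs j) x) + norm (vd (cs j) x)"
      using norm_triangle_ineq[of "vd (cs i) x - vd (cs j) x" "vd (cs j) x"] by simp
    ultimately show ?thesis by linarith
  qed
  have "L / (2 * pi) \<le> 3 * m"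
  proof (rule g_not_shorter[of w b])
    fix x y assume xy: "w \<le> x" "x \<le> y" "y \<le> b"
    have lip: "norm (cs i y - cs i x) \<le> 3 * m * (y - x)" if i: "i \<ge> N" for i
    proof -
      have "(vd (cs i) has_integral (cs i y - cs i x)) {x..y}"
        by (rule fundamental_theorem_of_calculus[OF xy(2)]) (rule has_vector_derivative_at_within[OF smooth_has_vd[OF sm(1)]])
      then have "norm (cs i y - cs i x) = norm (integral {x..y} (vd (cs i)))" by (simp add: integral_unique)
      also have "\<dots> \<le> integral {x..y} (\<lambda>_. 3 * m)"
        using sp[OF _ i] xy
        by (intro integral_norm_bound_integral integrable_continuous_real continuous_on_const smooth_continuous[OF smooth_vd[OF sm(1)]]) auto
      finally show ?thesis using xy by (simp add: mult_ac)
    qed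
    have lim: "(\<lambda>i. cs i z) \<longlonglongrightarrow> g z" for z
    proof -
      have "(\<lambda>i. cs i z - g z) \<longlonglongrightarrow> 0"
        by (rule tendsto_norm_zero_cancel, rule tendsto_sandwich[OF _ _ tendsto_const LIMSEQ_inverse_real_of_nat])
          (use near in auto)
      then show ?thesis by (simp add: LIM_zero_iff)
    qed
    have "(\<lambda>i. norm (cs i y - cs i x)) \<longlonglongrightarrow> norm (g y - g x)" by (intro tendsto_intros lim)
    then show "norm (g y - g x) \<le> 3 * m * (y - x)"
      by (rule LIMSEQ_le_const2) (use lip in blast)
  qed (use w b in auto)
  moreover have "L / (2 * pi) = 4 * m" by (simp add: m_def)
  ultimately show False using m by simp
qed

text \<open>Speeds at least \<open>2 m\<close> and derivatives within \<open>m\<close> of each other keep the straight homotopies immersed with speed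
  at least \<open>m\<close>; their lengths tend to zero by \<open>H2_dist_linear_path\<close>.\<close>

lemma approximable_by_Cauchy_sequence:
  assumes lam: "lam > 0" and \<kappa>: "weak_curvature c \<kappa>" "weak_energy c \<kappa> < \<infinity>"
  shows "\<exists>cs. (\<forall>k. cs k \<in> immersed_curves) \<and> H2_Cauchy lam cs \<and> (\<lambda>k. frechet_dist (cs k) c) \<longlonglongrightarrow> 0"
proof -
  obtain cs B where cs: "\<And>j. cs j \<in> smooth_loops (2 * pi)"
    and near: "\<And>j u. norm (cs j u - g u) \<le> inverse (real (Suc j))"
    and B: "\<And>j. bending (2 * pi) (cs j) \<le> B"
    and Cauchy: "\<And>\<epsilon>. \<epsilon> > 0 \<Longrightarrow> \<exists>N. \<forall>i\<ge>N. \<forall>j\<ge>N. bending (2 * pi) (\<lambda>t. cs i t - cs j t) < \<epsilon>"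
    using smooth_approximations[OF \<kappa>] by blast
  note sm = smooth_loopsD[OF cs]
  define m where "m = L / (8 * pi)"
  have m: "m > 0" using L_pos by (simp add: m_def)
  have B0: "B \<ge> 0" using order_trans[OF bending_nonneg[OF sm(1)] B] .
  obtain N where N: "\<And>i j. i \<ge> N \<Longrightarrow> j \<ge> N \<Longrightarrow> bending (2 * pi) (\<lambda>t. cs i t - cs j t) < m\<^sup>2 / (2 * pi)"
    using Cauchy[of "m\<^sup>2 / (2 * pi)"] m by (auto simp: zero_less_divide_iff)
  have diff: "norm (vd (cs i) u - vd (cs j) u) \<le> m" if "i \<ge> N" "j \<ge> N" for i j u
  proof -
    have "vd (\<lambda>t. cs i t - cs j t) u = vd (cs i) u - vd (cs j) u"
      using has_vector_derivative_diff[OF smooth_has_vd[OF sm(1)] smooth_has_vd[OF sm(1)]] by (rule vector_derivative_at)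
    then have "norm (vd (cs i) u - vd (cs j) u) \<le> sqrt (2 * pi * bending (2 * pi) (\<lambda>t. cs i t - cs j t))"
      using smooth_loop_derivative_bound[OF smooth_loops_diff[OF cs cs], of i j u] by simp
    also have "\<dots> \<le> sqrt (m\<^sup>2)"
      using N[OF that] by (intro real_sqrt_le_mono) (simp add: pos_less_divide_eq mult.commute)
    finally show ?thesis using m by simp
  qed
  have low: "2 * m \<le> norm (vd (cs j) u)" if "j \<ge> N" for j u
    using eventually_uniformly_immersed[where N=N, OF cs near diff[unfolded m_def] that] by (simp add: m_def)
  obtain A where A: "norm (vd (cs N) u) \<le> A" for u
    using periodic_bounded[OF _ smooth_continuous[OF smooth_vd[OF sm(1)]] vd_periodic[OF sm]] by auto
  define M where "M = A + 2 * m"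
  have path: "m \<le> norm (vd (cs i) u + v *\<^sub>R (vd (cs j) u - vd (cs i) u))"
    "norm (vd (cs i) u + v *\<^sub>R (vd (cs j) u - vd (cs i) u)) \<le> M"
    if ij: "i \<ge> N" "j \<ge> N" and v: "v \<in> {0..1}" for i j u v
  proof -
    have "norm (v *\<^sub>R (vd (cs j) u - vd (cs i) u)) \<le> 1 * m"
      unfolding norm_scaleR using v diff[OF ij(2,1), of u] by (intro mult_mono) auto
    then have d: "norm (v *\<^sub>R (vd (cs j) u - vd (cs i) u)) \<le> m" by simp
    have "norm (vd (cs i) u) \<le> norm (vd (cs i) u - vd (cs N) u) + norm (vd (cs N) u)"
      using norm_triangle_ineq[of "vd (cs i) u - vd (cs N) u" "vd (cs N) u"] by simp
    then have up: "norm (vd (cs i) u) \<le> m + A" using diff[OF ij(1), of N u] A[of u] by simp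
    show "m \<le> norm (vd (cs i) u + v *\<^sub>R (vd (cs j) u - vd (cs i) u))"
      using norm_diff_ineq[of "vd (cs i) u" "v *\<^sub>R (vd (cs j) u - vd (cs i) u)"] low[OF ij(1), of u] d by linarith
    show "norm (vd (cs i) u + v *\<^sub>R (vd (cs j) u - vd (cs i) u)) \<le> M"
      using norm_triangle_ineq[of "vd (cs i) u" "v *\<^sub>R (vd (cs j) u - vd (cs i) u)"] up d unfolding M_def by linarith
  qed
  have close: "norm (cs j u - cs i u) \<le> 2 * inverse (real (Suc n))" if "i \<ge> n" "j \<ge> n" for i j n u
  proof -
    have *: "norm (cs l u - g u) \<le> inverse (real (Suc n))" if "l \<ge> n" for l
      using order_trans[OF near[of l u], of "inverse (real (Suc n))"] that by (simp add: le_imp_inverse_le)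
    have "norm (cs j u - cs i u) \<le> norm (cs j u - g u) + norm (cs i u - g u)"
      using norm_triangle_ineq4[of "cs j u - g u" "cs i u - g u"] by simp
    also have "\<dots> \<le> inverse (real (Suc n)) + inverse (real (Suc n))" by (intro add_mono * that)
    finally show ?thesis by simp
  qed
  define K where "K = linear_path_const lam m M B"
  have M0: "M > 0" using m order_trans[OF norm_ge_zero A] by (simp add: M_def add_nonneg_pos)
  have K: "K \<ge> 0" using lam m M0 B0 by (simp add: K_def linear_path_const_def)
  have imm: "cs i \<in> immersed_curves" if "i \<ge> N" for i
    unfolding immersed_curves_def
  proof (intro CollectI conjI allI sm)
    show "vd (cs i) u \<noteq> 0" for u using low[OF that, of u] m by auto
  qed
  have H2: "\<exists>N'. \<forall>i\<ge>N'. \<forall>j\<ge>N'. i \<ge> N \<longrightarrow> j \<ge> N \<longrightarrow> H2_dist lam (cs i) (cs j) < ennreal \<epsilon>" if \<epsilon>: "\<epsilon> > 0" for \<epsilon>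
  proof -
    define b where "b = min 1 (\<epsilon>\<^sup>2 / (4 * (K + 1)))"
    have b: "b > 0" "b \<le> 1" using \<epsilon> K by (auto simp: b_def)
    have Kb: "K * b \<le> \<epsilon>\<^sup>2 / 4"
    proof -
      have "b \<le> \<epsilon>\<^sup>2 / (4 * (K + 1))" unfolding b_def by (rule min.cobounded2)
      then have "K * b \<le> (K + 1) * (\<epsilon>\<^sup>2 / (4 * (K + 1)))" using K b by (intro mult_mono) simp_all
      also have "\<dots> = \<epsilon>\<^sup>2 / 4"
      proof -
        have "K + 1 \<noteq> 0" using K by simp
        then show ?thesis by (simp add: divide_simps)
      qed
      finally show ?thesis .
    qed
    obtain N1 where N1: "\<forall>i\<ge>N1. \<forall>j\<ge>N1. bending (2 * pi) (\<lambda>t. cs i t - cs j t) < b" using Cauchy[OF b(1)] by blast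
    obtain n where n: "inverse (real (Suc n)) < \<epsilon> / 4" using reals_Archimedean[of "\<epsilon> / 4"] \<epsilon> by auto
    show ?thesis
    proof (intro exI[of _ "max N1 n"] allI impI)
      fix i j assume ij: "max N1 n \<le> i" "max N1 n \<le> j" "N \<le> i" "N \<le> j"
      have "H2_dist lam (cs i) (cs j) \<le> ennreal (sqrt ((2 * inverse (real (Suc n)))\<^sup>2 + linear_path_const lam m M B * b))"
      proof (rule H2_dist_linear_path(3)[OF lam cs cs m path(1)[OF ij(3,4)] path(2)[OF ij(3,4)] close _ _ b(2)])
        show "bending (2 * pi) (\<lambda>u. cs j u - cs i u) \<le> b" using N1 ij by (intro less_imp_le) simp
      qed (use ij B in simp_all)
      also have "\<dots> < ennreal \<epsilon>"
      proof (rule ennreal_lessI[OF \<epsilon>], rule real_less_lsqrt)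
        have "(2 * inverse (real (Suc n)))\<^sup>2 \<le> (\<epsilon> / 2)\<^sup>2" using n by (intro power_mono) simp_all
        also have "\<dots> = \<epsilon>\<^sup>2 / 4" by (simp add: power_divide)
        finally have "(2 * inverse (real (Suc n)))\<^sup>2 + K * b \<le> \<epsilon>\<^sup>2 / 4 + \<epsilon>\<^sup>2 / 4" using Kb by (rule add_mono)
        also have "\<dots> < \<epsilon>\<^sup>2" using zero_less_power[OF \<epsilon>, of 2] by linarith
        finally show "(2 * inverse (real (Suc n)))\<^sup>2 + linear_path_const lam m M B * b < \<epsilon>\<^sup>2" by (simp only: K_def)
      qed (use \<epsilon> in simp_all)
      finally show "H2_dist lam (cs i) (cs j) < ennreal \<epsilon>" .
    qed
  qed
  define cs' where "cs' k = cs (k + N)" for k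
  have "H2_Cauchy lam cs'"
    unfolding H2_Cauchy_def
  proof (intro allI impI)
    fix \<epsilon> :: real assume "\<epsilon> > 0"
    then obtain N' where N': "\<forall>i\<ge>N'. \<forall>j\<ge>N'. i \<ge> N \<longrightarrow> j \<ge> N \<longrightarrow> H2_dist lam (cs i) (cs j) < ennreal \<epsilon>" using H2 by blast
    show "\<exists>N. \<forall>i\<ge>N. \<forall>j\<ge>N. H2_dist lam (cs' i) (cs' j) < ennreal \<epsilon>"
      using N' by (intro exI[of _ N']) (simp add: cs'_def)
  qed
  moreover have "(\<lambda>k. frechet_dist (cs' k) c) \<longlonglongrightarrow> 0"
  proof (rule tendsto_sandwich[of "\<lambda>_. 0" _ _ "\<lambda>k. ennreal (inverse (real (Suc k)) + inverse (real (Suc k)))"])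
    show "eventually (\<lambda>k. frechet_dist (cs' k) c \<le> ennreal (inverse (real (Suc k)) + inverse (real (Suc k)))) sequentially"
    proof (intro always_eventually allI)
      fix k
      obtain \<phi> where \<phi>: "\<phi> \<in> diff_circle" "\<forall>u. norm (c (\<phi> u) - g u) \<le> inverse (real (Suc k))"
        using frechet_approx[of "inverse (real (Suc k))"] by auto
      show "frechet_dist (cs' k) c \<le> ennreal (inverse (real (Suc k)) + inverse (real (Suc k)))"
        unfolding frechet_dist_def
      proof (rule INF_lower2[OF \<phi>(1)], rule SUP_least, rule ennreal_leI)
        fix u
        have "norm (cs' k u - g u) \<le> inverse (real (Suc (k + N)))" unfolding cs'_def by (rule near)
        also have "\<dots> \<le> inverse (real (Suc k))" by (intro le_imp_inverse_le) simp_all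
        finally have 1: "norm (cs' k u - g u) \<le> inverse (real (Suc k))" .
        have "norm (c (\<phi> u) - cs' k u) \<le> norm (c (\<phi> u) - g u) + norm (cs' k u - g u)"
          using norm_triangle_ineq4[of "c (\<phi> u) - g u" "cs' k u - g u"] by simp
        also have "\<dots> \<le> inverse (real (Suc k)) + inverse (real (Suc k))" using \<phi>(2) 1 by (intro add_mono) simp_all
        finally show "norm (c (\<phi> u) - cs' k u) \<le> inverse (real (Suc k)) + inverse (real (Suc k))" .
      qed
    qed
    have "(\<lambda>k. ennreal (inverse (real (Suc k)) + inverse (real (Suc k)))) \<longlonglongrightarrow> ennreal (0 + 0)"
      by (intro tendsto_ennrealI tendsto_add LIMSEQ_inverse_real_of_nat)
    then show "(\<lambda>k. ennreal (inverse (real (Suc k)) + inverse (real (Suc k)))) \<longlonglongrightarrow> 0" by simp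
  qed simp_all
  moreover have "cs' k \<in> immersed_curves" for k unfolding cs'_def by (rule imm) simp
  ultimately show ?thesis by blast
qed

end

theorem theorem3p12:
  fixes lam :: real
  assumes "CARD('n) \<ge> 2" and "lam > 0"
  shows
    "((\<forall>c \<in> (immersed_curves :: (real \<Rightarrow> real ^ 'n) set).
         \<exists>K. lipschitz_near (H2_dist lam) immersed_curves energy c K) \<and>
      (\<exists>K :: real \<Rightarrow> real. \<forall>c \<in> (immersed_curves :: (real \<Rightarrow> real ^ 'n) set).
         lipschitz_near (H2_dist lam) immersed_curves energy c (K (len c) * (1 + energy c))))
     \<and>
     (\<forall>(cs :: nat \<Rightarrow> real \<Rightarrow> real ^ 'n) c.
        (\<forall>k. cs k \<in> immersed_curves) \<and> H2_Cauchy lam cs \<and>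
        rectifiable_closed_curve c \<and> nonconstant c \<and>
        (\<lambda>k. frechet_dist (cs k) c) \<longlonglongrightarrow> 0 \<longrightarrow>
        (\<exists>\<kappa>. weak_curvature c \<kappa> \<and> weak_energy c \<kappa> < \<infinity>))
     \<and>
     (\<forall>c :: real \<Rightarrow> real ^ 'n.
        rectifiable_closed_curve c \<and> nonconstant c \<and>
        (\<exists>\<kappa>. weak_curvature c \<kappa> \<and> weak_energy c \<kappa> < \<infinity>) \<longrightarrow>
        (\<exists>cs. (\<forall>k. cs k \<in> immersed_curves) \<and> H2_Cauchy lam cs \<and>
              (\<lambda>k. frechet_dist (cs k) c) \<longlonglongrightarrow> 0))"
proof (intro conjI ballI allI impI)
  define K where "K l = exp (energy_rate lam (l / 4) * (sqrt lam * (l / 4)))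
    * (energy_rate lam (l / 4) + 1 / (sqrt lam * (l / 4)))" for l
  have lip: "lipschitz_near (H2_dist lam) immersed_curves energy c (K (len c) * (1 + energy c))"
    if "c \<in> immersed_curves" for c :: "real \<Rightarrow> real ^ 'n"
    using energy_lipschitz_near[OF assms(2) that] unfolding K_def .
  then show "\<exists>K. lipschitz_near (H2_dist lam) immersed_curves energy c K"
    if "c \<in> immersed_curves" for c :: "real \<Rightarrow> real ^ 'n"
    using that by blast
  show "\<exists>K :: real \<Rightarrow> real. \<forall>c \<in> (immersed_curves :: (real \<Rightarrow> real ^ 'n) set).
         lipschitz_near (H2_dist lam) immersed_curves energy c (K (len c) * (1 + energy c))"
    using lip by blast
next
  fix cs :: "nat \<Rightarrow> real \<Rightarrow> real ^ 'n" and c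
  assume h: "(\<forall>k. cs k \<in> immersed_curves) \<and> H2_Cauchy lam cs \<and>
        rectifiable_closed_curve c \<and> nonconstant c \<and> (\<lambda>k. frechet_dist (cs k) c) \<longlonglongrightarrow> 0"
  then interpret rectifiable_loop c by unfold_locales auto
  show "\<exists>\<kappa>. weak_curvature c \<kappa> \<and> weak_energy c \<kappa> < \<infinity>"
    using h by (intro weak_curvature_of_Cauchy_limit[OF assms(2), of cs]) auto
next
  fix c :: "real \<Rightarrow> real ^ 'n"
  assume h: "rectifiable_closed_curve c \<and> nonconstant c \<and> (\<exists>\<kappa>. weak_curvature c \<kappa> \<and> weak_energy c \<kappa> < \<infinity>)"
  then interpret rectifiable_loop c by unfold_locales auto
  show "\<exists>cs. (\<forall>k. cs k \<in> immersed_curves) \<and> H2_Cauchy lam cs \<and> (\<lambda>k. frechet_dist (cs k) c) \<longlonglongrightarrow> 0"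
    using h approximable_by_Cauchy_sequence[OF assms(2)] by blast
qed

end
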